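(* Let $W\subseteq\mathbb{K}^E$ be a realization of a matroid $\mathsf{M}$ without loops. Suppose that $\mathsf{M}=\bigoplus_{i=1}^n\mathsf{M}_i$ decomposes into connected components $\mathsf{M}_i$ on $E_i$, where $E=E_1\sqcup\dots\sqcup E_n$. Let $W=\bigoplus_{i=1}^nW_i$ be the induced decomposition into $W_i\subseteq\mathbb{K}^{E_i}$. Then $X_W$ is the reduced union of the integral schemes $X_{W_i}\times\mathbb{K}^{E\setminus E_i}$, and $\Sigma_W$ is the union of the schemes $\Sigma_{W_i}\times\mathbb{K}^{E\setminus E_i}$ and of the integral schemes $X_{W_i}\times X_{W_j}\times\mathbb{K}^{E\setminus(E_i\cup E_j)}$ for $i\ne j$. The same holds for $\Sigma$ replaced by $\Delta$. In particular, $X_W$ is generically smooth over $\mathbb{K}$.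
   Context: $\mathbb{K}$ is a field and $E$ a finite set, regarded as the standard basis of $\mathbb{K}^E$, with coordinates $x_e=e^\vee$ and $\mathbb{K}[x]=\mathbb{K}[x_e\mid e\in E]$; $\mathbb{K}^E$ is identified with $\operatorname{Spec}\mathbb{K}[x]$. A subspace $W\subseteq\mathbb{K}^E$ (a configuration) is a realization of the matroid $\mathsf{M}$ on $E$ if the independent sets of $\mathsf{M}$ are exactly the $S\subseteq E$ such that the family $(e^\vee|_W)_{e\in S}$ is linearly independent in $W^\vee$. Then $r:=\dim W=\operatorname{rk}\mathsf{M}$. If $\mathsf{M}=\bigoplus_i\mathsf{M}_i$ with underlying partition $E=\bigsqcup_iE_i$, then $W=\bigoplus_iW_i$ where $W_i:=W\cap\mathbb{K}^{E_i}$ realizes $\mathsf{M}_i$; this is the induced decomposition. For a basis $w^1,\dots,w^r$ of $W$ and $w^i_e=e^\vee(w^i)$, let $Q_W=\big(\sum_{e}x_e w^i_e w^j_e\big)_{i,j}$ and let $\psi_W=\det Q_W=\sum_B\det\big((w^i_e)_{i,\,e\in B}\big)^2\prod_{e\in B}x_e$ (sum over bases $B$ of $\mathsf{M}$) be the configuration polynomial, well defined up to a square factor in $\mathbb{K}^*$. Let $J_W$ be the ideal generated by $\psi_W$ and all its partial derivatives, and $M_W$ the ideal of submaximal (size $r-1$) minors of $Q_W$ (the first Fitting ideal of $\operatorname{coker}Q_W$; $M_W=\mathbb{K}[x]$ if $r\le1$). Put $X_W=\operatorname{Spec}(\mathbb{K}[x]/\langle\psi_W\rangle)$, $\Sigma_W=\operatorname{Spec}(\mathbb{K}[x]/J_W)$,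 $\Delta_W=\operatorname{Spec}(\mathbb{K}[x]/M_W)$, closed subschemes of $\mathbb{K}^E$; similarly for $W_i\subseteq\mathbb{K}^{E_i}$. Unions of closed subschemes are scheme-theoretic (defined by the intersection of the defining ideals), and products are over $\mathbb{K}$. *)

theory Defs
  imports
    Jordan_Normal_Form.Determinant
    "HOL-Algebra.QuotRing"
    "HOL-Library.Poly_Mapping"
    "HOL-Library.Function_Algebras"
    "HOL-Library.Disjoint_Sets"
begin

section \<open>Matroids\<close>

text \<open>A matroid on \<open>E\<close> is given by its ground set and its family of independent sets.\<close>

definition matroid :: "'e set \<Rightarrow> 'e set set \<Rightarrow> bool" where
  "matroid E Ind \<longleftrightarrow>
     finite E \<and> Ind \<subseteq> Pow E \<and> {} \<in> Ind \<and>
     (\<forall>S\<in>Ind. \<forall>T\<subseteq>S. T \<in> Ind) \<and>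
     (\<forall>S\<in>Ind. \<forall>T\<in>Ind. card S < card T \<longrightarrow> (\<exists>e\<in>T - S. insert e S \<in> Ind))"

definition loopless :: "'e set \<Rightarrow> 'e set set \<Rightarrow> bool" where
  "loopless E Ind \<longleftrightarrow> (\<forall>e\<in>E. {e} \<in> Ind)"

definition matroid_direct_sum ::
  "'i set \<Rightarrow> ('i \<Rightarrow> 'e set) \<Rightarrow> ('i \<Rightarrow> 'e set set) \<Rightarrow> 'e set \<Rightarrow> 'e set set \<Rightarrow> bool" where
  "matroid_direct_sum N Es Inds E Ind \<longleftrightarrow>
     disjoint_family_on Es N \<and> E = (\<Union>i\<in>N. Es i) \<and>
     Ind = {\<Union>i\<in>N. S i | S. \<forall>i\<in>N. S i \<in> Inds i}"

text \<open>The matroid on the empty set is not counted as connected, so that connected components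
  have nonempty ground sets.\<close>

definition connected_matroid :: "'e set \<Rightarrow> 'e set set \<Rightarrow> bool" where
  "connected_matroid E Ind \<longleftrightarrow> matroid E Ind \<and> E \<noteq> {} \<and>
     \<not> (\<exists>Es Inds. (\<forall>i\<in>{1, 2::nat}. matroid (Es i) (Inds i) \<and> Es i \<noteq> {}) \<and>
          matroid_direct_sum {1, 2} Es Inds E Ind)"

section \<open>Configurations and their matroids\<close>

interpretation fun_vs: vector_space "\<lambda>(c::'k::field) (v::'e \<Rightarrow> 'k) e. c * v e"
  by unfold_locales (simp_all add: fun_eq_iff algebra_simps)

text \<open>\<open>\<bbbK>\<^sup>E\<close> as the functions vanishing off \<open>E\<close>; thus \<open>\<bbbK>\<^sup>F \<subseteq> \<bbbK>\<^sup>E\<close> for \<open>F \<subseteq> E\<close>.\<close>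

definition coord_space :: "'e set \<Rightarrow> ('e \<Rightarrow> 'k::field) set" where
  "coord_space E = {v. \<forall>e. e \<notin> E \<longrightarrow> v e = 0}"

text \<open>Linear independence in the dual of \<open>W\<close> of the family (not the set) of restrictions
  to \<open>W\<close> of the coordinate functions \<open>v \<mapsto> v e\<close>, \<open>e \<in> S\<close>.\<close>

definition coords_independent :: "('e \<Rightarrow> 'k::field) set \<Rightarrow> 'e set \<Rightarrow> bool" where
  "coords_independent W S \<longleftrightarrow>
     (\<forall>c. (\<forall>w\<in>W. (\<Sum>e\<in>S. c e * w e) = 0) \<longrightarrow> (\<forall>e\<in>S. c e = 0))"

definition realization :: "'e set \<Rightarrow> 'e set set \<Rightarrow> ('e \<Rightarrow> 'k::field) set \<Rightarrow> bool" where
  "realization E Ind W \<longleftrightarrow>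
     fun_vs.subspace W \<and> W \<subseteq> coord_space E \<and> Ind = {S. S \<subseteq> E \<and> coords_independent W S}"

definition is_basis :: "('e \<Rightarrow> 'k::field) set \<Rightarrow> ('e \<Rightarrow> 'k) list \<Rightarrow> bool" where
  "is_basis W ws \<longleftrightarrow>
     distinct ws \<and> fun_vs.independent (set ws) \<and> fun_vs.span (set ws) = W"

section \<open>The polynomial rings \<open>\<bbbK>[x\<^sub>e | e \<in> F]\<close>\<close>

text \<open>Polynomials in variables from the whole type, as finitely supported functions from
  monomials (exponent vectors) to coefficients, with convolution as multiplication.\<close>

type_synonym ('e, 'k) mpoly = "('e \<Rightarrow>\<^sub>0 nat) \<Rightarrow>\<^sub>0 'k"

definition Const :: "'k \<Rightarrow> ('e, 'k::comm_ring_1) mpoly" where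
  "Const c = Poly_Mapping.single 0 c"

definition Var :: "'e \<Rightarrow> ('e, 'k::comm_ring_1) mpoly" where
  "Var e = Poly_Mapping.single (Poly_Mapping.single e 1) 1"

definition vars :: "('e, 'k::comm_ring_1) mpoly \<Rightarrow> 'e set" where
  "vars p = (\<Union>m\<in>Poly_Mapping.keys p. Poly_Mapping.keys m)"

text \<open>The truncated subtraction below is harmless: its coefficient is \<open>0\<close> if the
  exponent of \<open>e\<close> in \<open>m\<close> is \<open>0\<close>.\<close>

definition partial :: "'e \<Rightarrow> ('e, 'k::comm_ring_1) mpoly \<Rightarrow> ('e, 'k) mpoly" where
  "partial e p = (\<Sum>m\<in>Poly_Mapping.keys p.
     Poly_Mapping.single (m - Poly_Mapping.single e 1)
       (of_nat (Poly_Mapping.lookup m e) * Poly_Mapping.lookup p m))"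

definition poly_ring :: "'e set \<Rightarrow> ('e, 'k::comm_ring_1) mpoly ring" where
  "poly_ring F = \<lparr>carrier = {p. vars p \<subseteq> F}, mult = (*), one = 1, zero = 0, add = (+)\<rparr>"

lemma vars_simps:
  fixes p :: "('e, 'k::comm_ring_1) mpoly"
  shows "vars (0 :: ('e, 'k) mpoly) = {}" "vars (1 :: ('e, 'k) mpoly) = {}"
    "vars (- p) = vars p"
  by (auto simp: vars_def simp flip: single_one)

lemma vars_add: "vars (p + q) \<subseteq> vars p \<union> vars q"
  unfolding vars_def using Poly_Mapping.keys_add[of p q] by blast

lemma vars_mult: "vars (p * q) \<subseteq> vars p \<union> vars q"
proof
  fix e assume "e \<in> vars (p * q)"
  then obtain m where m: "m \<in> Poly_Mapping.keys (p * q)" "e \<in> Poly_Mapping.keys m"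
    by (auto simp: vars_def)
  then obtain a b where "m = a + b" "a \<in> Poly_Mapping.keys p" "b \<in> Poly_Mapping.keys q"
    using keys_mult[of p q] by blast
  with m(2) Poly_Mapping.keys_add[of a b] show "e \<in> vars p \<union> vars q"
    by (auto simp: vars_def)
qed

lemma cring_poly_ring: "cring (poly_ring F :: ('e, 'k::comm_ring_1) mpoly ring)"
proof -
  have add: "vars (p + q) \<subseteq> F" and mult: "vars (p * q) \<subseteq> F"
    if "vars p \<subseteq> F" "vars q \<subseteq> F" for p q :: "('e, 'k) mpoly"
    using that vars_add[of p q] vars_mult[of p q] by blast+
  have "\<exists>q. vars q \<subseteq> F \<and> q + p = 0" if "vars p \<subseteq> F" for p :: "('e, 'k) mpoly"
    using that by (intro exI[of _ "- p"]) (simp add: vars_simps)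
  then have "abelian_group (poly_ring F :: ('e, 'k) mpoly ring)"
    by (intro abelian_groupI) (simp_all add: poly_ring_def add vars_simps add_ac Bex_def)
  moreover have "comm_monoid (poly_ring F :: ('e, 'k) mpoly ring)"
    by (intro comm_monoidI) (simp_all add: poly_ring_def mult vars_simps mult_ac)
  ultimately show ?thesis
    by (intro cringI) (simp_all add: poly_ring_def distrib_right)
qed

section \<open>Closed subschemes of \<open>\<bbbK>\<^sup>F\<close>\<close>

text \<open>A closed subscheme of \<open>\<bbbK>\<^sup>F = Spec \<bbbK>[x\<^sub>e | e \<in> F]\<close> is represented by its defining ideal in
  \<open>poly_ring F\<close>; equality of closed subschemes is equality of ideals.\<close>

definition scheme_union :: "'e set \<Rightarrow> ('e, 'k::field) mpoly set set \<Rightarrow> ('e, 'k) mpoly set" where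
  "scheme_union F \<I> = carrier (poly_ring F) \<inter> \<Inter>\<I>"

text \<open>For disjoint \<open>F\<close>, \<open>G\<close> the product over \<open>\<bbbK>\<close> of the subschemes of \<open>\<bbbK>\<^sup>F\<close> and \<open>\<bbbK>\<^sup>G\<close> defined by
  \<open>I\<close> and \<open>J\<close> is defined in \<open>\<bbbK>\<^sup>F \<times> \<bbbK>\<^sup>G = \<bbbK>\<^bsup>F \<union> G\<^esup>\<close> by the ideal generated by \<open>I\<close> and \<open>J\<close>.\<close>

definition scheme_prod ::
  "'e set \<Rightarrow> ('e, 'k::field) mpoly set \<Rightarrow> 'e set \<Rightarrow> ('e, 'k) mpoly set \<Rightarrow> ('e, 'k) mpoly set" where
  "scheme_prod F I G J = Idl\<^bsub>poly_ring (F \<union> G)\<^esub> (I \<union> J)"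

text \<open>\<open>Z \<times> \<bbbK>\<^bsup>E \<setminus> F\<^esup>\<close> for \<open>Z \<subseteq> \<bbbK>\<^sup>F\<close> defined by \<open>I\<close>; the whole space has ideal \<open>{0}\<close>.\<close>

definition times_rest ::
  "'e set \<Rightarrow> 'e set \<Rightarrow> ('e, 'k::field) mpoly set \<Rightarrow> ('e, 'k) mpoly set" where
  "times_rest E F I = scheme_prod F I (E - F) {0}"

text \<open>An affine scheme is integral (reduced) iff its coordinate ring is a domain (has no nonzero
  nilpotent elements).\<close>

definition integral_scheme :: "'e set \<Rightarrow> ('e, 'k::field) mpoly set \<Rightarrow> bool" where
  "integral_scheme F I \<longleftrightarrow> domain (poly_ring F Quot I)"

definition reduced_scheme :: "'e set \<Rightarrow> ('e, 'k::field) mpoly set \<Rightarrow> bool" where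
  "reduced_scheme F I \<longleftrightarrow>
     (let R = poly_ring F Quot I
      in \<forall>a\<in>carrier R. \<forall>k::nat. a [^]\<^bsub>R\<^esub> k = \<zero>\<^bsub>R\<^esub> \<longrightarrow> a = \<zero>\<^bsub>R\<^esub>)"

text \<open>The points of the scheme, as prime ideals of the ambient polynomial ring, and its
  Zariski open sets.\<close>

definition scheme_points :: "'e set \<Rightarrow> ('e, 'k::field) mpoly set \<Rightarrow> ('e, 'k) mpoly set set" where
  "scheme_points F I = {P. primeideal P (poly_ring F) \<and> I \<subseteq> P}"

definition scheme_open ::
  "'e set \<Rightarrow> ('e, 'k::field) mpoly set \<Rightarrow> ('e, 'k) mpoly set set \<Rightarrow> bool" where
  "scheme_open F I U \<longleftrightarrow>
     (\<exists>S\<subseteq>carrier (poly_ring F). U = {P \<in> scheme_points F I. \<not> S \<subseteq> P})"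

text \<open>Smoothness over \<open>\<bbbK>\<close> at the point \<open>P\<close> (as in Bosch--Luetkebohmert--Raynaud, Neron Models,
  2.2): near \<open>P\<close> the ideal \<open>I\<close> is generated by sections \<open>g\<^sub>1, \<dots>, g\<^sub>c\<close> whose differentials are
  linearly independent in the fibre at \<open>P\<close> of the module of differentials of \<open>\<bbbK>\<^sup>F\<close>, which has the
  basis \<open>(dx\<^sub>e)\<close>. Since the residue field at \<open>P\<close> is the fraction field of the coordinate ring
  modulo \<open>P\<close>, clearing denominators reduces linear independence over it to coefficients in the
  coordinate ring.\<close>

definition smooth_at ::
  "'e set \<Rightarrow> ('e, 'k::field) mpoly set \<Rightarrow> ('e, 'k) mpoly set \<Rightarrow> bool" where
  "smooth_at F I P \<longleftrightarrow>
     (\<exists>gs. set gs \<subseteq> I \<and>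
        (\<forall>f\<in>I. \<exists>s\<in>carrier (poly_ring F) - P. s * f \<in> Idl\<^bsub>poly_ring F\<^esub> (set gs)) \<and>
        (\<forall>a. (\<forall>i<length gs. a i \<in> carrier (poly_ring F)) \<and>
             (\<forall>e\<in>F. (\<Sum>i<length gs. a i * partial e (gs ! i)) \<in> P)
           \<longrightarrow> (\<forall>i<length gs. a i \<in> P)))"

text \<open>Some dense open subscheme is smooth over \<open>\<bbbK>\<close>.\<close>

definition generically_smooth :: "'e set \<Rightarrow> ('e, 'k::field) mpoly set \<Rightarrow> bool" where
  "generically_smooth F I \<longleftrightarrow>
     (\<exists>U. scheme_open F I U \<and>
        (\<forall>V. scheme_open F I V \<and> V \<noteq> {} \<longrightarrow> U \<inter> V \<noteq> {}) \<and>
        (\<forall>P\<in>U. smooth_at F I P))"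

section \<open>Configuration polynomials and the associated schemes\<close>

text \<open>All of the following depend on a basis \<open>ws\<close> of a configuration in \<open>\<bbbK>\<^sup>F\<close>. The polynomial is
  only well defined up to a nonzero square factor; the ideals do not depend on the basis.\<close>

definition config_matrix :: "'e set \<Rightarrow> ('e \<Rightarrow> 'k::field) list \<Rightarrow> ('e, 'k) mpoly mat" where
  "config_matrix F ws = mat (length ws) (length ws)
     (\<lambda>(i, j). \<Sum>e\<in>F. Var e * Const ((ws ! i) e * (ws ! j) e))"

definition config_poly :: "'e set \<Rightarrow> ('e \<Rightarrow> 'k::field) list \<Rightarrow> ('e, 'k) mpoly" where
  "config_poly F ws = det (config_matrix F ws)"

definition X_scheme :: "'e set \<Rightarrow> ('e \<Rightarrow> 'k::field) list \<Rightarrow> ('e, 'k) mpoly set" where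
  "X_scheme F ws = Idl\<^bsub>poly_ring F\<^esub> {config_poly F ws}"

definition Sigma_scheme :: "'e set \<Rightarrow> ('e \<Rightarrow> 'k::field) list \<Rightarrow> ('e, 'k) mpoly set" where
  "Sigma_scheme F ws =
     Idl\<^bsub>poly_ring F\<^esub> (insert (config_poly F ws) {partial e (config_poly F ws) | e. e \<in> F})"

definition Delta_scheme :: "'e set \<Rightarrow> ('e \<Rightarrow> 'k::field) list \<Rightarrow> ('e, 'k) mpoly set" where
  "Delta_scheme F ws =
     (if length ws \<le> 1 then carrier (poly_ring F)
      else Idl\<^bsub>poly_ring F\<^esub>
        {det (mat_delete (config_matrix F ws) i j) | i j. i < length ws \<and> j < length ws})"

end

theory Submission
  imports Defs "HOL-Computational_Algebra.Polynomial"
begin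

text \<open>The theorem rests on two facts. First, for a suitable basis of \<open>W\<close> the matrix \<open>Q\<^sub>W\<close> is
  block-diagonal, with one block \<open>Q\<^bsub>W\<^sub>i\<^esub>\<close> for each component, so that up to units
  \<open>\<psi>\<^sub>W = \<Prod>\<^sub>i \<psi>\<^sub>i\<close> with \<open>\<psi>\<^sub>i = \<psi>\<^bsub>W\<^sub>i\<^esub>\<close> in disjoint sets of variables. The product rule
  then gives \<open>J\<^sub>W = \<Sum>\<^sub>i J\<^bsub>W\<^sub>i\<^esub> \<Prod>\<^bsub>j \<noteq> i\<^esub> \<psi>\<^sub>j\<close>, and the shape of the adjugate of a block-diagonal
  matrix gives the same formula for \<open>M\<^sub>W\<close>. Second, the ideals \<open>(\<psi>\<^sub>i)\<close> and \<open>(\<psi>\<^sub>i, \<psi>\<^sub>j)\<close> are prime.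

  For primality, the monomials of \<open>\<psi>\<^sub>W\<close> are the products \<open>\<Prod>\<^bsub>e \<in> B\<^esub> x\<^sub>e\<close> over the bases \<open>B\<close> of the
  matroid. A factorization of \<open>\<psi>\<^sub>W\<close> has factors in disjoint sets of variables and therefore splits
  the set of bases as a product, that is, it decomposes the matroid
  (\<open>connected_imp_indecomposable\<close>). It remains that an irreducible multiaffine \<open>p\<close> is prime, and even
  remains prime over the coordinate ring of an integral scheme in other variables
  (\<open>indecomposable_prime\<close>). This is an induction on the number of variables of \<open>p = A x\<^sub>e + B\<close>. The
  polynomial \<open>A\<close> is again multiaffine, so it is a product of irreducible multiaffine factors, which
  are prime by induction and do not divide \<open>B\<close> because they would divide \<open>p\<close>. Hence \<open>B\<close> is a nonzerodivisor
  modulo \<open>A\<close>, and solving \<open>A x\<^sub>e + B = 0\<close> for \<open>x\<^sub>e\<close> embeds the quotient ring by \<open>p\<close> into a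
  localization of the polynomial ring in the other variables.

  The formulas for \<open>J\<^sub>W\<close> and \<open>M\<^sub>W\<close> turn into intersections by pure ideal theory
  (\<open>intersection_eq_span_products\<close>). An element of all \<open>(\<psi>\<^sub>i, \<psi>\<^sub>j)\<close> is a combination
  \<open>\<Sum>\<^sub>i g\<^sub>i \<Prod>\<^bsub>j \<noteq> i\<^esub> \<psi>\<^sub>j\<close>, and if it also lies in an ideal \<open>I\<^sub>i \<ni> \<psi>\<^sub>i\<close> generated in the variables of the
  \<open>i\<close>-th component, then so does \<open>g\<^sub>i\<close>, since the polynomial \<open>\<Prod>\<^bsub>j \<noteq> i\<^esub> \<psi>\<^sub>j\<close> in the other variables is a
  nonzerodivisor modulo \<open>I\<^sub>i\<close>. Generic smoothness holds because \<open>\<psi>\<^sub>i\<close>, being affine in each of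
  its variables, does not divide its derivatives by them.\<close>

section \<open>Substitution homomorphisms on polynomial rings\<close>

abbreviation (input) "keys \<equiv> Poly_Mapping.keys"
abbreviation (input) "lookup \<equiv> Poly_Mapping.lookup"
abbreviation (input) "single \<equiv> Poly_Mapping.single"

definition monomial_at :: "('e \<Rightarrow> 'a::comm_ring_1) \<Rightarrow> ('e \<Rightarrow>\<^sub>0 nat) \<Rightarrow> 'a" where
  "monomial_at v m = (\<Prod>e\<in>keys m. v e ^ lookup m e)"

definition mpoly_eval ::
  "('k::comm_ring_1 \<Rightarrow> 'a::comm_ring_1) \<Rightarrow> ('e \<Rightarrow> 'a) \<Rightarrow> ('e, 'k) mpoly \<Rightarrow> 'a" where
  "mpoly_eval h v p =
     (\<Sum>m\<in>keys p. h (lookup p m) * monomial_at v m)"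

lemma monomial_at_superset:
  assumes "finite S" "keys m \<subseteq> S"
  shows "monomial_at v m = (\<Prod>e\<in>S. v e ^ lookup m e)"
  unfolding monomial_at_def using assms
  by (intro prod.mono_neutral_left) (auto simp: in_keys_iff)

lemma monomial_at_add: "monomial_at v (m + n) = monomial_at v m * monomial_at v n"
proof -
  let ?S = "keys m \<union> keys n"
  have "keys (m + n) \<subseteq> ?S"
    by (rule Poly_Mapping.keys_add)
  then show ?thesis
    by (simp add: monomial_at_superset[of ?S] lookup_add power_add prod.distrib)
qed

lemma monomial_at_0 [simp]: "monomial_at v 0 = 1"
  by (simp add: monomial_at_def)

lemma monomial_at_single [simp]: "monomial_at v (single e k) = v e ^ k"
  by (cases "k = 0") (simp_all add: monomial_at_def)

lemma mpoly_as_sum: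
  "p = (\<Sum>m\<in>keys p. single m (lookup p m))"
  by (rule poly_mapping_eqI)
     (simp add: lookup_sum lookup_single when_def in_keys_iff sum.delta)

lemma single_eq_Const_monomial: "single m c = Const c * monomial_at Var m"
proof -
  have pow: "Var e ^ k = single (single e k) (1::'b)" for e :: 'a and k
    by (induction k) (simp_all add: Var_def mult_single flip: single_add)
  have prod: "(\<Prod>e\<in>S. single (f e) (1::'b)) = single (\<Sum>e\<in>S. f e) 1"
    for S and f :: "'a \<Rightarrow> ('a \<Rightarrow>\<^sub>0 nat)"
    by (induction S rule: infinite_finite_induct) (simp_all add: mult_single)
  have m: "(\<Sum>e\<in>keys m. single e (lookup m e)) = m"
    by (rule poly_mapping_eqI)
       (simp add: lookup_sum lookup_single when_def in_keys_iff sum.delta)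
  show ?thesis
    by (simp add: monomial_at_def pow prod m Const_def mult_single)
qed

lemma Const_ring_hom: "comm_ring_hom (Const :: 'k::comm_ring_1 \<Rightarrow> ('e, 'k) mpoly)"
  by unfold_locales (simp_all add: Const_def single_add mult_single)

interpretation Const: comm_ring_hom "Const :: 'k::comm_ring_1 \<Rightarrow> ('e, 'k) mpoly"
  by (rule Const_ring_hom)

lemma ring_hom_unique:
  fixes f g :: "('e, 'k::comm_ring_1) mpoly \<Rightarrow> 'a::comm_ring_1"
  assumes "comm_ring_hom f" "comm_ring_hom g"
    and Const: "\<And>c. f (Const c) = g (Const c)" and Var: "\<And>e. e \<in> vars p \<Longrightarrow> f (Var e) = g (Var e)"
  shows "f p = g p"
proof -
  interpret f: comm_ring_hom f by fact
  interpret g: comm_ring_hom g by fact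
  have "f (monomial_at Var m) = g (monomial_at Var m)" if "m \<in> keys p" for m
    unfolding monomial_at_def f.hom_prod g.hom_prod f.hom_power g.hom_power
    using that by (intro prod.cong refl arg_cong2[where f = "(^)"] Var) (auto simp: vars_def)
  then show ?thesis
    by (subst (1 2) mpoly_as_sum[of p])
       (simp add: f.hom_sum g.hom_sum single_eq_Const_monomial f.hom_mult g.hom_mult Const)
qed

context comm_ring_hom
begin

lemma mpoly_eval_single: "mpoly_eval hom v (single m c) = hom c * monomial_at v m"
  by (cases "c = 0") (simp_all add: mpoly_eval_def)

lemma mpoly_eval_superset:
  assumes "finite S" "keys p \<subseteq> S"
  shows "mpoly_eval hom v p = (\<Sum>m\<in>S. hom (lookup p m) * monomial_at v m)"
  unfolding mpoly_eval_def using assms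
  by (intro sum.mono_neutral_left) (auto simp: in_keys_iff)

lemma mpoly_eval_add: "mpoly_eval hom v (p + q) = mpoly_eval hom v p + mpoly_eval hom v q"
proof -
  let ?S = "keys p \<union> keys q"
  have "keys (p + q) \<subseteq> ?S"
    by (rule Poly_Mapping.keys_add)
  then show ?thesis
    by (simp add: mpoly_eval_superset[of ?S] lookup_add hom_add distrib_right sum.distrib)
qed

lemma mpoly_eval_sum: "mpoly_eval hom v (sum f A) = (\<Sum>x\<in>A. mpoly_eval hom v (f x))"
  by (induction A rule: infinite_finite_induct)
     (simp_all add: mpoly_eval_add, simp_all add: mpoly_eval_def)

lemma mpoly_eval_mult: "mpoly_eval hom v (p * q) = mpoly_eval hom v p * mpoly_eval hom v q"
proof -
  let ?l = "lookup"
  have "mpoly_eval hom v (p * q) =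
      mpoly_eval hom v (\<Sum>m\<in>keys p. \<Sum>n\<in>keys q.
        single (m + n) (?l p m * ?l q n))"
    by (subst mpoly_as_sum[of p], subst mpoly_as_sum[of q])
       (simp add: sum_product mult_single)
  also have "\<dots> = mpoly_eval hom v p * mpoly_eval hom v q"
    by (simp add: mpoly_eval_sum mpoly_eval_single hom_mult monomial_at_add
        mpoly_eval_def[of hom v p] mpoly_eval_def[of hom v q] sum_product mult_ac)
  finally show ?thesis .
qed

lemma mpoly_eval_Const [simp]: "mpoly_eval hom v (Const c) = hom c"
  by (simp add: Const_def mpoly_eval_single)

lemma mpoly_eval_Var [simp]: "mpoly_eval hom v (Var e) = v e"
  by (simp add: Var_def mpoly_eval_single)

lemma mpoly_eval_ring_hom: "comm_ring_hom (mpoly_eval hom v)"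
proof
  show "mpoly_eval hom v 1 = 1"
    using mpoly_eval_Const[of v 1] by (simp del: mpoly_eval_Const add: hom_one)
  show "mpoly_eval hom v 0 = 0"
    by (simp add: mpoly_eval_def)
qed (simp_all add: mpoly_eval_add mpoly_eval_mult)

end

text \<open>Applied to subrings of polynomials in prescribed variables, this bounds the variables that
  occur in the result of a substitution.\<close>

lemma mpoly_eval_closed:
  assumes zero: "0 \<in> A" and one: "1 \<in> A"
    and add: "\<And>a b. a \<in> A \<Longrightarrow> b \<in> A \<Longrightarrow> a + b \<in> A"
    and mult: "\<And>a b. a \<in> A \<Longrightarrow> b \<in> A \<Longrightarrow> a * b \<in> A"
    and h: "\<And>c. h c \<in> A" and v: "\<And>e. e \<in> vars p \<Longrightarrow> v e \<in> A"
  shows "mpoly_eval h v p \<in> A"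
proof -
  have sum: "sum f S \<in> A" if "\<And>x. x \<in> S \<Longrightarrow> f x \<in> A" for f :: "'x \<Rightarrow> _" and S
    using that by (induction S rule: infinite_finite_induct) (auto intro: zero add)
  have prod: "prod f S \<in> A" if "\<And>x. x \<in> S \<Longrightarrow> f x \<in> A" for f :: "'x \<Rightarrow> _" and S
    using that by (induction S rule: infinite_finite_induct) (auto intro: one mult)
  have pow: "a ^ k \<in> A" if "a \<in> A" for a k
    using that by (induction k) (auto intro: one mult)
  show ?thesis
    unfolding mpoly_eval_def monomial_at_def
    by (intro sum mult h prod pow v) (auto simp: vars_def)
qed

subsection \<open>Variables\<close>

lemma vars_Const [simp]: "vars (Const c) = {}"
  by (auto simp: vars_def Const_def split: if_splits)

lemma vars_Var [simp]: "vars (Var e :: ('e, 'k::comm_ring_1) mpoly) = {e}"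
  by (auto simp: vars_def Var_def)

lemma finite_vars [simp]: "finite (vars p)"
  by (simp add: vars_def)

lemma vars_add_subset: "vars p \<subseteq> F \<Longrightarrow> vars q \<subseteq> F \<Longrightarrow> vars (p + q) \<subseteq> F"
  and vars_mult_subset: "vars p \<subseteq> F \<Longrightarrow> vars q \<subseteq> F \<Longrightarrow> vars (p * q) \<subseteq> F"
  using vars_add[of p q] vars_mult[of p q] by blast+

lemma vars_power_subset: "vars p \<subseteq> F \<Longrightarrow> vars (p ^ k) \<subseteq> F"
  by (induction k) (simp_all only: power_0 power_Suc vars_simps vars_mult_subset empty_subsetI)

lemma vars_sum_subset: "(\<And>x. x \<in> A \<Longrightarrow> vars (f x) \<subseteq> F) \<Longrightarrow> vars (sum f A) \<subseteq> F"
proof (induction A rule: infinite_finite_induct)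
  case (insert x A)
  then show ?case using vars_add[of "f x" "sum f A"] by (simp; blast)
qed (simp_all add: vars_simps)

lemma vars_prod_subset: "(\<And>x. x \<in> A \<Longrightarrow> vars (f x) \<subseteq> F) \<Longrightarrow> vars (prod f A) \<subseteq> F"
proof (induction A rule: infinite_finite_induct)
  case (insert x A)
  then show ?case using vars_mult[of "f x" "prod f A"] by (simp; blast)
qed (simp_all add: vars_simps)

lemma no_vars_imp_Const:
  assumes "vars p = {}"
  shows "p = Const (lookup p 0)"
proof -
  have "m = 0" if "m \<in> keys p" for m
    using assms that by (auto simp: vars_def)
  then show ?thesis
    by (intro poly_mapping_eqI) (auto simp: Const_def lookup_single when_def in_keys_iff)
qed

subsection \<open>Setting variables to zero\<close>

text \<open>A retraction onto \<open>\<bbbK>[x\<^sub>e | e \<in> F]\<close>, by which identities are carried back into this subring.\<close>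

definition restrict_vars :: "'e set \<Rightarrow> ('e, 'k::comm_ring_1) mpoly \<Rightarrow> ('e, 'k) mpoly" where
  "restrict_vars F = mpoly_eval Const (\<lambda>e. if e \<in> F then Var e else 0)"

interpretation restrict_vars: comm_ring_hom "restrict_vars F"
  unfolding restrict_vars_def by (rule Const.mpoly_eval_ring_hom)

lemma restrict_vars_Const [simp]: "restrict_vars F (Const c) = Const c"
  and restrict_vars_Var: "restrict_vars F (Var e) = (if e \<in> F then Var e else 0)"
  by (simp_all add: restrict_vars_def)

lemma ring_hom_id: "comm_ring_hom (\<lambda>x :: 'a::comm_ring_1. x)"
  by unfold_locales simp_all

lemma restrict_vars_id: "vars p \<subseteq> F \<Longrightarrow> restrict_vars F p = p"
  by (rule ring_hom_unique[OF restrict_vars.comm_ring_hom_axioms ring_hom_id])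
     (auto simp: restrict_vars_Var)

lemma vars_restrict_vars: "vars (restrict_vars F p) \<subseteq> F"
proof -
  have "restrict_vars F p \<in> {q. vars q \<subseteq> F}"
    unfolding restrict_vars_def
    by (rule mpoly_eval_closed) (auto simp: vars_simps intro: vars_add_subset vars_mult_subset
        dest: subsetD[OF vars_add] subsetD[OF vars_mult])
  then show ?thesis by simp
qed

lemma lookup_restrict_vars:
  assumes "keys m \<subseteq> F"
  shows "lookup (restrict_vars F p) m = lookup p m"
proof -
  let ?v = "\<lambda>e. if e \<in> F then Var e else (0 :: ('a, 'b) mpoly)"
  have 1: "monomial_at ?v n = single n 1" if "keys n \<subseteq> F" for n
  proof -
    have "monomial_at ?v n = monomial_at Var n"
      unfolding monomial_at_def using that by (intro prod.cong) auto
    then show ?thesis by (simp add: single_eq_Const_monomial)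
  qed
  have 2: "monomial_at ?v n = 0" if "\<not> keys n \<subseteq> F" for n
    unfolding monomial_at_def using that
    by (intro prod_zero) (auto simp: power_0_left in_keys_iff)
  have "lookup (Const c * monomial_at ?v n) m = (if n = m then c else 0)" for c n
    using assms 1[of n] 2[of n]
    by (cases "keys n \<subseteq> F") (auto simp: Const_def mult_single lookup_single when_def)
  then show ?thesis
    by (simp add: restrict_vars_def mpoly_eval_def lookup_sum in_keys_iff)
qed

subsection \<open>Polynomials in one distinguished variable\<close>

text \<open>The view of \<open>\<bbbK>[x]\<close> as \<open>\<bbbK>[x\<^sub>f | f \<noteq> e][x\<^sub>e]\<close>. The coefficients stay in the type of all
  polynomials, so that evaluation at \<open>Var e\<close> is the inverse.\<close>

definition as_upoly :: "'e \<Rightarrow> ('e, 'k::comm_ring_1) mpoly \<Rightarrow> ('e, 'k) mpoly poly" where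
  "as_upoly e = mpoly_eval (\<lambda>c. [:Const c:]) (\<lambda>f. if f = e then [:0, 1:] else [:Var f:])"

lemma pCons_Const_ring_hom:
  "comm_ring_hom (\<lambda>c. [:Const c:] :: ('e, 'k::comm_ring_1) mpoly poly)"
  by unfold_locales (simp_all add: Const.hom_add Const.hom_mult one_pCons)

interpretation pCons_Const: comm_ring_hom "\<lambda>c. [:Const c:] :: ('e, 'k::comm_ring_1) mpoly poly"
  by (rule pCons_Const_ring_hom)

interpretation as_upoly: comm_ring_hom "as_upoly e"
  unfolding as_upoly_def by (rule pCons_Const.mpoly_eval_ring_hom)

lemma as_upoly_Const [simp]: "as_upoly e (Const c) = [:Const c:]"
  and as_upoly_Var: "as_upoly e (Var f) = (if f = e then [:0, 1:] else [:Var f:])"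
  by (simp_all add: as_upoly_def)

lemma as_upoly_Var_self [simp]: "as_upoly e (Var e) = [:0, 1:]"
  by (simp add: as_upoly_Var)

lemma poly_as_upoly [simp]: "poly (as_upoly e p) (Var e) = p"
proof -
  have "comm_ring_hom (\<lambda>p. poly (as_upoly e p) (Var e))"
    by unfold_locales (simp_all add: as_upoly.hom_add as_upoly.hom_mult)
  then show ?thesis
    by (rule ring_hom_unique[OF _ ring_hom_id]) (simp_all add: as_upoly_Var)
qed

lemma as_upoly_eq_0_iff [simp]: "as_upoly e p = 0 \<longleftrightarrow> p = 0"
  by (metis poly_as_upoly poly_0 as_upoly.hom_zero)

lemma mpoly_expand:
  "p = (\<Sum>k\<le>degree (as_upoly e p). coeff (as_upoly e p) k * Var e ^ k)"
  by (subst poly_as_upoly[of e p, symmetric]) (simp add: poly_altdef)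

lemma as_upoly_no_var:
  assumes "e \<notin> vars p"
  shows "as_upoly e p = [:p:]"
proof -
  have "comm_ring_hom (\<lambda>p. [:p:] :: ('a, 'b) mpoly poly)"
    by unfold_locales (simp_all add: one_pCons)
  then show ?thesis
    by (rule ring_hom_unique[OF as_upoly.comm_ring_hom_axioms])
       (use assms in \<open>auto simp: as_upoly_Var\<close>)
qed

lemma vars_coeff_as_upoly: "vars (coeff (as_upoly e p) k) \<subseteq> vars p - {e}"
proof -
  let ?S = "vars p - {e}"
  have "as_upoly e p \<in> {q. \<forall>k. vars (coeff q k) \<subseteq> ?S}"
    unfolding as_upoly_def
  proof (rule mpoly_eval_closed, goal_cases)
    case (3 a b)
    then show ?case by (simp add: vars_add_subset)
  next
    case (4 a b)
    have "vars (coeff a i * coeff b j) \<subseteq> ?S" for i j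
      using 4 by (intro vars_mult_subset) auto
    then show ?case by (auto simp only: mem_Collect_eq coeff_mult intro!: vars_sum_subset)
  qed (auto simp: vars_simps coeff_pCons split: nat.split)
  then show ?thesis by blast
qed

lemma degree_as_upoly_eq_0_iff: "degree (as_upoly e p) = 0 \<longleftrightarrow> e \<notin> vars p"
proof
  assume "degree (as_upoly e p) = 0"
  then obtain a where a: "as_upoly e p = [:a:]"
    by (rule degree_eq_zeroE)
  then have "p = a" using poly_as_upoly[of e p] by simp
  with vars_coeff_as_upoly[of e p 0] a show "e \<notin> vars p" by auto
qed (simp add: as_upoly_no_var)

section \<open>Ideals of the polynomial ring in all variables\<close>

text \<open>Ideals are the submodules of the ring over itself, and generated ideals are spans.\<close>

interpretation ring_mod: Modules.module "(*) :: 'a::comm_ring_1 \<Rightarrow> 'a \<Rightarrow> 'a"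
  by unfold_locales (simp_all add: algebra_simps)

text \<open>As a rewrite rule this would undo associativity.\<close>

declare ring_mod.scale_scale [simp del]

abbreviation ideal_span :: "'a::comm_ring_1 set \<Rightarrow> 'a set" where
  "ideal_span \<equiv> ring_mod.span"

abbreviation is_ideal :: "'a::comm_ring_1 set \<Rightarrow> bool" where
  "is_ideal \<equiv> ring_mod.subspace"

definition is_prime_ideal :: "'a::comm_ring_1 set \<Rightarrow> bool" where
  "is_prime_ideal J \<longleftrightarrow> is_ideal J \<and> 1 \<notin> J \<and> (\<forall>a b. a * b \<in> J \<longrightarrow> a \<in> J \<or> b \<in> J)"

lemma is_prime_idealD:
  assumes "is_prime_ideal J"
  shows "is_ideal J" "1 \<notin> J" "a * b \<in> J \<Longrightarrow> a \<in> J \<or> b \<in> J"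
  using assms unfolding is_prime_ideal_def by blast+

lemma ideal_absorb:
  assumes "is_ideal J" "a \<in> J"
  shows "b * a \<in> J" "a * b \<in> J"
  using ring_mod.subspace_scale[OF assms, of b] by (simp_all add: mult.commute)

lemma ideal_dvd: "is_ideal J \<Longrightarrow> a \<in> J \<Longrightarrow> a dvd b \<Longrightarrow> b \<in> J"
  by (auto elim!: dvdE intro: ideal_absorb)

lemma prime_ideal_power: "is_prime_ideal J \<Longrightarrow> a ^ k \<in> J \<Longrightarrow> a \<in> J"
  by (induction k) (auto simp: is_prime_ideal_def)

lemma prime_ideal_prod:
  assumes "is_prime_ideal J" "finite A" "prod f A \<in> J"
  shows "\<exists>x\<in>A. f x \<in> J"
  using assms(2,3,1) by (induction A) (auto simp: is_prime_ideal_def)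

lemma ideal_span_singleton: "x \<in> ideal_span {a} \<longleftrightarrow> a dvd x"
  by (auto simp: ring_mod.span_singleton dvd_def mult.commute)

lemma ideal_span_insert: "x \<in> ideal_span (insert a S) \<longleftrightarrow> (\<exists>k. x - k * a \<in> ideal_span S)"
  by (simp add: ring_mod.span_breakdown_eq)

subsection \<open>Ideals defined without a variable\<close>

text \<open>This characterizes the ideals that are extended from \<open>\<bbbK>[x\<^sub>f | f \<noteq> e]\<close>.\<close>

definition free_of :: "'e \<Rightarrow> ('e, 'k::comm_ring_1) mpoly set \<Rightarrow> bool" where
  "free_of e J \<longleftrightarrow> (\<forall>f\<in>J. \<forall>k. coeff (as_upoly e f) k \<in> J)"

lemma free_ofD: "free_of e J \<Longrightarrow> f \<in> J \<Longrightarrow> coeff (as_upoly e f) k \<in> J"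
  by (simp add: free_of_def)

lemma free_of_ideal_span:
  assumes "\<And>s. s \<in> S \<Longrightarrow> e \<notin> vars s"
  shows "free_of e (ideal_span S)"
  unfolding free_of_def
proof (intro ballI allI)
  fix f k assume "f \<in> ideal_span S"
  then show "coeff (as_upoly e f) k \<in> ideal_span S"
  proof (induction f rule: ring_mod.span_induct_alt)
    case base
    then show ?case by (simp add: as_upoly.hom_zero ring_mod.span_zero)
  next
    case (step c x y)
    have "as_upoly e x = [:x:]"
      using assms step by (simp add: as_upoly_no_var)
    then have "coeff (as_upoly e (c * x + y)) k = coeff (as_upoly e c) k * x + coeff (as_upoly e y) k"
      by (simp add: as_upoly.hom_add as_upoly.hom_mult mult.commute)
    then show ?case
      using step by (simp add: ring_mod.span_add ring_mod.span_scale ring_mod.span_base)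
  qed
qed

lemma in_ideal_by_coeffs:
  assumes "is_ideal J" "\<And>k. coeff (as_upoly e f) k \<in> J"
  shows "f \<in> J"
  by (subst mpoly_expand[of f e])
     (intro ring_mod.subspace_sum assms ideal_absorb)

text \<open>Modulo \<open>J\<close> one computes with polynomials in \<open>x\<^sub>e\<close> over a coefficient ring. If \<open>h * u\<close> vanishes
  there, then the leading coefficient of \<open>h\<close> annihilates the leading coefficient of \<open>u\<close>, and induction
  on the number of variables of \<open>h\<close> applies. For \<open>J = {0}\<close> this shows that the polynomial ring is a
  domain; in general, that a nonzero function on one factor of a product of schemes over
  \<open>\<bbbK>\<close> pulls back to a nonzerodivisor.\<close>

lemma nonzero_divisor_mod_free_ideal:
  fixes h :: "('e, 'k::field) mpoly"
  assumes J: "is_ideal J" and "h \<noteq> 0" "\<And>e. e \<in> vars h \<Longrightarrow> free_of e J" "h * u \<in> J"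
  shows "u \<in> J"
  using assms(2-)
proof (induction "card (vars h)" arbitrary: h u rule: less_induct)
  case less
  show ?case
  proof (cases "vars h = {}")
    case True
    then obtain c where c: "h = Const c"
      using no_vars_imp_Const by blast
    with \<open>h \<noteq> 0\<close> have "c \<noteq> 0" by auto
    then have "u = Const (1 / c) * (h * u)"
      by (simp add: c mult.assoc[symmetric] flip: Const.hom_mult)
    then show ?thesis
      using J less.prems(3) by (metis ideal_absorb(1))
  next
    case False
    then obtain e where e: "e \<in> vars h" by blast
    let ?H = "as_upoly e h" and ?U = "as_upoly e u"
    have lead: "lead_coeff ?H \<noteq> 0"
      using less.prems(1) by simp
    have vars_lead: "vars (lead_coeff ?H) \<subseteq> vars h - {e}"
      by (rule vars_coeff_as_upoly)
    then have card: "card (vars (lead_coeff ?H)) < card (vars h)"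
      using e by (intro psubset_card_mono) auto
    show ?thesis
    proof (rule ccontr)
      assume "u \<notin> J"
      define K where "K = {k. coeff ?U k \<notin> J}"
      have "K \<noteq> {}"
        using in_ideal_by_coeffs[OF J, of e u] \<open>u \<notin> J\<close> by (auto simp: K_def)
      moreover have "K \<subseteq> {..degree ?U}"
        using coeff_eq_0[of ?U] ring_mod.subspace_0[OF J] by (force simp: K_def not_le[symmetric])
      then have fin: "finite K" by (rule finite_subset) simp
      ultimately have max: "Max K \<in> K"
        by (rule Max_in[rotated])
      have top: "coeff ?U k \<in> J" if "k > Max K" for k
        using Max_ge[OF fin, of k] that by (auto simp: K_def)
      let ?d = "degree ?H" and ?t = "Max K"
      let ?g = "\<lambda>i. coeff ?H i * coeff ?U (?d + ?t - i)"
      have total: "(\<Sum>i\<le>?d + ?t. ?g i) \<in> J"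
        using free_ofD[OF less.prems(2)[OF e] less.prems(3), of "?d + ?t"]
        by (simp add: as_upoly.hom_mult coeff_mult)
      have split: "(\<Sum>i\<le>?d + ?t. ?g i) = ?g ?d + (\<Sum>i\<in>{..?d + ?t} - {?d}. ?g i)"
        by (subst sum.remove[of _ ?d]) auto
      have rest: "(\<Sum>i\<in>{..?d + ?t} - {?d}. ?g i) \<in> J"
      proof (rule ring_mod.subspace_sum[OF J])
        fix i assume "i \<in> {..?d + ?t} - {?d}"
        then consider "i < ?d" | "i > ?d" by fastforce
        then show "?g i \<in> J"
        proof cases
          case 1
          then show ?thesis by (intro ideal_absorb J top) simp
        next
          case 2
          then show ?thesis using ring_mod.subspace_0[OF J] by (simp add: coeff_eq_0)
        qed
      qed
      have "?g ?d \<in> J"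
        using ring_mod.subspace_diff[OF J total rest] unfolding split by simp
      then have "lead_coeff ?H * coeff ?U ?t \<in> J"
        by simp
      then have "coeff ?U ?t \<in> J"
        by (rule less.hyps[OF card lead, rotated]) (use vars_lead less.prems(2) in blast)
      with max show False by (simp add: K_def)
    qed
  qed
qed

lemma free_of_zero: "free_of e {0}"
  by (simp add: free_of_def as_upoly.hom_zero)

lemma mpoly_no_zero_divisors:
  fixes p q :: "('e, 'k::field) mpoly"
  shows "p * q = 0 \<longleftrightarrow> p = 0 \<or> q = 0"
proof -
  have "q = 0" if "p \<noteq> 0" "p * q = 0"
    using nonzero_divisor_mod_free_ideal[OF ring_mod.subspace_single_0 that(1) free_of_zero, of q]
      that(2) by simp
  then show ?thesis by auto
qed

lemma mpoly_prod_eq_0_iff: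
  fixes f :: "'i \<Rightarrow> ('e, 'k::field) mpoly"
  shows "finite A \<Longrightarrow> prod f A = 0 \<longleftrightarrow> (\<exists>i\<in>A. f i = 0)"
  by (induction A rule: finite_induct) (simp_all add: mpoly_no_zero_divisors)

lemma mpoly_mult_left_cancel:
  fixes p q r :: "('e, 'k::field) mpoly"
  assumes "p \<noteq> 0" "p * q = p * r"
  shows "q = r"
  using mpoly_no_zero_divisors[of p "q - r"] assms by (simp add: algebra_simps)

lemma is_prime_ideal_zero: "is_prime_ideal ({0} :: ('e, 'k::field) mpoly set)"
  by (simp add: is_prime_ideal_def ring_mod.subspace_single_0 mpoly_no_zero_divisors)

lemma degree_as_upoly_mult:
  fixes p q :: "('e, 'k::field) mpoly"
  assumes "p * q \<noteq> 0"
  shows "degree (as_upoly e (p * q)) = degree (as_upoly e p) + degree (as_upoly e q)"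
proof -
  have "lead_coeff (as_upoly e p) * lead_coeff (as_upoly e q) \<noteq> 0"
    using assms by (simp add: mpoly_no_zero_divisors)
  then show ?thesis
    using degree_mult_le[of "as_upoly e p" "as_upoly e q"]
    by (metis as_upoly.hom_mult coeff_mult_degree_sum le_antisym le_degree)
qed

lemma vars_mult_eq:
  fixes p q :: "('e, 'k::field) mpoly"
  assumes "p * q \<noteq> 0"
  shows "vars (p * q) = vars p \<union> vars q"
proof -
  have "e \<in> vars (p * q) \<longleftrightarrow> e \<in> vars p \<or> e \<in> vars q" for e
    using degree_as_upoly_mult[OF assms, of e] by (metis add_is_0 degree_as_upoly_eq_0_iff)
  then show ?thesis by blast
qed

section \<open>Multiaffine polynomials: indecomposable implies prime\<close>

definition multiaffine :: "('e, 'k::comm_ring_1) mpoly \<Rightarrow> bool" where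
  "multiaffine p \<longleftrightarrow> (\<forall>e. degree (as_upoly e p) \<le> 1)"

text \<open>For multiaffine polynomials over a field this is irreducibility: the polynomials without
  variables are the constants.\<close>

definition indecomposable :: "('e, 'k::comm_ring_1) mpoly \<Rightarrow> bool" where
  "indecomposable p \<longleftrightarrow>
     multiaffine p \<and> vars p \<noteq> {} \<and> (\<forall>f g. p = f * g \<longrightarrow> vars f = {} \<or> vars g = {})"

text \<open>Degrees in each variable add up, hence a variable occurs in at most one factor.\<close>

lemma multiaffine_factors:
  fixes p q :: "('e, 'k::field) mpoly"
  assumes "multiaffine (p * q)" "p * q \<noteq> 0"
  shows "multiaffine p" "multiaffine q" "vars p \<inter> vars q = {}"
proof -
  have le: "degree (as_upoly e p) + degree (as_upoly e q) \<le> 1" for e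
    using assms(1) unfolding multiaffine_def degree_as_upoly_mult[OF assms(2)] by blast
  show "multiaffine p" "multiaffine q"
    unfolding multiaffine_def using le by (meson add_leE)+
  have "degree (as_upoly e p) = 0 \<or> degree (as_upoly e q) = 0" for e
    using le[of e] by linarith
  then show "vars p \<inter> vars q = {}"
    by (auto simp: degree_as_upoly_eq_0_iff)
qed

abbreviation ideal_adjoin :: "'a::comm_ring_1 set \<Rightarrow> 'a \<Rightarrow> 'a set" where
  "ideal_adjoin Q p \<equiv> ideal_span (insert p Q)"

lemma ideal_adjoin_iff: "is_ideal Q \<Longrightarrow> x \<in> ideal_adjoin Q p \<longleftrightarrow> (\<exists>k. x - k * p \<in> Q)"
  by (simp add: ideal_span_insert flip: ring_mod.span_eq_iff)

text \<open>Modulo a prime ideal not containing \<open>B\<close> the polynomial \<open>B\<close> is a nonzerodivisor. Splitting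
  \<open>A = f * g\<close>, one first divides by \<open>f\<close> and then by \<open>g\<close>, so this passes from the
  irreducible factors to \<open>A\<close>.\<close>

lemma regular_mod_multiaffine:
  fixes A B :: "('e, 'k::field) mpoly"
  assumes Q: "is_ideal Q" and free: "\<And>e. e \<in> vars A \<Longrightarrow> free_of e Q"
    and A: "multiaffine A" "A \<noteq> 0"
    and factors: "\<And>d. indecomposable d \<Longrightarrow> d dvd A \<Longrightarrow>
      is_prime_ideal (ideal_adjoin Q d) \<and> B \<notin> ideal_adjoin Q d"
    and "B * v \<in> ideal_adjoin Q A"
  shows "v \<in> ideal_adjoin Q A"
  using assms(2-)
proof (induction "card (vars A)" arbitrary: A v rule: less_induct)
  case less
  show ?case
  proof (cases "vars A = {} \<or> indecomposable A")
    case True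
    then show ?thesis
    proof
      assume "vars A = {}"
      then obtain c where c: "A = Const c"
        using no_vars_imp_Const by blast
      with \<open>A \<noteq> 0\<close> have "c \<noteq> 0" by auto
      then have "v - (v * Const (1 / c)) * A = 0"
        by (simp add: c mult.assoc flip: Const.hom_mult)
      then show ?thesis
        unfolding ideal_adjoin_iff[OF Q] using ring_mod.subspace_0[OF Q] by metis
    next
      assume "indecomposable A"
      then show ?thesis
        using less.prems(4)[of A] less.prems(5) is_prime_idealD(3)[of "ideal_adjoin Q A" B v] by simp
    qed
  next
    case False
    with less.prems(2) obtain f g where A: "A = f * g" and ne: "vars f \<noteq> {}" "vars g \<noteq> {}"
      by (auto simp: indecomposable_def)
    have fg: "f \<noteq> 0" "g \<noteq> 0" "multiaffine f" "multiaffine g" "vars f \<inter> vars g = {}"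
      using multiaffine_factors[of f g] less.prems(2,3) by (auto simp: A)
    have vars: "vars A = vars f \<union> vars g"
      using vars_mult_eq less.prems(3) by (simp add: A)
    have "vars f \<subset> vars A" "vars g \<subset> vars A"
      using vars ne fg(5) by auto
    then have card: "card (vars f) < card (vars A)" "card (vars g) < card (vars A)"
      by (simp_all add: psubset_card_mono)
    have dvd: "d dvd A" if "d dvd f \<or> d dvd g" for d
      using that by (auto simp: A)
    obtain k where k: "B * v - k * A \<in> Q"
      using less.prems(5) by (auto simp: ideal_adjoin_iff[OF Q])
    then have "B * v - (k * g) * f \<in> Q"
      by (simp add: A mult_ac)
    then have "B * v \<in> ideal_adjoin Q f"
      unfolding ideal_adjoin_iff[OF Q] by blast
    then have "v \<in> ideal_adjoin Q f"
      by (rule less.hyps[OF card(1) _ fg(3,1), rotated -1])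
        (use vars dvd less.prems(1,4) in auto)
    then obtain l where l: "v - l * f \<in> Q"
      by (auto simp: ideal_adjoin_iff[OF Q])
    have "f * (B * l - k * g) = (B * v - k * A) - B * (v - l * f)"
      by (simp add: A algebra_simps)
    then have "f * (B * l - k * g) \<in> Q"
      using ring_mod.subspace_diff[OF Q k] ideal_absorb(1)[OF Q l, of B] by simp
    then have "B * l - k * g \<in> Q"
      by (rule nonzero_divisor_mod_free_ideal[OF Q fg(1), rotated]) (use vars less.prems(1) in auto)
    then have "B * l \<in> ideal_adjoin Q g"
      unfolding ideal_adjoin_iff[OF Q] by blast
    then have "l \<in> ideal_adjoin Q g"
      by (rule less.hyps[OF card(2) _ fg(4,2), rotated -1])
        (use vars dvd less.prems(1,4) in auto)
    then obtain m where m: "l - m * g \<in> Q"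
      by (auto simp: ideal_adjoin_iff[OF Q])
    have "v - m * A = (v - l * f) + f * (l - m * g)"
      by (simp add: A algebra_simps)
    also have "\<dots> \<in> Q"
      using ring_mod.subspace_add[OF Q l ideal_absorb(1)[OF Q m]] .
    finally show ?thesis
      unfolding ideal_adjoin_iff[OF Q] by blast
  qed
qed

text \<open>Let \<open>R\<close> be the image of \<open>\<bbbK>[x\<^sub>f | f \<noteq> e]\<close> modulo \<open>Q\<close>. The substitution \<open>x\<^sub>e = - B / A\<close> maps the
  quotient of \<open>R[x\<^sub>e]\<close> by \<open>A x\<^sub>e + B\<close> into the domain \<open>R[1 / A]\<close>. Its injectivity is what
  regularity of \<open>B\<close> modulo \<open>A\<close> is for. The proof clears denominators instead of localizing.\<close>

lemma linear_prime:
  fixes A B :: "('e, 'k::field) mpoly"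
  assumes Q: "is_prime_ideal Q" "free_of e Q"
    and e: "e \<notin> vars A" "e \<notin> vars B" and A: "A \<notin> Q"
    and regular: "\<And>v. B * v \<in> ideal_adjoin Q A \<Longrightarrow> v \<in> ideal_adjoin Q A"
  shows "is_prime_ideal (ideal_adjoin Q (A * Var e + B))"
proof -
  let ?p = "A * Var e + B"
  note I = is_prime_idealD(1)[OF Q(1)] and P = is_prime_idealD(3)[OF Q(1)]
  note adj = ideal_adjoin_iff[OF I]
  have J: "is_ideal (ideal_adjoin Q ?p)"
    by simp
  have up: "as_upoly e ?p = [:B, A:]"
    using e by (simp add: as_upoly.hom_add as_upoly.hom_mult as_upoly_no_var)
  \<comment> \<open>A nonzero multiple of \<open>A x\<^sub>e + B\<close> modulo \<open>Q\<close> has positive degree in \<open>x\<^sub>e\<close>.\<close>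
  have elim: "g \<in> Q" if g: "e \<notin> vars g" "g - k * ?p \<in> Q" for g k
  proof -
    let ?k = "coeff (as_upoly e k)"
    have step: "?k d \<in> Q" if "?k (Suc d) \<in> Q" for d
    proof -
      have "coeff (as_upoly e (g - k * ?p)) (Suc d) = - (?k (Suc d) * B + ?k d * A)"
        by (simp only: as_upoly.hom_minus as_upoly.hom_mult up as_upoly_no_var[OF g(1)])
          (simp add: mult.commute[of "as_upoly e k"] algebra_simps)
      then have "- (?k (Suc d) * B + ?k d * A) \<in> Q"
        using free_ofD[OF Q(2) g(2), of "Suc d"] by simp
      from ring_mod.subspace_add[OF I this ideal_absorb(2)[OF I that, of B]]
        ring_mod.subspace_neg[OF I]
      have "?k d * A \<in> Q"
        by fastforce
      with P A show ?thesis by blast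
    qed
    have "?k d \<in> Q" for d
    proof (cases "d \<le> Suc (degree (as_upoly e k))")
      case True
      then show ?thesis
      proof (induction d rule: inc_induct)
        case base
        then show ?case
          using ring_mod.subspace_0[OF I] by (simp add: coeff_eq_0)
      next
        case (step d)
        then show ?case using \<open>?k (Suc d) \<in> Q \<Longrightarrow> ?k d \<in> Q\<close> by blast
      qed
    next
      case False
      then show ?thesis
        using ring_mod.subspace_0[OF I] by (simp add: coeff_eq_0)
    qed
    then have "k \<in> Q"
      by (rule in_ideal_by_coeffs[OF I])
    from ring_mod.subspace_add[OF I g(2) ideal_absorb(2)[OF I this, of ?p]] show ?thesis
      by simp
  qed
  \<comment> \<open>\<open>A\<close> is a nonzerodivisor modulo \<open>A x\<^sub>e + B\<close>.\<close>
  have cancel: "u \<in> ideal_adjoin Q ?p" if Au: "A * u \<in> ideal_adjoin Q ?p" for u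
  proof -
    obtain v where v: "A * u - v * ?p \<in> Q"
      using Au unfolding adj by blast
    have "A * u - v * ?p = - (B * v - (u - Var e * v) * A)"
      by (simp add: algebra_simps)
    then have "B * v - (u - Var e * v) * A \<in> Q"
      using ring_mod.subspace_neg[OF I v] by simp
    then have "B * v \<in> ideal_adjoin Q A"
      unfolding adj by blast
    then have "v \<in> ideal_adjoin Q A"
      by (rule regular)
    then obtain w where w: "v - w * A \<in> Q"
      unfolding adj by blast
    have "A * (u - w * ?p) = (A * u - v * ?p) + ?p * (v - w * A)"
      by (simp add: algebra_simps)
    also have "\<dots> \<in> Q"
      using ring_mod.subspace_add[OF I v ideal_absorb(1)[OF I w]] .
    finally have "u - w * ?p \<in> Q"
      using P A by blast
    then show ?thesis
      unfolding adj by blast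
  qed
  have cancel_power: "u \<in> ideal_adjoin Q ?p" if "A ^ N * u \<in> ideal_adjoin Q ?p" for u N
    using that
  proof (induction N)
    case (Suc N)
    then have "A ^ N * u \<in> ideal_adjoin Q ?p"
      by (simp add: mult.assoc cancel)
    then show ?case by (rule Suc.IH)
  qed simp
  \<comment> \<open>Here \<open>g0\<close> is the numerator of \<open>g\<close> after substituting \<open>- B / A\<close> for \<open>x\<^sub>e\<close>.\<close>
  have reduce: "\<exists>N g0. e \<notin> vars g0 \<and> ?p dvd A ^ N * g - g0" for g
  proof -
    let ?g = "coeff (as_upoly e g)" and ?D = "degree (as_upoly e g)"
    define g0 where "g0 = (\<Sum>k\<le>?D. ?g k * A ^ (?D - k) * (- B) ^ k)"
    have "vars g0 \<subseteq> - {e}"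
      unfolding g0_def using vars_coeff_as_upoly[of e g] e
      by (intro vars_sum_subset vars_mult_subset vars_power_subset) (auto simp: vars_simps)
    moreover have "A ^ ?D * g - g0 =
        (\<Sum>k\<le>?D. ?g k * A ^ (?D - k) * ((A * Var e) ^ k - (- B) ^ k))"
    proof -
      have "A ^ ?D * (?g k * Var e ^ k) = ?g k * A ^ (?D - k) * (A * Var e) ^ k" if "k \<le> ?D" for k
        using that power_add[of A "?D - k" k] by (simp add: power_mult_distrib mult_ac)
      then have "A ^ ?D * g = (\<Sum>k\<le>?D. ?g k * A ^ (?D - k) * (A * Var e) ^ k)"
        by (subst (2) mpoly_expand[of g e]) (simp add: sum_distrib_left)
      then show ?thesis
        by (simp add: g0_def right_diff_distrib sum_subtractf)
    qed
    moreover have "?p dvd (A * Var e) ^ k - (- B) ^ k" for k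
      using power_diff_sumr2[of "A * Var e" k "- B"] by simp
    ultimately show ?thesis
      by (intro exI[of _ ?D] exI[of _ g0]) (auto intro: dvd_sum)
  qed
  have "1 \<notin> ideal_adjoin Q ?p"
    using elim[of 1] is_prime_idealD(2)[OF Q(1)] unfolding adj by (auto simp: vars_simps)
  moreover have "g \<in> ideal_adjoin Q ?p \<or> h \<in> ideal_adjoin Q ?p"
    if gh: "g * h \<in> ideal_adjoin Q ?p" for g h
  proof -
    have mem: "x \<in> ideal_adjoin Q ?p" if "?p dvd x" for x
      using ideal_dvd[OF J _ that] by (simp add: ring_mod.span_base)
    obtain N g0 where g0: "e \<notin> vars g0" "?p dvd A ^ N * g - g0"
      using reduce by blast
    obtain M h0 where h0: "e \<notin> vars h0" "?p dvd A ^ M * h - h0"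
      using reduce by blast
    have "g0 * h0 = A ^ N * A ^ M * (g * h) - (A ^ N * g - g0) * (A ^ M * h) - g0 * (A ^ M * h - h0)"
      by (simp add: algebra_simps)
    also have "\<dots> \<in> ideal_adjoin Q ?p"
      using g0(2) h0(2) by (intro ring_mod.subspace_diff[OF J] ideal_absorb[OF J] gh mem)
    finally obtain k where "g0 * h0 - k * ?p \<in> Q"
      unfolding adj by blast
    then have "g0 * h0 \<in> Q"
      using g0(1) h0(1) vars_mult[of g0 h0] by (intro elim[of "g0 * h0" k]) auto
    then have "g0 \<in> Q \<or> h0 \<in> Q"
      by (rule P)
    moreover have "u \<in> ideal_adjoin Q ?p" if "u0 \<in> Q" "?p dvd A ^ K * u - u0" for u u0 K
    proof (rule cancel_power)
      show "A ^ K * u \<in> ideal_adjoin Q ?p"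
        using ring_mod.subspace_add[OF J mem[OF that(2)], of u0] that(1)
        by (simp add: ring_mod.span_base)
    qed
    ultimately show ?thesis
      using g0(2) h0(2) by blast
  qed
  ultimately show ?thesis
    unfolding is_prime_ideal_def using J by blast
qed

text \<open>That \<open>A\<close> is multiaffine: for \<open>f \<noteq> e\<close>, a coefficient of \<open>p\<close> at a power of \<open>x\<^sub>f\<close> has the
  form \<open>a x\<^sub>e + b\<close> with \<open>a\<close>, \<open>b\<close> free of \<open>x\<^sub>e\<close>, so it vanishes only if \<open>a\<close> does.\<close>

lemma multiaffine_decompose:
  fixes p :: "('e, 'k::field) mpoly"
  assumes "multiaffine p" "e \<in> vars p"
  obtains A B where "p = A * Var e + B" "multiaffine A" "A \<noteq> 0"
    "vars A \<subseteq> vars p - {e}" "vars B \<subseteq> vars p - {e}"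
proof
  let ?A = "coeff (as_upoly e p) 1" and ?B = "coeff (as_upoly e p) 0"
  have deg: "degree (as_upoly e p) = 1"
    using assms degree_as_upoly_eq_0_iff[of e p] unfolding multiaffine_def
    by (metis One_nat_def le_Suc_eq le_zero_eq)
  then show p: "p = ?A * Var e + ?B"
    by (subst mpoly_expand[of p e]) (simp add: add.commute)
  show "vars ?A \<subseteq> vars p - {e}" "vars ?B \<subseteq> vars p - {e}"
    by (rule vars_coeff_as_upoly)+
  show "?A \<noteq> 0"
    using deg by (metis coeff_0_degree_minus_1 leading_coeff_0_iff degree_0 zero_neq_one)
  show "multiaffine ?A"
    unfolding multiaffine_def
  proof (rule allI, rule ccontr)
    fix f assume d: "\<not> degree (as_upoly f ?A) \<le> 1"
    let ?d = "degree (as_upoly f ?A)"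
    let ?a = "coeff (as_upoly f ?A) ?d" and ?b = "coeff (as_upoly f ?B) ?d"
    have "f \<noteq> e"
      using d vars_coeff_as_upoly[of e p 1] degree_as_upoly_eq_0_iff[of f ?A] by auto
    then have "as_upoly f (Var e :: ('e, 'k) mpoly) = [:Var e:]"
      by (intro as_upoly_no_var) simp
    then have "as_upoly f p = as_upoly f ?A * [:Var e:] + as_upoly f ?B"
      by (subst p) (simp only: as_upoly.hom_add as_upoly.hom_mult)
    moreover have "coeff (as_upoly f p) ?d = 0"
      using assms(1) d by (intro coeff_eq_0) (simp add: multiaffine_def, meson le_less_trans not_le)
    ultimately have "?a * Var e + ?b = 0"
      by (simp add: mult.commute)
    then have "as_upoly e (?a * Var e + ?b) = 0"
      by simp
    moreover have "as_upoly e ?a = [:?a:]" "as_upoly e ?b = [:?b:]"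
      using vars_coeff_as_upoly[of f ?A] vars_coeff_as_upoly[of f ?B]
        vars_coeff_as_upoly[of e p] by (blast intro: as_upoly_no_var)+
    ultimately have "?a = 0"
      by (simp add: as_upoly.hom_add as_upoly.hom_mult)
    then show False
      using d by auto
  qed
qed

text \<open>The ideal \<open>Q\<close> plays the role of a prime ideal in other variables, over whose coordinate ring
  \<open>p\<close> is to be prime. Setting the variables outside \<open>F\<close> to zero annihilates \<open>Q\<close>: this is a
  rational point of the scheme of \<open>Q\<close> in these variables, and it brings divisibility modulo \<open>Q\<close> back to
  divisibility of polynomials in the variables \<open>F\<close>.\<close>

theorem indecomposable_prime:
  fixes p :: "('e, 'k::field) mpoly"
  assumes Q: "is_prime_ideal Q" and free: "\<And>e. e \<in> F \<Longrightarrow> free_of e Q"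
    and vanish: "\<And>q. q \<in> Q \<Longrightarrow> restrict_vars F q = 0"
    and "indecomposable p" "vars p \<subseteq> F"
  shows "is_prime_ideal (ideal_adjoin Q p)"
  using assms(4-)
proof (induction "card (vars p)" arbitrary: p rule: less_induct)
  case less
  note I = is_prime_idealD(1)[OF Q]
  obtain e where e: "e \<in> vars p"
    using less.prems(1) by (auto simp: indecomposable_def)
  obtain A B where p: "p = A * Var e + B" and A: "multiaffine A" "A \<noteq> 0"
    and vars: "vars A \<subseteq> vars p - {e}" "vars B \<subseteq> vars p - {e}"
    using multiaffine_decompose[OF _ e] less.prems(1) by (auto simp: indecomposable_def)
  have restrict: "restrict_vars F A = A" "restrict_vars F B = B"
    using vars less.prems(2) by (auto intro: restrict_vars_id)
  have "A \<notin> Q"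
    using vanish[of A] restrict A(2) by auto
  moreover have "v \<in> ideal_adjoin Q A" if "B * v \<in> ideal_adjoin Q A" for v
  proof (rule regular_mod_multiaffine[OF I _ A _ that])
    show "free_of f Q" if "f \<in> vars A" for f
      using that vars(1) less.prems(2) free by blast
    fix d assume d: "indecomposable d" "d dvd A"
    from d(2) obtain a where a: "A = d * a" by (elim dvdE)
    then have vars_d: "vars d \<subseteq> vars p - {e}" "d \<noteq> 0"
      using vars(1) vars_mult_eq[of d a] A(2) by auto
    then have card: "card (vars d) < card (vars p)"
      using e by (intro psubset_card_mono) auto
    have prime: "is_prime_ideal (ideal_adjoin Q d)"
      using vars_d less.prems(2) by (intro less.hyps[OF card d(1)]) auto
    \<comment> \<open>A common factor of \<open>A\<close> and \<open>B\<close> divides \<open>p\<close>, but does not contain \<open>x\<^sub>e\<close>.\<close>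
    have "B \<notin> ideal_adjoin Q d"
    proof
      assume "B \<in> ideal_adjoin Q d"
      then obtain k where "B - k * d \<in> Q"
        by (auto simp: ideal_adjoin_iff[OF I])
      moreover have "restrict_vars F d = d"
        using vars_d(1) less.prems(2) by (intro restrict_vars_id) auto
      ultimately have "B = restrict_vars F k * d"
        using vanish restrict(2) by (metis eq_iff_diff_eq_0 restrict_vars.hom_minus restrict_vars.hom_mult)
      then have eq: "p = d * (a * Var e + restrict_vars F k)" (is "_ = d * ?c")
        by (simp add: p a algebra_simps)
      have "vars d \<noteq> {}"
        using d(1) by (simp add: indecomposable_def)
      then have "vars ?c = {}"
        using less.prems(1) eq by (auto simp: indecomposable_def)
      moreover have "vars p = vars d \<union> vars ?c"
        using vars_mult_eq[of d ?c] e eq vars_simps(1) by (metis empty_iff)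
      ultimately show False
        using e vars_d by blast
    qed
    with prime show "is_prime_ideal (ideal_adjoin Q d) \<and> B \<notin> ideal_adjoin Q d" ..
  qed
  ultimately show ?case
    unfolding p using e vars less.prems(2) by (intro linear_prime[OF Q free]) auto
qed

section \<open>The monomials of a configuration polynomial\<close>

definition set_monomial :: "'e set \<Rightarrow> ('e \<Rightarrow>\<^sub>0 nat)" where
  "set_monomial B = (\<Sum>e\<in>B. single e 1)"

lemma lookup_set_monomial:
  "finite B \<Longrightarrow> lookup (set_monomial B) e = (if e \<in> B then 1 else 0)"
  by (simp add: set_monomial_def lookup_sum lookup_single when_def)

lemma keys_set_monomial [simp]: "finite B \<Longrightarrow> keys (set_monomial B) = B"
  by (auto simp: in_keys_iff lookup_set_monomial split: if_splits)

lemma set_monomial_Un: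
  "finite A \<Longrightarrow> finite B \<Longrightarrow> A \<inter> B = {} \<Longrightarrow> set_monomial (A \<union> B) = set_monomial A + set_monomial B"
  by (simp add: set_monomial_def sum.union_disjoint)

lemma prod_Var: "(\<Prod>e\<in>B. Var (f e)) = single (\<Sum>e\<in>B. single (f e) 1) 1"
  by (induction B rule: infinite_finite_induct) (simp_all add: Var_def mult_single)

lemma multiaffineI:
  assumes "\<And>m e. m \<in> keys p \<Longrightarrow> lookup m e \<le> 1"
  shows "multiaffine p"
  unfolding multiaffine_def as_upoly_def mpoly_eval_def
proof (intro allI degree_sum_le finite_keys)
  fix e m assume m: "m \<in> keys p"
  let ?v = "\<lambda>f. if f = e then [:0, 1:] else [:Var f:] :: ('a, 'b) mpoly poly"
  have "degree (?v f ^ lookup m f) \<le> (if f = e then lookup m f else 0)" for f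
    using degree_power_le[of "?v f" "lookup m f"] by (auto split: if_splits)
  then have "degree (monomial_at ?v m) \<le> (\<Sum>f\<in>keys m. if f = e then lookup m f else 0)"
    unfolding monomial_at_def by (intro order.trans[OF degree_prod_sum_le] sum_mono) auto
  also have "\<dots> \<le> 1"
    using assms[OF m, of e] by (simp add: sum.delta)
  finally show "degree ([:Const (lookup p m):] * monomial_at ?v m) \<le> 1"
    using degree_mult_le[of "[:Const (lookup p m):]" "monomial_at ?v m"] by simp
qed

definition minor_mat :: "('e \<Rightarrow> 'k) list \<Rightarrow> (nat \<Rightarrow> 'e) \<Rightarrow> 'k mat" where
  "minor_mat ws f = mat (length ws) (length ws) (\<lambda>(i, j). (ws ! j) (f i))"

lemma config_matrix_carrier [simp]:
  "config_matrix E ws \<in> carrier_mat (length ws) (length ws)"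
  by (simp add: config_matrix_def)

text \<open>Row \<open>i\<close> of the configuration matrix is \<open>\<Sum>\<^sub>e x\<^sub>e w\<^sup>i\<^sub>e (w\<^sup>1\<^sub>e, \<dots>, w\<^sup>r\<^sub>e)\<close>. Expanding the determinant
  by multilinearity in the rows gives a sum over all choices \<open>f\<close> of one element of \<open>E\<close> for each row, and
  a repeated choice gives proportional rows.\<close>

lemma config_poly_expand:
  fixes ws :: "('e \<Rightarrow> 'k::field) list"
  assumes "finite E"
  defines "r \<equiv> length ws"
  shows "config_poly E ws = (\<Sum>f\<in>{f \<in> {0..<r} \<rightarrow>\<^sub>E E. inj_on f {0..<r}}.
    single (set_monomial (f ` {0..<r})) ((\<Prod>i<r. (ws ! i) (f i)) * det (minor_mat ws f)))"
proof -
  let ?P = "{p. p permutes {0..<r}}" and ?F = "{0..<r} \<rightarrow>\<^sub>E E"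
  let ?a = "\<lambda>i j e. Var e * Const ((ws ! i) e * (ws ! j) e) :: ('e, 'k) mpoly"
  have fin: "finite ?P" "finite ?F"
    using assms by (auto simp: finite_permutations intro: finite_PiE)
  have entry: "(\<Prod>i=0..<r. ?a i (p i) (f i)) =
      (\<Prod>i=0..<r. Var (f i)) * Const ((\<Prod>i<r. (ws ! i) (f i)) * (\<Prod>i=0..<r. (ws ! p i) (f i)))" for p f
    by (simp add: prod.distrib Const.hom_prod Const.hom_mult atLeast0LessThan)
  have "config_poly E ws = (\<Sum>p\<in>?P. signof p * (\<Prod>i=0..<r. \<Sum>e\<in>E. ?a i (p i) e))"
    unfolding config_poly_def det_def'[OF config_matrix_carrier] r_def
    by (intro sum.cong refl arg_cong2[where f = "(*)"] prod.cong)
       (auto simp: config_matrix_def permutes_in_image)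
  also have "\<dots> = (\<Sum>p\<in>?P. \<Sum>f\<in>?F. signof p * (\<Prod>i=0..<r. ?a i (p i) (f i)))"
    using assms by (simp add: prod_sum_PiE sum_distrib_left)
  also have "\<dots> = (\<Sum>f\<in>?F. \<Sum>p\<in>?P. signof p * (\<Prod>i=0..<r. ?a i (p i) (f i)))"
    by (rule sum.swap)
  also have "\<dots> = (\<Sum>f\<in>?F. (\<Prod>i=0..<r. Var (f i)) *
      Const ((\<Prod>i<r. (ws ! i) (f i)) * det (minor_mat ws f)))"
  proof (rule sum.cong[OF refl])
    fix f
    have "det (minor_mat ws f) = (\<Sum>p\<in>?P. signof p * (\<Prod>i=0..<r. (ws ! p i) (f i)))"
      unfolding minor_mat_def r_def[symmetric] det_def'[OF mat_carrier]
      by (intro sum.cong refl arg_cong2[where f = "(*)"] prod.cong)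
         (auto simp: permutes_in_image)
    then show "(\<Sum>p\<in>?P. signof p * (\<Prod>i=0..<r. ?a i (p i) (f i))) = (\<Prod>i=0..<r. Var (f i)) *
      Const ((\<Prod>i<r. (ws ! i) (f i)) * det (minor_mat ws f))"
      by (simp only: entry) (simp add: Const.hom_mult Const.hom_sum sum_distrib_left mult_ac)
  qed
  also have "\<dots> = (\<Sum>f\<in>{f \<in> ?F. inj_on f {0..<r}}. (\<Prod>i=0..<r. Var (f i)) *
      Const ((\<Prod>i<r. (ws ! i) (f i)) * det (minor_mat ws f)))"
  proof (rule sum.mono_neutral_right[OF fin(2)]; (intro ballI)?)
    fix f assume "f \<in> ?F - {f \<in> ?F. inj_on f {0..<r}}"
    then obtain i j where ij: "i < r" "j < r" "i \<noteq> j" "f i = f j"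
      by (auto simp: inj_on_def)
    then have "det (minor_mat ws f) = 0"
      by (intro det_identical_rows[of _ r i j]) (auto simp: minor_mat_def r_def)
    then show "(\<Prod>i=0..<r. Var (f i)) * Const ((\<Prod>i<r. (ws ! i) (f i)) * det (minor_mat ws f)) = 0"
      by simp
  qed auto
  also have "\<dots> = (\<Sum>f\<in>{f \<in> ?F. inj_on f {0..<r}}.
    single (set_monomial (f ` {0..<r})) ((\<Prod>i<r. (ws ! i) (f i)) * det (minor_mat ws f)))"
    by (intro sum.cong refl)
       (simp add: prod_Var Const_def mult_single set_monomial_def sum.reindex)
  finally show ?thesis .
qed

lemma keys_config_poly:
  assumes "finite E" "m \<in> keys (config_poly E ws)"
  shows "\<exists>B. B \<subseteq> E \<and> card B = length ws \<and> m = set_monomial B"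
proof -
  let ?F = "{f \<in> {0..<length ws} \<rightarrow>\<^sub>E E. inj_on f {0..<length ws}}"
  obtain f where "f \<in> ?F" "m = set_monomial (f ` {0..<length ws})"
    using assms(2) unfolding config_poly_expand[OF assms(1)] in_keys_iff lookup_sum
    by (elim sum.not_neutral_contains_not_neutral) (auto simp: lookup_single when_def split: if_splits)
  then show ?thesis
    by (intro exI[of _ "f ` {0..<length ws}"]) (auto simp: card_image)
qed

lemma vars_config_poly:
  assumes "finite E"
  shows "vars (config_poly E ws) \<subseteq> E"
proof
  fix e assume "e \<in> vars (config_poly E ws)"
  then obtain m where "m \<in> keys (config_poly E ws)" "e \<in> keys m"
    by (auto simp: vars_def)
  then show "e \<in> E"
    using keys_config_poly[OF assms] finite_subset[OF _ assms] by (metis keys_set_monomial subsetD)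
qed

lemma multiaffine_config_poly:
  assumes "finite E"
  shows "multiaffine (config_poly E ws)"
proof (rule multiaffineI)
  fix m e assume "m \<in> keys (config_poly E ws)"
  then obtain B where "B \<subseteq> E" "m = set_monomial B"
    using keys_config_poly[OF assms] by blast
  then show "lookup m e \<le> 1"
    using lookup_set_monomial[OF finite_subset[OF _ assms]] by simp
qed

lemma restrict_config_poly:
  assumes "finite E" "B \<subseteq> E"
  shows "restrict_vars B (config_poly E ws) = config_poly B ws"
proof -
  have "restrict_vars B (\<Sum>e\<in>E. Var e * Const (c e)) = (\<Sum>e\<in>B. Var e * Const (c e))" for c :: "'a \<Rightarrow> 'b"
    using assms
    by (simp add: restrict_vars.hom_sum restrict_vars.hom_mult restrict_vars_Var if_distrib[of "\<lambda>x. x * _"]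
        sum.If_cases Int_absorb1)
  then have "map_mat (restrict_vars B) (config_matrix E ws) = config_matrix B ws"
    by (intro eq_matI) (auto simp: config_matrix_def)
  then show ?thesis
    by (simp add: config_poly_def flip: restrict_vars.hom_det)
qed

text \<open>For as many elements as basis vectors, the configuration matrix is a product
  \<open>V\<^sup>T D V\<close> of square matrices with \<open>D\<close> the diagonal matrix of the variables.\<close>

lemma config_poly_of_basis:
  fixes ws :: "('e \<Rightarrow> 'k::field) list"
  assumes f: "bij_betw f {0..<length ws} B"
  shows "config_poly B ws = single (set_monomial B) ((det (minor_mat ws f))\<^sup>2)"
proof -
  let ?r = "length ws"
  define V :: "('e, 'k) mpoly mat" where "V = map_mat Const (minor_mat ws f)"
  define D where "D = mat ?r ?r (\<lambda>(i, j). if i = j then Var (f i) else 0 :: ('e, 'k) mpoly)"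
  have V: "V \<in> carrier_mat ?r ?r" and D: "D \<in> carrier_mat ?r ?r"
    by (simp_all add: V_def D_def minor_mat_def)
  have "config_matrix B ws = V\<^sup>T * D * V"
  proof (rule eq_matI)
    fix i j assume "i < dim_row (V\<^sup>T * D * V)" "j < dim_col (V\<^sup>T * D * V)"
    then have ij: "i < ?r" "j < ?r" using V by auto
    have VD: "(V\<^sup>T * D) $$ (i, k) = Const ((ws ! i) (f k)) * Var (f k)" if "k < ?r" for k
    proof -
      have "(V\<^sup>T * D) $$ (i, k) = (\<Sum>l=0..<?r. V $$ (l, i) * D $$ (l, k))"
        using ij that V D by (simp add: scalar_prod_def)
      also have "\<dots> = (\<Sum>l=0..<?r. if l = k then Const ((ws ! i) (f k)) * Var (f k) else 0)"
        using ij that by (intro sum.cong) (auto simp: V_def D_def minor_mat_def)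
      finally show ?thesis using that by simp
    qed
    have "V\<^sup>T * D \<in> carrier_mat ?r ?r"
      using V D by auto
    moreover have "(A * V) $$ (i, j) = (\<Sum>k=0..<?r. A $$ (i, k) * V $$ (k, j))"
      if "A \<in> carrier_mat ?r ?r" for A
      using that ij V by (simp add: scalar_prod_def)
    ultimately have "(V\<^sup>T * D * V) $$ (i, j) = (\<Sum>k=0..<?r. (V\<^sup>T * D) $$ (i, k) * V $$ (k, j))"
      by blast
    also have "\<dots> = (\<Sum>k=0..<?r. Var (f k) * Const ((ws ! i) (f k) * (ws ! j) (f k)))"
      using ij by (intro sum.cong) (auto simp: VD, auto simp: V_def minor_mat_def Const.hom_mult mult_ac)
    also have "\<dots> = (\<Sum>e\<in>B. Var e * Const ((ws ! i) e * (ws ! j) e))"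
      by (rule sum.reindex_bij_betw[OF f])
    finally show "config_matrix B ws $$ (i, j) = (V\<^sup>T * D * V) $$ (i, j)"
      using ij by (simp add: config_matrix_def)
  qed (use V D in \<open>auto simp: config_matrix_def\<close>)
  then have "config_poly B ws = det V * det D * det V"
    using V D by (simp add: config_poly_def det_mult[of _ ?r] det_transpose[of _ ?r])
  moreover have "det V = Const (det (minor_mat ws f))"
    by (simp add: V_def)
  moreover have "det D = single (set_monomial B) 1"
  proof -
    have "det D = prod_list (diag_mat D)"
      using D by (intro det_upper_triangular) (auto simp: D_def)
    also have "diag_mat D = map (\<lambda>i. Var (f i)) [0..<?r]"
      unfolding diag_mat_def D_def by (intro nth_equalityI) auto
    also have "prod_list \<dots> = (\<Prod>i=0..<?r. Var (f i))"
      using prod.distinct_set_conv_list[of "[0..<?r]" "\<lambda>i. Var (f i) :: ('e, 'k) mpoly"] by simp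
    also have "\<dots> = (\<Prod>e\<in>B. Var e)"
      by (rule prod.reindex_bij_betw[OF f])
    finally show ?thesis
      by (simp add: prod_Var set_monomial_def)
  qed
  ultimately show ?thesis
    by (simp add: Const_def mult_single power2_eq_square mult_ac)
qed

lemma coords_vanish_on_span:
  fixes ws :: "('e \<Rightarrow> 'k::field) list"
  assumes "\<forall>w\<in>S. (\<Sum>e\<in>B. c e * w e) = 0" "w \<in> fun_vs.span S"
  shows "(\<Sum>e\<in>B. c e * w e) = 0"
  using assms(2)
proof (induction rule: fun_vs.span_induct_alt)
  case (step a x y)
  have "(\<Sum>e\<in>B. c e * ((\<lambda>e. a * x e) + y) e) = a * (\<Sum>e\<in>B. c e * x e) + (\<Sum>e\<in>B. c e * y e)"
    by (simp add: algebra_simps sum.distrib sum_distrib_left)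
  then show ?case using step assms(1) by simp
qed simp

text \<open>A kernel vector of the transposed minor is a linear relation among the coordinate functions
  in \<open>B\<close> on the basis \<open>ws\<close>.\<close>

lemma det_minor_mat_iff:
  fixes ws :: "('e \<Rightarrow> 'k::field) list"
  assumes f: "bij_betw f {0..<length ws} B" and W: "fun_vs.span (set ws) = W"
  shows "det (minor_mat ws f) \<noteq> 0 \<longleftrightarrow> coords_independent W B"
proof -
  let ?r = "length ws" and ?M = "(minor_mat ws f)\<^sup>T"
  have M: "?M \<in> carrier_mat ?r ?r" by (simp add: minor_mat_def)
  have eq: "(?M *\<^sub>v v) $ i = (\<Sum>e\<in>B. v $ (inv_into {0..<?r} f e) * (ws ! i) e)"
    if "v \<in> carrier_vec ?r" "i < ?r" for v i
  proof -
    have "(?M *\<^sub>v v) $ i = (\<Sum>k=0..<?r. v $ k * (ws ! i) (f k))"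
      using that M by (simp add: scalar_prod_def) (intro sum.cong, auto simp: minor_mat_def)
    also have "\<dots> = (\<Sum>k=0..<?r. v $ (inv_into {0..<?r} f (f k)) * (ws ! i) (f k))"
      using f by (intro sum.cong) (auto simp: bij_betw_def inv_into_f_f)
    also have "\<dots> = (\<Sum>e\<in>B. v $ (inv_into {0..<?r} f e) * (ws ! i) e)"
      by (rule sum.reindex_bij_betw[OF f])
    finally show ?thesis .
  qed
  have inv: "inv_into {0..<?r} f (f k) = k" if "k < ?r" for k
    using f that by (auto simp: bij_betw_def)
  have onto: "\<exists>k<?r. e = f k" if "e \<in> B" for e
    using f that by (auto simp: bij_betw_def)
  have "det (minor_mat ws f) = 0 \<longleftrightarrow> \<not> coords_independent W B"
  proof
    assume "det (minor_mat ws f) = 0"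
    then have "det ?M = 0" using M by (simp add: det_transpose[of _ ?r])
    then obtain v where v: "v \<in> carrier_vec ?r" "v \<noteq> 0\<^sub>v ?r" "?M *\<^sub>v v = 0\<^sub>v ?r"
      using det_0_iff_vec_prod_zero_field[OF M] by blast
    let ?c = "\<lambda>e. v $ (inv_into {0..<?r} f e)"
    have "\<forall>w\<in>set ws. (\<Sum>e\<in>B. ?c e * w e) = 0"
    proof
      fix w assume "w \<in> set ws"
      then obtain i where i: "i < ?r" "w = ws ! i" by (metis in_set_conv_nth)
      then show "(\<Sum>e\<in>B. ?c e * w e) = 0"
        using eq[OF v(1) i(1)] v(3) by simp
    qed
    then have vanish: "\<forall>w\<in>W. (\<Sum>e\<in>B. ?c e * w e) = 0"
      unfolding W[symmetric] using coords_vanish_on_span[of "set ws" ?c B] by fast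
    obtain k where "k < ?r" "v $ k \<noteq> 0"
      using v(1,2) by (metis eq_vecI carrier_vecD index_zero_vec)
    then have "f k \<in> B" "?c (f k) \<noteq> 0"
      using f inv by (auto simp: bij_betw_def)
    then show "\<not> coords_independent W B"
      unfolding coords_independent_def using vanish by metis
  next
    assume "\<not> coords_independent W B"
    then obtain c b where c: "\<forall>w\<in>W. (\<Sum>e\<in>B. c e * w e) = 0" "b \<in> B" "c b \<noteq> 0"
      by (auto simp: coords_independent_def)
    define v where "v = vec ?r (\<lambda>k. c (f k))"
    have v: "v \<in> carrier_vec ?r" by (simp add: v_def)
    obtain k where k: "k < ?r" "b = f k" using onto c(2) by blast
    have "(?M *\<^sub>v v) $ i = 0" if i: "i < ?r" for i
    proof -
      have "(?M *\<^sub>v v) $ i = (\<Sum>e\<in>B. c e * (ws ! i) e)"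
        unfolding eq[OF v i]
      proof (rule sum.cong[OF refl])
        fix e assume "e \<in> B"
        then obtain k where "k < ?r" "e = f k" using onto by blast
        then show "v $ (inv_into {0..<?r} f e) * (ws ! i) e = c e * (ws ! i) e"
          by (simp add: inv v_def)
      qed
      moreover have "ws ! i \<in> W"
        using i W fun_vs.span_base nth_mem by blast
      ultimately show ?thesis using c(1) by simp
    qed
    then have "?M *\<^sub>v v = 0\<^sub>v ?r"
      using M by (intro eq_vecI) auto
    moreover have "v \<noteq> 0\<^sub>v ?r"
      using k c(3) by (auto simp: v_def vec_eq_iff)
    ultimately have "det ?M = 0"
      using det_0_iff_vec_prod_zero_field[OF M] v by blast
    then show "det (minor_mat ws f) = 0"
      using M by (simp add: det_transpose[of _ ?r] minor_mat_def)
  qed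
  then show ?thesis by blast
qed

text \<open>The coefficient of \<open>\<Prod>\<^bsub>e \<in> B\<^esub> x\<^sub>e\<close> survives setting the variables outside \<open>B\<close> to zero, where it
  is the square of a minor.\<close>

lemma lookup_config_poly:
  fixes ws :: "('e \<Rightarrow> 'k::field) list"
  assumes "finite E" "B \<subseteq> E" "card B = length ws" "fun_vs.span (set ws) = W"
  shows "lookup (config_poly E ws) (set_monomial B) \<noteq> 0 \<longleftrightarrow> coords_independent W B"
proof -
  have fin: "finite B" using assms finite_subset by blast
  obtain f where f: "bij_betw f {0..<length ws} B"
    using ex_bij_betw_nat_finite[OF fin] assms(3) by auto
  have "lookup (config_poly E ws) (set_monomial B) =
      lookup (config_poly B ws) (set_monomial B)"
    using lookup_restrict_vars[of "set_monomial B" B "config_poly E ws"] fin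
    by (simp add: restrict_config_poly[OF assms(1,2)])
  then show ?thesis
    by (simp add: config_poly_of_basis[OF f] flip: det_minor_mat_iff[OF f assms(4)])
qed

section \<open>Bases of a configuration from its matroid\<close>

lemma fun_sum_apply: "(\<Sum>i\<in>A. f i) x = (\<Sum>i\<in>A. f i x)" for f :: "'i \<Rightarrow> 'a \<Rightarrow> 'b::comm_monoid_add"
  by (induction A rule: infinite_finite_induct) simp_all

lemma coords_independent_subset:
  assumes "coords_independent W S" "T \<subseteq> S" "finite S"
  shows "coords_independent W T"
  unfolding coords_independent_def
proof (intro allI impI)
  fix c assume c: "\<forall>w\<in>W. (\<Sum>e\<in>T. c e * w e) = 0"
  have eq: "(\<Sum>e\<in>S. (if e \<in> T then c e else 0) * w e) = (\<Sum>e\<in>T. c e * w e)" for w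
    using assms(2,3) by (intro sum.mono_neutral_cong_right) auto
  then have "\<forall>e\<in>S. (if e \<in> T then c e else 0) = 0"
    using assms(1)[unfolded coords_independent_def, rule_format, of "\<lambda>e. if e \<in> T then c e else 0"] c
    unfolding eq by blast
  then show "\<forall>e\<in>T. c e = 0"
    using assms(2) by (metis subsetD)
qed

text \<open>Adding \<open>e\<close> to \<open>S\<close>: subtracting from \<open>w\<close> the combination of dual vectors with the same
  coordinates in \<open>S\<close> leaves a vector vanishing on \<open>S\<close>. If its \<open>e\<close>-th coordinate were zero for all \<open>w\<close>,
  that coordinate would depend linearly on those in \<open>S\<close>.\<close>

lemma dual_vectors_exist:
  fixes W :: "('e \<Rightarrow> 'k::field) set"
  assumes W: "fun_vs.subspace W" and "finite S" "coords_independent W S"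
  shows "\<exists>u. \<forall>s\<in>S. u s \<in> W \<and> (\<forall>t\<in>S. u s t = (if s = t then 1 else 0))"
  using assms(2,3)
proof (induction S rule: finite_induct)
  case (insert e S)
  then obtain u where u: "\<And>s. s \<in> S \<Longrightarrow> u s \<in> W"
    "\<And>s t. s \<in> S \<Longrightarrow> t \<in> S \<Longrightarrow> u s t = (if s = t then 1 else 0)"
    using coords_independent_subset[OF insert.prems, of S] by blast
  define residue where "residue w = w - (\<Sum>s\<in>S. (\<lambda>x. w s * u s x))" for w
  have residue_W: "residue w \<in> W" if "w \<in> W" for w
    unfolding residue_def using that u(1)
    by (intro fun_vs.subspace_diff[OF W] fun_vs.subspace_sum[OF W] fun_vs.subspace_scale[OF W]) auto
  have residue_S: "residue w t = 0" if "t \<in> S" for w t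
  proof -
    have "(\<Sum>s\<in>S. w s * u s t) = (\<Sum>s\<in>S. if s = t then w s else 0)"
      using u(2) that by (intro sum.cong) auto
    then show ?thesis
      using that insert.hyps by (simp add: residue_def fun_sum_apply)
  qed
  have "\<exists>w\<in>W. residue w e \<noteq> 0"
  proof (rule ccontr)
    assume *: "\<not> ?thesis"
    let ?c = "\<lambda>t. if t = e then 1 else - u t e"
    have "(\<Sum>t\<in>insert e S. ?c t * w t) = residue w e" for w
    proof -
      have "(\<Sum>t\<in>S. ?c t * w t) = (\<Sum>t\<in>S. - (w t * u t e))"
        using insert.hyps by (intro sum.cong) auto
      then show ?thesis
        using insert.hyps by (simp add: residue_def fun_sum_apply sum_negf)
    qed
    with * have "\<forall>w\<in>W. (\<Sum>t\<in>insert e S. ?c t * w t) = 0"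
      by simp
    from insert.prems[unfolded coords_independent_def, THEN spec, THEN mp, OF this]
    have "?c e = 0"
      by (rule bspec) simp
    then show False by simp
  qed
  then obtain w where w: "w \<in> W" "residue w e \<noteq> 0" by blast
  define v where "v = (\<lambda>x. inverse (residue w e) * residue w x)"
  have v: "v \<in> W" "v e = 1" "\<And>t. t \<in> S \<Longrightarrow> v t = 0"
    using fun_vs.subspace_scale[OF W residue_W[OF w(1)]] w(2) residue_S by (auto simp: v_def)
  define u' where "u' t = (if t = e then v else u t - (\<lambda>x. u t e * v x))" for t
  have "u' s \<in> W \<and> (\<forall>t\<in>insert e S. u' s t = (if s = t then 1 else 0))" if "s \<in> insert e S" for s
  proof (cases "s = e")
    case True
    then show ?thesis using v insert.hyps by (auto simp: u'_def)
  next
    case False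
    then have s: "s \<in> S" using that by simp
    have "u' s \<in> W"
      using False s u(1) v(1)
      by (auto simp: u'_def intro!: fun_vs.subspace_diff[OF W] fun_vs.subspace_scale[OF W])
    then show ?thesis
      using False s u(2) v insert.hyps by (auto simp: u'_def)
  qed
  then show ?case by blast
qed simp

text \<open>The bases of the matroid realized by \<open>W\<close>.\<close>

definition coord_basis :: "('e \<Rightarrow> 'k::field) set \<Rightarrow> 'e set \<Rightarrow> 'e set \<Rightarrow> bool" where
  "coord_basis W E B \<longleftrightarrow> B \<subseteq> E \<and> coords_independent W B \<and>
     (\<forall>e\<in>E - B. \<not> coords_independent W (insert e B))"

lemma coord_basis_extends:
  assumes "finite E" "S \<subseteq> E" "coords_independent W S"
  obtains B where "coord_basis W E B" "S \<subseteq> B"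
proof -
  define A where "A = {B. S \<subseteq> B \<and> B \<subseteq> E \<and> coords_independent W B}"
  have "finite A" "S \<in> A"
    using assms by (simp_all add: A_def)
  then obtain B where "B \<in> A" "\<forall>C\<in>A. B \<le> C \<longrightarrow> B = C"
    using finite_has_maximal2[of A S] by metis
  then have B: "B \<in> A" "\<And>C. C \<in> A \<Longrightarrow> B \<subseteq> C \<Longrightarrow> B = C"
    by auto
  note B = B[unfolded A_def]
  have "\<not> coords_independent W (insert e B)" if "e \<in> E - B" for e
    using B(2)[of "insert e B"] B(1) that by auto
  then have "coord_basis W E B"
    using B(1) by (simp add: coord_basis_def)
  with B(1) show ?thesis using that by blast
qed

text \<open>The relation belongs to the fundamental circuit of \<open>e\<close>, solved for \<open>e\<close>.\<close>

lemma circuit_relation: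
  fixes W :: "('e \<Rightarrow> 'k::field) set"
  assumes "finite B" "coords_independent W B" "e \<notin> B" "\<not> coords_independent W (insert e B)"
  obtains c where "\<And>w. w \<in> W \<Longrightarrow> w e = (\<Sum>b\<in>B. c b * w b)"
proof -
  obtain d f where d: "\<forall>w\<in>W. (\<Sum>b\<in>insert e B. d b * w b) = 0" "f \<in> insert e B" "d f \<noteq> 0"
    using assms(4) by (auto simp: coords_independent_def)
  have eq: "d e * w e + (\<Sum>b\<in>B. d b * w b) = 0" if "w \<in> W" for w
    using d(1) that assms(1,3) by simp
  have "d e \<noteq> 0"
  proof
    assume "d e = 0"
    then have "\<forall>w\<in>W. (\<Sum>b\<in>B. d b * w b) = 0" using eq by simp
    then have "\<forall>b\<in>B. d b = 0" using assms(2) unfolding coords_independent_def by blast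
    with \<open>d e = 0\<close> d(2,3) show False by auto
  qed
  then have "w e = (\<Sum>b\<in>B. (- inverse (d e) * d b) * w b)" if "w \<in> W" for w
  proof -
    have "(\<Sum>b\<in>B. (- inverse (d e) * d b) * w b) = - inverse (d e) * (\<Sum>b\<in>B. d b * w b)"
      by (simp only: sum_distrib_left mult.assoc)
    also have "(\<Sum>b\<in>B. d b * w b) = - (d e * w e)"
      using eq[OF that] by (simp add: eq_neg_iff_add_eq_0 add.commute)
    finally show ?thesis using \<open>d e \<noteq> 0\<close> by simp
  qed
  then show ?thesis by (rule that)
qed

text \<open>The dual vectors of \<open>B\<close> span \<open>W\<close> because the coordinates in \<open>B\<close> determine all others through
  the fundamental circuits.\<close>

lemma coord_basis_dual:
  fixes W :: "('e \<Rightarrow> 'k::field) set"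
  assumes W: "fun_vs.subspace W" "W \<subseteq> coord_space E" and E: "finite E" and B: "coord_basis W E B"
  obtains u where "\<And>b. b \<in> B \<Longrightarrow> u b \<in> W"
    "\<And>b c. b \<in> B \<Longrightarrow> c \<in> B \<Longrightarrow> u b c = (if b = c then 1 else 0)"
    "\<And>w. w \<in> W \<Longrightarrow> w = (\<Sum>b\<in>B. (\<lambda>x. w b * u b x))"
proof -
  have fin: "finite B" and ind: "coords_independent W B"
    using B E finite_subset by (auto simp: coord_basis_def)
  obtain u where u: "\<And>b. b \<in> B \<Longrightarrow> u b \<in> W"
    "\<And>b c. b \<in> B \<Longrightarrow> c \<in> B \<Longrightarrow> u b c = (if b = c then 1 else 0)"
    using dual_vectors_exist[OF W(1) fin ind] by blast
  have delta: "(\<Sum>b\<in>B. f b * u b c) = f c" if "c \<in> B" for c f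
  proof -
    have "(\<Sum>b\<in>B. f b * u b c) = (\<Sum>b\<in>B. if b = c then f b else 0)"
      using u(2) that by (intro sum.cong) auto
    then show ?thesis using fin that by simp
  qed
  have delta': "(\<Sum>c\<in>B. f c * u b c) = f b" if "b \<in> B" for b f
  proof -
    have "(\<Sum>c\<in>B. f c * u b c) = (\<Sum>c\<in>B. if c = b then f c else 0)"
      using u(2) that by (intro sum.cong) auto
    then show ?thesis using fin that by simp
  qed
  have "w = (\<Sum>b\<in>B. (\<lambda>x. w b * u b x))" if w: "w \<in> W" for w
  proof
    fix e
    consider "e \<in> B" | "e \<in> E - B" | "e \<notin> E" by blast
    then show "w e = (\<Sum>b\<in>B. (\<lambda>x. w b * u b x)) e"
    proof cases
      case 1
      then show ?thesis by (simp add: fun_sum_apply delta)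
    next
      case 2
      then obtain c where c: "\<And>w. w \<in> W \<Longrightarrow> w e = (\<Sum>b\<in>B. c b * w b)"
        using circuit_relation[OF fin ind, of e] B by (auto simp: coord_basis_def)
      have "u b e = c b" if "b \<in> B" for b
        using c[OF u(1)[OF that]] delta'[OF that] by simp
      then show ?thesis
        using c[OF w] by (simp add: fun_sum_apply mult.commute)
    next
      case 3
      then have "v e = 0" if "v \<in> W" for v
        using that W(2) by (auto simp: coord_space_def)
      then have "w e = 0" "\<And>b. b \<in> B \<Longrightarrow> u b e = 0"
        using w u(1) by blast+
      then show ?thesis by (simp add: fun_sum_apply)
    qed
  qed
  with u show ?thesis using that by blast
qed

lemma card_coord_basis:
  fixes W :: "('e \<Rightarrow> 'k::field) set"
  assumes W: "fun_vs.subspace W" "W \<subseteq> coord_space E" and E: "finite E" and B: "coord_basis W E B"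
    and ws: "is_basis W ws"
  shows "card B = length ws"
proof -
  obtain u where u: "\<And>b. b \<in> B \<Longrightarrow> u b \<in> W"
    "\<And>b c. b \<in> B \<Longrightarrow> c \<in> B \<Longrightarrow> u b c = (if b = c then 1 else 0)"
    "\<And>w. w \<in> W \<Longrightarrow> w = (\<Sum>b\<in>B. (\<lambda>x. w b * u b x))"
    using coord_basis_dual[OF W E B] by blast
  have fin: "finite B" using B E finite_subset by (auto simp: coord_basis_def)
  have inj: "inj_on u B"
    using u(2) by (auto simp: inj_on_def) (metis zero_neq_one)
  have "fun_vs.independent (u ` B)"
  proof
    assume "fun_vs.dependent (u ` B)"
    then obtain a v where a: "v \<in> u ` B" "a v \<noteq> 0" "(\<Sum>v\<in>u ` B. (\<lambda>e. a v * v e)) = 0"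
      using fun_vs.dependent_finite[of "u ` B"] fin by auto
    then obtain b where b: "b \<in> B" "v = u b" by blast
    have "0 = (\<Sum>v\<in>u ` B. (\<lambda>e. a v * v e)) b"
      using a(3) by simp
    also have "\<dots> = (\<Sum>c\<in>B. a (u c) * u c b)"
      by (simp add: fun_sum_apply sum.reindex[OF inj])
    also have "\<dots> = (\<Sum>c\<in>B. if c = b then a (u c) else 0)"
      using u(2) b(1) by (intro sum.cong) auto
    also have "\<dots> = a (u b)"
      using fin b(1) by simp
    finally show False using a(2) b(2) by simp
  qed
  moreover have "u ` B \<subseteq> fun_vs.span (set ws)"
    using u(1) ws by (auto simp: is_basis_def)
  moreover have "set ws \<subseteq> fun_vs.span (u ` B)"
  proof
    fix w assume "w \<in> set ws"
    then have "w \<in> W" using ws fun_vs.span_base by (auto simp: is_basis_def)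
    then show "w \<in> fun_vs.span (u ` B)"
      by (subst u(3)) (assumption, intro fun_vs.span_sum fun_vs.span_scale fun_vs.span_base imageI)
  qed
  ultimately have "card (u ` B) = card (set ws)"
    using fun_vs.independent_span_bound[of "set ws" "u ` B"]
      fun_vs.independent_span_bound[of "u ` B" "set ws"] ws fin
    by (auto simp: is_basis_def)
  then show ?thesis
    using ws card_image[OF inj] by (simp add: is_basis_def distinct_card)
qed

lemma independent_extends:
  fixes W :: "('e \<Rightarrow> 'k::field) set"
  assumes "fun_vs.subspace W" "W \<subseteq> coord_space E" "finite E" "is_basis W ws"
    and "S \<subseteq> E" "coords_independent W S"
  obtains B where "B \<subseteq> E" "coords_independent W B" "card B = length ws" "S \<subseteq> B"
proof -
  obtain B where "coord_basis W E B" "S \<subseteq> B"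
    using coord_basis_extends assms by blast
  then show ?thesis
    using card_coord_basis[OF assms(1-3) _ assms(4)] that by (auto simp: coord_basis_def)
qed

section \<open>Connected matroids have indecomposable configuration polynomials\<close>

text \<open>A monomial of the product determines both of its factors, so there is no cancellation.\<close>

lemma lookup_mult_disjoint:
  assumes disj: "vars f \<inter> vars g = {}"
    and "keys a \<subseteq> vars f" "keys b \<subseteq> vars g"
  shows "lookup (f * g) (a + b) = lookup f a * lookup g b"
proof -
  let ?l = "lookup"
  have split: "a' + b' = a + b \<longleftrightarrow> a' = a \<and> b' = b"
    if "a' \<in> keys f" "b' \<in> keys g" for a' b'
  proof
    assume eq: "a' + b' = a + b"
    have zero: "?l m e = 0" if "keys m \<subseteq> vars h" "e \<notin> vars h" for m e and h :: "('a, 'b) mpoly"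
      using that by (auto simp: in_keys_iff)
    have keys: "keys a' \<subseteq> vars f" "keys b' \<subseteq> vars g"
      using that by (auto simp: vars_def)
    have "?l a' e = ?l a e \<and> ?l b' e = ?l b e" for e
      using arg_cong[OF eq, of "\<lambda>m. ?l m e"] disj
        zero[OF keys(1)] zero[OF keys(2)] zero[OF assms(2)] zero[OF assms(3)]
      by (cases "e \<in> vars f"; cases "e \<in> vars g") (auto simp: lookup_add)
    then show "a' = a \<and> b' = b"
      by (auto intro: poly_mapping_eqI)
  qed simp
  have "f * g = (\<Sum>a'\<in>keys f. \<Sum>b'\<in>keys g.
      single (a' + b') (?l f a' * ?l g b'))"
    by (subst mpoly_as_sum[of f], subst mpoly_as_sum[of g]) (simp add: sum_product mult_single)
  then have "?l (f * g) (a + b) = (\<Sum>a'\<in>keys f. \<Sum>b'\<in>keys g.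
      ?l f a' * ?l g b' when a' + b' = a + b)"
    by (simp add: lookup_sum lookup_single)
  also have "\<dots> = (\<Sum>a'\<in>keys f. \<Sum>b'\<in>keys g.
      (if a' = a then ?l f a' else 0) * (if b' = b then ?l g b' else 0))"
    using split by (intro sum.cong refl) (auto simp: when_def)
  also have "\<dots> = (\<Sum>a'\<in>keys f. if a' = a then ?l f a' else 0) *
      (\<Sum>b'\<in>keys g. if b' = b then ?l g b' else 0)"
    by (simp only: sum_product)
  also have "\<dots> = ?l f a * ?l g b"
    by (simp add: in_keys_iff)
  finally show ?thesis .
qed

lemma matroid_restrict:
  assumes "matroid E Ind" "F \<subseteq> E"
  shows "matroid F {S \<in> Ind. S \<subseteq> F}"
proof -
  have M: "finite E" "{} \<in> Ind" "\<And>S T. S \<in> Ind \<Longrightarrow> T \<subseteq> S \<Longrightarrow> T \<in> Ind"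
    "\<And>S T. S \<in> Ind \<Longrightarrow> T \<in> Ind \<Longrightarrow> card S < card T \<Longrightarrow> \<exists>e\<in>T - S. insert e S \<in> Ind"
    using assms(1) by (simp_all add: matroid_def)
  have augment: "\<exists>e\<in>T - S. insert e S \<in> {S \<in> Ind. S \<subseteq> F}"
    if "S \<in> {S \<in> Ind. S \<subseteq> F}" "T \<in> {S \<in> Ind. S \<subseteq> F}" "card S < card T" for S T
  proof -
    have "\<exists>e\<in>T - S. insert e S \<in> Ind"
      using M(4)[of S T] that by simp
    then obtain e where "e \<in> T - S" "insert e S \<in> Ind" ..
    then show ?thesis using that by (intro bexI[of _ e]) auto
  qed
  have hereditary: "T \<in> {S \<in> Ind. S \<subseteq> F}" if "S \<in> {S \<in> Ind. S \<subseteq> F}" "T \<subseteq> S" for S T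
    using M(3)[of S T] that by auto
  show ?thesis
    unfolding matroid_def
  proof (intro conjI ballI allI impI)
    show "finite F" using assms(2) M(1) by (rule finite_subset)
  qed (use M(2) augment hereditary in blast)+
qed

text \<open>A factorization \<open>f * g\<close> has its factors in disjoint sets \<open>F\<close>, \<open>G\<close> of variables partitioning \<open>E\<close>.
  Since the monomials of the product are all products of a monomial of \<open>f\<close> and one of \<open>g\<close>, bases
  \<open>B\<close> and \<open>C\<close> of the matroid recombine to the basis \<open>(B \<inter> F) \<union> (C \<inter> G)\<close>. As independent sets extend to
  bases, the matroid is the direct sum of its restrictions to \<open>F\<close> and \<open>G\<close>.\<close>

theorem connected_imp_indecomposable:
  fixes W :: "('e \<Rightarrow> 'k::field) set"
  assumes W: "fun_vs.subspace W" "W \<subseteq> coord_space E" and E: "finite E" and ws: "is_basis W ws"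
    and connected: "connected_matroid E {S. S \<subseteq> E \<and> coords_independent W S}"
    and loopless: "\<And>e. e \<in> E \<Longrightarrow> coords_independent W {e}"
  shows "indecomposable (config_poly E ws)" "vars (config_poly E ws) = E"
    and "lookup (config_poly E ws) 0 = 0" "length ws \<ge> 1"
proof -
  let ?I = "{S. S \<subseteq> E \<and> coords_independent W S}" and ?p = "config_poly E ws"
  have span: "fun_vs.span (set ws) = W" using ws by (simp add: is_basis_def)
  have basis_iff: "lookup ?p (set_monomial B) \<noteq> 0 \<longleftrightarrow> coords_independent W B"
    if "B \<subseteq> E" "card B = length ws" for B
    using lookup_config_poly[OF E that span] .
  have fin: "finite B" if "B \<subseteq> E" for B using that E finite_subset by blast
  show vars: "vars ?p = E"
  proof
    show "vars ?p \<subseteq> E" by (rule vars_config_poly[OF E])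
    show "E \<subseteq> vars ?p"
    proof
      fix e assume e: "e \<in> E"
      obtain B where B: "B \<subseteq> E" "coords_independent W B" "card B = length ws" "{e} \<subseteq> B"
        by (rule independent_extends[OF W E ws _ loopless[OF e]]) (use e in auto)
      then have "set_monomial B \<in> keys ?p"
        using basis_iff by (simp add: in_keys_iff)
      then show "e \<in> vars ?p"
        unfolding vars_def using B(4) keys_set_monomial[OF fin[OF B(1)]] by blast
    qed
  qed
  have ne: "E \<noteq> {}" and matroid: "matroid E ?I"
    using connected by (auto simp: connected_matroid_def)
  show len: "length ws \<ge> 1"
  proof -
    obtain e B where "B \<subseteq> E" "card B = length ws" "{e} \<subseteq> B"
      using independent_extends[OF W E ws _ loopless] ne by (metis empty_subsetI ex_in_conv insert_subset)
    then have "card B \<noteq> 0"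
      using fin[of B] by auto
    with \<open>card B = length ws\<close> show ?thesis by linarith
  qed
  show "lookup ?p 0 = 0"
  proof (rule ccontr)
    assume "lookup ?p 0 \<noteq> 0"
    then obtain B where "B \<subseteq> E" "card B = length ws" "0 = set_monomial B"
      using keys_config_poly[OF E, of 0 ws] by (auto simp: in_keys_iff)
    then show False
      using keys_set_monomial[of B] fin len by auto
  qed
  have "vars f = {} \<or> vars g = {}" if p: "?p = f * g" for f g
  proof (rule ccontr)
    assume "\<not> (vars f = {} \<or> vars g = {})"
    then have nonempty: "vars f \<noteq> {}" "vars g \<noteq> {}" by auto
    let ?F = "vars f" and ?G = "vars g"
    have "?p \<noteq> 0" using ne vars by (auto simp: vars_simps)
    then have FG: "?F \<union> ?G = E" "?F \<inter> ?G = {}"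
      using vars_mult_eq[of f g] multiaffine_factors[of f g] multiaffine_config_poly[OF E] vars p
      by metis+
    \<comment> \<open>No two products of monomials of \<open>f\<close> and \<open>g\<close> coincide, so bases can be recombined.\<close>
    have exchange: "coords_independent W (B \<inter> ?F \<union> C \<inter> ?G)"
      if B: "B \<subseteq> E" "coords_independent W B" "card B = length ws"
        and C: "C \<subseteq> E" "coords_independent W C" "card C = length ws" for B C
    proof -
      let ?D = "B \<inter> ?F \<union> C \<inter> ?G"
      have split: "D = (D \<inter> ?F) \<union> (D \<inter> ?G)" if "D \<subseteq> E" for D
        using that FG(1) by blast
      have mon: "set_monomial ((D \<inter> ?F) \<union> (D' \<inter> ?G)) = set_monomial (D \<inter> ?F) + set_monomial (D' \<inter> ?G)"
        if "D \<subseteq> E" "D' \<subseteq> E" for D D'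
        using that FG(2) fin by (intro set_monomial_Un) auto
      have look: "lookup ?p (set_monomial ((D \<inter> ?F) \<union> (D' \<inter> ?G))) =
          lookup f (set_monomial (D \<inter> ?F)) * lookup g (set_monomial (D' \<inter> ?G))"
        if "D \<subseteq> E" "D' \<subseteq> E" for D D'
        unfolding p mon[OF that] using fin that by (intro lookup_mult_disjoint FG(2)) auto
      have "lookup f (set_monomial (B \<inter> ?F)) \<noteq> 0"
        using look[OF B(1) B(1)] basis_iff[OF B(1,3)] B(2) split[OF B(1)] by auto
      moreover have "lookup g (set_monomial (C \<inter> ?G)) \<noteq> 0"
        using look[OF C(1) C(1)] basis_iff[OF C(1,3)] C(2) split[OF C(1)] by auto
      ultimately have nz: "lookup ?p (set_monomial ?D) \<noteq> 0"
        using look[OF B(1) C(1)] by simp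
      then obtain D where D: "D \<subseteq> E" "card D = length ws" "set_monomial ?D = set_monomial D"
        using keys_config_poly[OF E, of "set_monomial ?D" ws] by (auto simp: in_keys_iff)
      have "?D \<subseteq> E" using B(1) C(1) by blast
      with D have "?D = D"
        using keys_set_monomial fin by metis
      with D nz show ?thesis using basis_iff[of D] by simp
    qed
    define Es where "Es i = (if i = (1::nat) then ?F else ?G)" for i
    define Inds where "Inds i = {S \<in> ?I. S \<subseteq> Es i}" for i
    have Es: "Es 1 = ?F" "Es 2 = ?G" by (simp_all add: Es_def)
    have "matroid (Es i) (Inds i)" for i
      unfolding Inds_def using FG(1) by (intro matroid_restrict[OF matroid]) (auto simp: Es_def)
    moreover have "Es i \<noteq> {}" for i
      using nonempty by (simp add: Es_def)
    moreover have "matroid_direct_sum {1, 2} Es Inds E ?I"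
      unfolding matroid_direct_sum_def
    proof (intro conjI)
      show "disjoint_family_on Es {1, 2}"
        using FG(2) by (auto simp: disjoint_family_on_def Es_def)
      show "E = (\<Union>i\<in>{1, 2}. Es i)"
        using FG(1) by (auto simp: Es_def)
      show "?I = {\<Union>i\<in>{1, 2}. S i |S. \<forall>i\<in>{1, 2}. S i \<in> Inds i}" (is "_ = ?R")
      proof (intro subset_antisym subsetI)
        fix S assume S: "S \<in> ?I"
        then have "S = (\<Union>i\<in>{1, 2}. S \<inter> Es i)"
          using FG(1) by (auto simp: Es_def)
        moreover have "S \<inter> Es i \<in> Inds i" for i
          using S coords_independent_subset[of W S] fin by (auto simp: Inds_def)
        ultimately show "S \<in> ?R" by blast
      next
        fix S assume "S \<in> ?R"
        then obtain T :: "nat \<Rightarrow> 'e set" where T: "S = T 1 \<union> T 2" "T 1 \<in> Inds 1" "T 2 \<in> Inds 2" by auto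
        obtain B where B: "B \<subseteq> E" "coords_independent W B" "card B = length ws" "T 1 \<subseteq> B"
          using independent_extends[OF W E ws, of "T 1"] T(2) by (auto simp: Inds_def)
        obtain C where C: "C \<subseteq> E" "coords_independent W C" "card C = length ws" "T 2 \<subseteq> C"
          using independent_extends[OF W E ws, of "T 2"] T(3) by (auto simp: Inds_def)
        have "S \<subseteq> B \<inter> ?F \<union> C \<inter> ?G"
          using T B(4) C(4) by (auto simp: Inds_def Es_def)
        then have "coords_independent W S"
          using fin[OF B(1)] fin[OF C(1)]
          by (intro coords_independent_subset[OF exchange[OF B(1-3) C(1-3)]]) auto
        then show "S \<in> ?I"
          using T by (auto simp: Inds_def)
      qed
    qed
    ultimately show False
      using connected unfolding connected_matroid_def by blast
  qed
  then show "indecomposable ?p"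
    unfolding indecomposable_def using multiaffine_config_poly[OF E] vars ne by simp
qed

section \<open>Adjugates of block-diagonal and congruent matrices\<close>

abbreviation block_diag :: "'a::zero mat \<Rightarrow> 'a mat \<Rightarrow> 'a mat" where
  "block_diag A B \<equiv> four_block_mat A (0\<^sub>m (dim_row A) (dim_col B)) (0\<^sub>m (dim_row B) (dim_col A)) B"

lemma block_diag_carrier [simp]:
  "A \<in> carrier_mat n n \<Longrightarrow> B \<in> carrier_mat m m \<Longrightarrow> block_diag A B \<in> carrier_mat (n + m) (n + m)"
  by auto

lemma block_diag_mult:
  fixes A B C D :: "'a::comm_ring_1 mat"
  assumes "A \<in> carrier_mat n n" "B \<in> carrier_mat m m" "C \<in> carrier_mat n n" "D \<in> carrier_mat m m"
  shows "block_diag A B * block_diag C D = block_diag (A * C) (B * D)"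
  using assms by (subst mult_four_block_mat[of _ n n _ m _ m]) auto

lemma det_block_diag_one_right:
  fixes A :: "'a::comm_ring_1 mat"
  assumes A: "A \<in> carrier_mat n n"
  shows "det (block_diag A (1\<^sub>m m)) = det A"
proof (induction m)
  case 0
  have "block_diag A (1\<^sub>m 0) = A"
    using A by (intro eq_matI) auto
  then show ?case by simp
next
  case (Suc m)
  have "block_diag A (1\<^sub>m (Suc m)) = block_diag (block_diag A (1\<^sub>m m)) (1\<^sub>m 1)"
    using A by (intro eq_matI) auto
  also have "det \<dots> = det (block_diag A (1\<^sub>m m)) * det (1\<^sub>m 1 :: 'a mat)"
    using A by (intro det_four_block_mat_upper_right_zero_col[where n = "n + m"]) auto
  finally show ?case using Suc by simp
qed

lemma det_block_diag_one_left:
  fixes B :: "'a::comm_ring_1 mat"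
  assumes B: "B \<in> carrier_mat m m"
  shows "det (block_diag (1\<^sub>m n) B) = det B"
proof (induction n)
  case 0
  have "block_diag (1\<^sub>m 0) B = B"
    using B by (intro eq_matI) auto
  then show ?case by simp
next
  case (Suc n)
  have "block_diag (1\<^sub>m (Suc n)) B = block_diag (1\<^sub>m 1) (block_diag (1\<^sub>m n) B)"
    using B by (intro eq_matI) auto
  also have "det \<dots> = det (1\<^sub>m 1 :: 'a mat) * det (block_diag (1\<^sub>m n) B)"
    using B by (intro det_four_block_mat_lower_left_zero_col[where n = "n + m"]) auto
  finally show ?case using Suc by simp
qed

text \<open>Factoring into two matrices with an identity block makes this valid over every commutative
  ring.\<close>

lemma det_block_diag:
  fixes A B :: "'a::comm_ring_1 mat"
  assumes A: "A \<in> carrier_mat n n" and B: "B \<in> carrier_mat m m"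
  shows "det (block_diag A B) = det A * det B"
proof -
  have "block_diag A B = block_diag A (1\<^sub>m m) * block_diag (1\<^sub>m n) B"
    using A B by (subst block_diag_mult[of _ n _ m]) auto
  also have "det \<dots> = det (block_diag A (1\<^sub>m m)) * det (block_diag (1\<^sub>m n) B)"
    using A B by (intro det_mult[of _ "n + m"]) auto
  finally show ?thesis
    using A B by (simp only: det_block_diag_one_right[OF A] det_block_diag_one_left[OF B])
qed

text \<open>In a domain, a matrix of nonzero determinant can be cancelled. This replaces a computation of
  minors by a verification of a matrix identity.\<close>

lemma adj_mat_unique:
  fixes C X :: "('e, 'k::field) mpoly mat"
  assumes C: "C \<in> carrier_mat n n" and X: "X \<in> carrier_mat n n"
    and nz: "det C \<noteq> 0" and XC: "X * C = det C \<cdot>\<^sub>m 1\<^sub>m n"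
  shows "X = adj_mat C"
proof -
  note adj = adj_mat[OF C]
  have "X * (C * adj_mat C) = (X * C) * adj_mat C"
    by (rule assoc_mult_mat[symmetric, OF X C adj(1)])
  then have eq: "det C \<cdot>\<^sub>m X = det C \<cdot>\<^sub>m adj_mat C"
    unfolding XC adj(2) mult_smult_distrib[OF X one_carrier_mat]
      mult_smult_assoc_mat[OF one_carrier_mat adj(1)]
    using X adj(1) by simp
  show ?thesis
  proof (rule eq_matI)
    fix i j assume "i < dim_row (adj_mat C)" "j < dim_col (adj_mat C)"
    then have "det C * X $$ (i, j) = det C * adj_mat C $$ (i, j)"
      using arg_cong[OF eq, of "\<lambda>M. M $$ (i, j)"] X adj(1) by simp
    then show "X $$ (i, j) = adj_mat C $$ (i, j)"
      by (rule mpoly_mult_left_cancel[OF nz])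
  qed (use X adj(1) in auto)
qed

lemma adj_mat_block_diag:
  fixes A B :: "('e, 'k::field) mpoly mat"
  assumes A: "A \<in> carrier_mat n n" and B: "B \<in> carrier_mat m m"
    and nz: "det A \<noteq> 0" "det B \<noteq> 0"
  shows "adj_mat (block_diag A B) = block_diag (det B \<cdot>\<^sub>m adj_mat A) (det A \<cdot>\<^sub>m adj_mat B)"
proof (rule adj_mat_unique[symmetric])
  note a = adj_mat[OF A] and b = adj_mat[OF B]
  show "block_diag A B \<in> carrier_mat (n + m) (n + m)"
    using A B by (rule block_diag_carrier)
  show "block_diag (det B \<cdot>\<^sub>m adj_mat A) (det A \<cdot>\<^sub>m adj_mat B) \<in> carrier_mat (n + m) (n + m)"
    using a(1) b(1) by (intro block_diag_carrier) auto
  show "det (block_diag A B) \<noteq> 0"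
    using nz by (simp add: det_block_diag[OF A B] mpoly_no_zero_divisors)
  have "block_diag (det B \<cdot>\<^sub>m adj_mat A) (det A \<cdot>\<^sub>m adj_mat B) * block_diag A B =
      block_diag (det B \<cdot>\<^sub>m (det A \<cdot>\<^sub>m 1\<^sub>m n)) (det A \<cdot>\<^sub>m (det B \<cdot>\<^sub>m 1\<^sub>m m))"
    using A B a(1) b(1)
    by (subst block_diag_mult[of _ n _ m])
       (auto simp: mult_smult_assoc_mat[OF a(1) A] mult_smult_assoc_mat[OF b(1) B] a(3) b(3))
  also have "\<dots> = det (block_diag A B) \<cdot>\<^sub>m 1\<^sub>m (n + m)"
    by (intro eq_matI) (auto simp: det_block_diag[OF A B] mult.commute)
  finally show "block_diag (det B \<cdot>\<^sub>m adj_mat A) (det A \<cdot>\<^sub>m adj_mat B) * block_diag A B =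
      det (block_diag A B) \<cdot>\<^sub>m 1\<^sub>m (n + m)" .
qed

lemma adj_mat_congruence:
  fixes P D :: "('e, 'k::field) mpoly mat"
  assumes P: "P \<in> carrier_mat n n" and D: "D \<in> carrier_mat n n"
    and nz: "det (P * D * P\<^sup>T) \<noteq> 0"
  shows "adj_mat (P * D * P\<^sup>T) = adj_mat (P\<^sup>T) * adj_mat D * adj_mat P"
proof (rule adj_mat_unique[symmetric, OF _ _ nz])
  have T: "P\<^sup>T \<in> carrier_mat n n" using P by simp
  note p = adj_mat[OF P] and d = adj_mat[OF D] and t = adj_mat[OF T]
  show "P * D * P\<^sup>T \<in> carrier_mat n n" "adj_mat (P\<^sup>T) * adj_mat D * adj_mat P \<in> carrier_mat n n"
    using P D T p(1) d(1) t(1) by auto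
  have smult: "c \<cdot>\<^sub>m 1\<^sub>m n * X = c \<cdot>\<^sub>m X" "X * (c \<cdot>\<^sub>m Y) = c \<cdot>\<^sub>m (X * Y)"
    if "X \<in> carrier_mat n n" "Y \<in> carrier_mat n n" for c and X Y :: "('e, 'k) mpoly mat"
    using that by (simp_all add: mult_smult_assoc_mat[OF one_carrier_mat] mult_smult_distrib)
  have "adj_mat (P\<^sup>T) * adj_mat D * adj_mat P * (P * D * P\<^sup>T) =
      adj_mat (P\<^sup>T) * (adj_mat D * ((adj_mat P * P) * (D * P\<^sup>T)))"
    using P D T p(1) d(1) t(1) by (simp add: assoc_mult_mat[of _ n n _ n _ n])
  also have "\<dots> = det P \<cdot>\<^sub>m (adj_mat (P\<^sup>T) * (adj_mat D * (D * P\<^sup>T)))"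
    using D T p d(1) t(1) by (simp add: smult[where X = "D * P\<^sup>T"] smult(2)[where Y = "D * P\<^sup>T"]
        smult(2)[where Y = "adj_mat D * (D * P\<^sup>T)"])
  also have "adj_mat D * (D * P\<^sup>T) = (adj_mat D * D) * P\<^sup>T"
    using D T d(1) by (simp add: assoc_mult_mat[of _ n n _ n _ n])
  also have "\<dots> = det D \<cdot>\<^sub>m P\<^sup>T"
    using T by (simp add: d(3) smult(1)[where Y = "P\<^sup>T"])
  also have "adj_mat (P\<^sup>T) * (det D \<cdot>\<^sub>m P\<^sup>T) = det D \<cdot>\<^sub>m (det (P\<^sup>T) \<cdot>\<^sub>m 1\<^sub>m n)"
    using T t by (simp add: smult(2))
  also have "det P \<cdot>\<^sub>m (det D \<cdot>\<^sub>m (det (P\<^sup>T) \<cdot>\<^sub>m 1\<^sub>m n)) = det (P * D * P\<^sup>T) \<cdot>\<^sub>m 1\<^sub>m n"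
    using P D T by (intro eq_matI) (simp_all add: det_mult[of _ n] mult_ac)
  finally show "adj_mat (P\<^sup>T) * adj_mat D * adj_mat P * (P * D * P\<^sup>T) = det (P * D * P\<^sup>T) \<cdot>\<^sub>m 1\<^sub>m n" .
qed

definition entries :: "'a mat \<Rightarrow> 'a set" where
  "entries M = {M $$ (i, j) | i j. i < dim_row M \<and> j < dim_col M}"

lemma entriesI: "i < dim_row M \<Longrightarrow> j < dim_col M \<Longrightarrow> M $$ (i, j) \<in> entries M"
  by (auto simp: entries_def)

lemma entries_mult_subset:
  fixes X Y :: "'a::comm_ring_1 mat"
  assumes J: "is_ideal J" and dim: "X \<in> carrier_mat n n" "Y \<in> carrier_mat n n"
    and "entries X \<subseteq> J \<or> entries Y \<subseteq> J"
  shows "entries (X * Y) \<subseteq> J"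
proof
  fix a assume "a \<in> entries (X * Y)"
  then obtain i j where ij: "i < n" "j < n" "a = (X * Y) $$ (i, j)"
    using dim by (auto simp: entries_def)
  then have "a = (\<Sum>k=0..<n. X $$ (i, k) * Y $$ (k, j))"
    using dim by (simp add: scalar_prod_def)
  moreover have "X $$ (i, k) * Y $$ (k, j) \<in> J" if "k < n" for k
  proof -
    have "X $$ (i, k) \<in> entries X" "Y $$ (k, j) \<in> entries Y"
      using ij dim that by (auto simp: entries_def)
    then show ?thesis
      using assms(4) ideal_absorb[OF J] by blast
  qed
  ultimately show "a \<in> J"
    by (auto intro!: ring_mod.subspace_sum[OF J])
qed

text \<open>The off-diagonal blocks contribute the entry \<open>0\<close>, unless one of the blocks is empty.\<close>

lemma entries_block_diag:
  fixes A B :: "'a::zero mat"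
  assumes "A \<in> carrier_mat n n" "B \<in> carrier_mat m m"
  shows "insert 0 (entries (block_diag A B)) = insert 0 (entries A \<union> entries B)"
proof (intro equalityI subsetI)
  fix a assume "a \<in> insert 0 (entries (block_diag A B))"
  then consider "a = 0" | i j where "i < n + m" "j < n + m" "a = block_diag A B $$ (i, j)"
    using assms by (auto simp: entries_def)
  then show "a \<in> insert 0 (entries A \<union> entries B)"
  proof cases
    case 2
    consider "i < n" "j < n" "a = A $$ (i, j)" | "i - n < m" "j - n < m" "a = B $$ (i - n, j - n)" | "a = 0"
      using 2 assms by (cases "i < n"; cases "j < n") auto
    then show ?thesis
      using assms by cases (auto simp: entries_def)
  qed simp
next
  fix a assume "a \<in> insert 0 (entries A \<union> entries B)"
  then consider "a = 0" | i j where "i < n" "j < n" "a = A $$ (i, j)"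
    | i j where "i < m" "j < m" "a = B $$ (i, j)"
    using assms by (auto simp: entries_def)
  then show "a \<in> insert 0 (entries (block_diag A B))"
  proof cases
    case 2
    then have "a = block_diag A B $$ (i, j)" "i < n + m" "j < n + m"
      using assms by auto
    then show ?thesis using assms entriesI[of i "block_diag A B" j] by simp
  next
    case 3
    then have "a = block_diag A B $$ (n + i, n + j)" "n + i < n + m" "n + j < n + m"
      using assms by auto
    then show ?thesis using assms entriesI[of "n + i" "block_diag A B" "n + j"] by simp
  qed simp
qed

lemma entries_smult: "entries (c \<cdot>\<^sub>m A) = (*) c ` entries A"
proof -
  have image: "entries M = (\<lambda>(i, j). M $$ (i, j)) ` ({..<dim_row M} \<times> {..<dim_col M})" for M :: "'a mat"
    by (auto simp: entries_def)
  show ?thesis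
    unfolding image image_image by (intro image_cong) auto
qed

text \<open>Cofactors and minors differ by signs only.\<close>

lemma ideal_span_minors:
  fixes C :: "'a::comm_ring_1 mat"
  assumes "C \<in> carrier_mat n n"
  shows "ideal_span {det (mat_delete C i j) | i j. i < n \<and> j < n} = ideal_span (entries (adj_mat C))"
proof -
  let ?m = "\<lambda>i j. det (mat_delete C i j)"
  have ent: "entries (adj_mat C) = {(- 1) ^ (i + j) * ?m i j | i j. i < n \<and> j < n}"
  proof (intro equalityI subsetI)
    fix a assume "a \<in> entries (adj_mat C)"
    then obtain i j where "i < n" "j < n" "a = (- 1) ^ (j + i) * ?m j i"
      using assms by (auto simp: entries_def adj_mat_def cofactor_def)
    then show "a \<in> {(- 1) ^ (i + j) * ?m i j | i j. i < n \<and> j < n}" by blast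
  next
    fix a assume "a \<in> {(- 1) ^ (i + j) * ?m i j | i j. i < n \<and> j < n}"
    then obtain i j where "i < n" "j < n" "a = (- 1) ^ (i + j) * ?m i j" by blast
    then show "a \<in> entries (adj_mat C)"
      using assms entriesI[of j "adj_mat C" i] by (simp add: adj_mat_def cofactor_def)
  qed
  have "?m i j \<in> ideal_span (entries (adj_mat C))" if "i < n" "j < n" for i j
  proof -
    have "(- 1) ^ (i + j) * ?m i j \<in> ideal_span (entries (adj_mat C))"
      using that by (intro ring_mod.span_base) (auto simp: ent)
    from ring_mod.span_scale[OF this, of "(- 1) ^ (i + j)"] show ?thesis
      by (simp add: mult.assoc[symmetric] flip: power_mult_distrib)
  qed
  moreover have "(- 1) ^ (i + j) * ?m i j \<in> ideal_span {?m i j | i j. i < n \<and> j < n}"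
    if "i < n" "j < n" for i j
    using that by (intro ring_mod.span_scale ring_mod.span_base) auto
  ultimately show ?thesis
    unfolding ring_mod.span_eq ent by blast
qed

section \<open>Change of basis and direct sums of configurations\<close>

lemma span_list_combination:
  assumes "v \<in> fun_vs.span (set bs)"
  shows "\<exists>p. \<forall>e. v e = (\<Sum>k<length bs. p k * (bs ! k) e)"
  using assms
proof (induction rule: fun_vs.span_induct_alt)
  case base
  show ?case by (intro exI[of _ "\<lambda>_. 0"]) simp
next
  case (step c x y)
  then obtain p k where p: "\<And>e. y e = (\<Sum>k<length bs. p k * (bs ! k) e)"
    and k: "k < length bs" "x = bs ! k"
    by (auto simp: in_set_conv_nth)
  have *: "((\<lambda>e. c * x e) + y) e = (\<Sum>i<length bs. (if i = k then p i + c else p i) * (bs ! i) e)" for e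
  proof -
    have "(\<Sum>i<length bs. (if i = k then p i + c else p i) * (bs ! i) e) =
        (\<Sum>i<length bs. p i * (bs ! i) e + (if i = k then c * (bs ! i) e else 0))"
      by (intro sum.cong) (auto simp: algebra_simps)
    then show ?thesis
      using k by (simp add: sum.distrib p)
  qed
  show ?case
    by (rule exI[of _ "\<lambda>i. if i = k then p i + c else p i"]) (rule allI, rule *)
qed

text \<open>The rows of \<open>P\<close> are coefficients expressing the vectors \<open>ws\<close> through \<open>bs\<close>. Used in both
  directions, this makes the ideals independent of the basis.\<close>

lemma config_matrix_change_basis:
  fixes ws bs :: "('e \<Rightarrow> 'k::field) list"
  assumes len: "length ws = length bs" and sub: "set ws \<subseteq> fun_vs.span (set bs)"
  obtains P where "P \<in> carrier_mat (length bs) (length bs)"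
    "config_matrix E ws = map_mat Const P * config_matrix E bs * (map_mat Const P)\<^sup>T"
proof -
  let ?r = "length bs"
  have "\<exists>p. \<forall>e. (ws ! i) e = (\<Sum>k<?r. p k * (bs ! k) e)" if "i < ?r" for i
    using that len sub by (intro span_list_combination) (auto dest: nth_mem)
  then obtain p where p: "\<And>i e. i < ?r \<Longrightarrow> (ws ! i) e = (\<Sum>k<?r. p i k * (bs ! k) e)"
    by metis
  define P where "P = mat ?r ?r (\<lambda>(i, k). p i k)"
  let ?P = "map_mat Const P :: ('e, 'k) mpoly mat" and ?D = "config_matrix E bs"
  have car: "?P \<in> carrier_mat ?r ?r" "?D \<in> carrier_mat ?r ?r"
    by (simp_all add: P_def)
  have "config_matrix E ws = ?P * ?D * ?P\<^sup>T"
  proof (rule eq_matI)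
    fix i j assume "i < dim_row (?P * ?D * ?P\<^sup>T)" "j < dim_col (?P * ?D * ?P\<^sup>T)"
    then have ij: "i < ?r" "j < ?r" using car by auto
    have entry: "(A * B) $$ (a, b) = (\<Sum>k<?r. A $$ (a, k) * B $$ (k, b))"
      if "A \<in> carrier_mat ?r ?r" "B \<in> carrier_mat ?r ?r" "a < ?r" "b < ?r"
      for A B :: "('e, 'k) mpoly mat" and a b
      using that by (simp add: scalar_prod_def atLeast0LessThan)
    have "(?P * ?D * ?P\<^sup>T) $$ (i, j) = (\<Sum>l<?r. (\<Sum>k<?r. ?P $$ (i, k) * ?D $$ (k, l)) * ?P\<^sup>T $$ (l, j))"
    proof -
      have "?P * ?D \<in> carrier_mat ?r ?r" using car by simp
      then have "(?P * ?D * ?P\<^sup>T) $$ (i, j) = (\<Sum>l<?r. (?P * ?D) $$ (i, l) * ?P\<^sup>T $$ (l, j))"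
        using ij car by (intro entry) auto
      also have "\<dots> = (\<Sum>l<?r. (\<Sum>k<?r. ?P $$ (i, k) * ?D $$ (k, l)) * ?P\<^sup>T $$ (l, j))"
        using ij car by (intro sum.cong refl arg_cong2[where f = "(*)"] entry) auto
      finally show ?thesis .
    qed
    also have "\<dots> = (\<Sum>l<?r. \<Sum>k<?r. \<Sum>e\<in>E. Const (p i k) * (Var e * Const ((bs ! k) e * (bs ! l) e)) * Const (p j l))"
      using ij unfolding sum_distrib_right
      by (intro sum.cong refl) (simp add: P_def config_matrix_def sum_distrib_left sum_distrib_right)
    also have "\<dots> = (\<Sum>l<?r. \<Sum>e\<in>E. \<Sum>k<?r. Const (p i k) * (Var e * Const ((bs ! k) e * (bs ! l) e)) * Const (p j l))"
      by (intro sum.cong refl sum.swap)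
    also have "\<dots> = (\<Sum>e\<in>E. \<Sum>l<?r. \<Sum>k<?r. Const (p i k) * (Var e * Const ((bs ! k) e * (bs ! l) e)) * Const (p j l))"
      by (rule sum.swap)
    also have "\<dots> = (\<Sum>e\<in>E. Var e * Const ((ws ! i) e * (ws ! j) e))"
    proof (rule sum.cong[OF refl])
      fix e
      have "(ws ! i) e * (ws ! j) e = (\<Sum>l<?r. \<Sum>k<?r. p i k * ((bs ! k) e * (bs ! l) e) * p j l)"
        by (subst sum.swap) (simp add: p[OF ij(1)] p[OF ij(2)] sum_product mult_ac)
      then show "(\<Sum>l<?r. \<Sum>k<?r. Const (p i k) * (Var e * Const ((bs ! k) e * (bs ! l) e)) * Const (p j l)) =
          Var e * Const ((ws ! i) e * (ws ! j) e)"
        by (simp only: Const.hom_sum Const.hom_mult sum_distrib_left mult_ac)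
    qed
    finally show "config_matrix E ws $$ (i, j) = (?P * ?D * ?P\<^sup>T) $$ (i, j)"
      using ij len by (simp add: config_matrix_def)
  qed (use len in \<open>simp_all add: P_def config_matrix_def\<close>)
  moreover have "P \<in> carrier_mat ?r ?r" by (simp add: P_def)
  ultimately show ?thesis using that by blast
qed

lemma config_poly_change_basis:
  fixes ws bs :: "('e \<Rightarrow> 'k::field) list"
  assumes "length ws = length bs" "set ws \<subseteq> fun_vs.span (set bs)"
  obtains c where "config_poly E ws = Const c * config_poly E bs"
proof -
  obtain P where P: "P \<in> carrier_mat (length bs) (length bs)"
    "config_matrix E ws = map_mat Const P * config_matrix E bs * (map_mat Const P)\<^sup>T"
    using config_matrix_change_basis[OF assms] by blast
  let ?r = "length bs" and ?P = "map_mat Const P :: ('e, 'k) mpoly mat"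
  have car: "?P \<in> carrier_mat ?r ?r" using P(1) by simp
  have "config_poly E ws = det ?P * config_poly E bs * det (?P\<^sup>T)"
    unfolding config_poly_def P(2) using car
    by (simp add: det_mult[of _ ?r])
  also have "\<dots> = Const (det P * det P) * config_poly E bs"
    unfolding det_transpose[OF car] by (simp add: Const.hom_mult mult_ac)
  finally show ?thesis by (rule that)
qed

text \<open>The ideal of submaximal minors. For length \<open>1\<close> it is the unit ideal, since the empty
  determinant is \<open>1\<close>.\<close>

definition minor_ideal :: "'e set \<Rightarrow> ('e \<Rightarrow> 'k::field) list \<Rightarrow> ('e, 'k) mpoly set" where
  "minor_ideal E ws = ideal_span (entries (adj_mat (config_matrix E ws)))"

lemma minor_ideal_change_basis:
  fixes ws bs :: "('e \<Rightarrow> 'k::field) list"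
  assumes "length ws = length bs" "set ws \<subseteq> fun_vs.span (set bs)" "config_poly E ws \<noteq> 0"
  shows "minor_ideal E ws \<subseteq> minor_ideal E bs"
proof -
  obtain P where P: "P \<in> carrier_mat (length bs) (length bs)"
    "config_matrix E ws = map_mat Const P * config_matrix E bs * (map_mat Const P)\<^sup>T"
    using config_matrix_change_basis[OF assms(1,2)] by blast
  let ?r = "length bs" and ?P = "map_mat Const P :: ('e, 'k) mpoly mat" and ?D = "config_matrix E bs"
  have car: "?P \<in> carrier_mat ?r ?r" "?D \<in> carrier_mat ?r ?r" "?P\<^sup>T \<in> carrier_mat ?r ?r"
    using P(1) by simp_all
  have adj: "adj_mat (config_matrix E ws) = adj_mat (?P\<^sup>T) * adj_mat ?D * adj_mat ?P"
    unfolding P(2) using assms(3) P(2) car by (intro adj_mat_congruence) (auto simp: config_poly_def)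
  have "entries (adj_mat ?D) \<subseteq> minor_ideal E bs"
    unfolding minor_ideal_def by (rule ring_mod.span_superset)
  then have "entries (adj_mat (?P\<^sup>T) * adj_mat ?D) \<subseteq> minor_ideal E bs"
    by (intro entries_mult_subset[OF _ adj_mat(1)[OF car(3)] adj_mat(1)[OF car(2)]])
       (simp_all add: minor_ideal_def)
  then have "entries (adj_mat (config_matrix E ws)) \<subseteq> minor_ideal E bs"
    unfolding adj
    by (intro entries_mult_subset[OF _ mult_carrier_mat[OF adj_mat(1)[OF car(3)] adj_mat(1)[OF car(2)]]
          adj_mat(1)[OF car(1)]])
       (simp_all add: minor_ideal_def)
  then show ?thesis
    unfolding minor_ideal_def by (simp add: ring_mod.span_minimal)
qed

lemma config_matrix_append:
  fixes ws vs :: "('e \<Rightarrow> 'k::field) list"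
  assumes fin: "finite F" "finite G" and disj: "F \<inter> G = {}"
    and sub: "set ws \<subseteq> coord_space F" "set vs \<subseteq> coord_space G"
  shows "config_matrix (F \<union> G) (ws @ vs) = block_diag (config_matrix F ws) (config_matrix G vs)"
proof -
  have zero: "w e = 0" if "w \<in> set ws" "e \<notin> F" for w e
    using that sub(1) by (auto simp: coord_space_def)
  have zero': "v e = 0" if "v \<in> set vs" "e \<notin> G" for v e
    using that sub(2) by (auto simp: coord_space_def)
  have left: "(\<Sum>e\<in>F \<union> G. Var e * Const (w e * w' e)) = (\<Sum>e\<in>F. Var e * Const (w e * w' e))"
    if "w \<in> set ws" for w w'
    using fin disj zero[OF that] by (intro sum.mono_neutral_right) auto
  have right: "(\<Sum>e\<in>F \<union> G. Var e * Const (v e * v' e)) = (\<Sum>e\<in>G. Var e * Const (v e * v' e))"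
    if "v \<in> set vs" for v v'
    using fin disj zero'[OF that] by (intro sum.mono_neutral_right) auto
  have mixed: "(\<Sum>e\<in>H. Var e * Const (w e * v e)) = 0"
    "(\<Sum>e\<in>H. Var e * Const (v e * w e)) = 0"
    if "w \<in> set ws" "v \<in> set vs" for w v H
  proof -
    have z: "w e * v e = 0" "v e * w e = 0" for e
      using zero[OF that(1), of e] zero'[OF that(2), of e] disj by auto
    then show "(\<Sum>e\<in>H. Var e * Const (w e * v e)) = 0"
      "(\<Sum>e\<in>H. Var e * Const (v e * w e)) = 0"
      by (simp_all only: z Const.hom_zero mult_zero_right sum.neutral_const)
  qed
  show ?thesis
  proof (rule eq_matI)
    fix i j
    assume "i < dim_row (block_diag (config_matrix F ws) (config_matrix G vs))"
      "j < dim_col (block_diag (config_matrix F ws) (config_matrix G vs))"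
    then have "i < length ws + length vs" "j < length ws + length vs"
      by (simp_all add: config_matrix_def)
    then show "config_matrix (F \<union> G) (ws @ vs) $$ (i, j) =
        block_diag (config_matrix F ws) (config_matrix G vs) $$ (i, j)"
      by (cases "i < length ws"; cases "j < length ws")
         (simp_all add: config_matrix_def nth_append left right mixed)
  qed (simp_all add: config_matrix_def)
qed

section \<open>Partial derivatives\<close>

lemma partial_superset:
  assumes "finite S" "keys p \<subseteq> S"
  shows "partial e p = (\<Sum>m\<in>S. single (m - single e 1)
     (of_nat (lookup m e) * lookup p m))"
  unfolding partial_def using assms
  by (intro sum.mono_neutral_left) (auto simp: in_keys_iff)

lemma partial_add: "partial e (p + q) = partial e p + partial e q"
proof -
  let ?S = "keys p \<union> keys q"
  have "keys (p + q) \<subseteq> ?S"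
    by (rule Poly_Mapping.keys_add)
  then show ?thesis
    by (simp add: partial_superset[of ?S] lookup_add distrib_left single_add sum.distrib)
qed

lemma partial_zero [simp]: "partial e 0 = 0"
  by (simp add: partial_def)

lemma partial_sum: "partial e (sum f A) = (\<Sum>x\<in>A. partial e (f x))"
  by (induction A rule: infinite_finite_induct) (simp_all add: partial_add)

lemma partial_single:
  "partial e (single m c) =
     single (m - single e 1) (of_nat (lookup m e) * c)"
  by (cases "c = 0") (simp_all add: partial_def)

lemma partial_mult: "partial e (p * q) = partial e p * q + p * partial e q"
proof -
  let ?l = "lookup" and ?s = "single"
  let ?e = "?s e (1::nat)"
  have mono: "partial e (?s (m + n) (a * b)) = partial e (?s m a) * ?s n b + ?s m a * partial e (?s n b)"
    for m n and a b :: 'b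
  proof -
    have shift: "?s (m + n - ?e) (of_nat (?l m e) * c) = ?s (m - ?e + n) (of_nat (?l m e) * c)" for m n and c :: 'b
    proof (cases "?l m e = 0")
      case False
      then have "m + n - ?e = m - ?e + n"
        by (intro poly_mapping_eqI) (auto simp: lookup_add lookup_minus lookup_single when_def)
      then show ?thesis by simp
    qed simp
    have "partial e (?s (m + n) (a * b)) =
        ?s (m + n - ?e) (of_nat (?l m e) * (a * b)) + ?s (n + m - ?e) (of_nat (?l n e) * (a * b))"
      by (simp add: partial_single lookup_add distrib_right single_add add.commute)
    also have "\<dots> = partial e (?s m a) * ?s n b + ?s m a * partial e (?s n b)"
      unfolding shift partial_single mult_single by (simp add: mult_ac add_ac)
    finally show ?thesis .
  qed
  have expand: "partial e r = (\<Sum>m\<in>keys r. partial e (?s m (?l r m)))" for r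
    by (simp only: partial_single) (simp add: partial_def)
  have left: "partial e p * q = (\<Sum>m\<in>keys p. partial e (?s m (?l p m))) *
      (\<Sum>n\<in>keys q. ?s n (?l q n))"
    by (simp only: expand[symmetric] mpoly_as_sum[symmetric])
  have right: "p * partial e q = (\<Sum>m\<in>keys p. ?s m (?l p m)) *
      (\<Sum>n\<in>keys q. partial e (?s n (?l q n)))"
    by (simp only: expand[symmetric] mpoly_as_sum[symmetric])
  have "partial e (p * q) = (\<Sum>m\<in>keys p. \<Sum>n\<in>keys q.
      partial e (?s (m + n) (?l p m * ?l q n)))"
    by (subst mpoly_as_sum[of p], subst mpoly_as_sum[of q])
       (simp add: sum_product mult_single partial_sum)
  also have "\<dots> = partial e p * q + p * partial e q"
    unfolding left right by (simp only: mono sum.distrib sum_product)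
  finally show ?thesis .
qed

lemma partial_no_var:
  assumes "e \<notin> vars p"
  shows "partial e p = 0"
  using assms unfolding partial_def vars_def
  by (intro sum.neutral) (auto simp: in_keys_iff)

lemma partial_Var: "partial e (Var e) = 1"
  by (simp add: Var_def partial_single)

lemma partial_Const_mult: "partial e (Const c * p) = Const c * partial e p"
  by (simp add: partial_mult partial_no_var)

lemma vars_partial: "vars (partial e p) \<subseteq> vars p"
  unfolding partial_def
proof (rule vars_sum_subset)
  fix m assume m: "m \<in> keys p"
  have "keys (m - single e 1) \<subseteq> keys m"
    by (auto simp: in_keys_iff lookup_minus)
  then show "vars (single (m - single e 1)
      (of_nat (lookup m e) * lookup p m)) \<subseteq> vars p"
    using m by (auto simp: vars_def split: if_splits)
qed

text \<open>The derivative is the nonzero leading coefficient in \<open>x\<^sub>e\<close>, which has smaller degree.\<close>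

lemma multiaffine_not_dvd_partial:
  fixes p :: "('e, 'k::field) mpoly"
  assumes "multiaffine p" "e \<in> vars p"
  shows "\<not> p dvd partial e p"
proof
  assume "p dvd partial e p"
  then obtain q where q: "partial e p = p * q" by (elim dvdE)
  obtain A B where p: "p = A * Var e + B" "A \<noteq> 0" and vars: "vars A \<subseteq> vars p - {e}" "vars B \<subseteq> vars p - {e}"
    by (rule multiaffine_decompose[OF assms])
  then have "partial e A = 0" "partial e B = 0"
    by (auto intro: partial_no_var)
  then have A: "partial e p = A"
    by (subst p(1)) (simp add: partial_add partial_mult partial_Var)
  then have "vars A = vars p \<union> vars q"
    using vars_mult_eq[of p q] q p(2) by simp
  then show False using vars assms(2) by blast
qed

section \<open>Intersections of ideals in disjoint sets of variables\<close>

lemma ideal_cancel_add: "is_ideal J \<Longrightarrow> a + b \<in> J \<Longrightarrow> b \<in> J \<Longrightarrow> a \<in> J"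
  using ring_mod.subspace_diff[of J "a + b" b] by simp

lemma restrict_vars_ideal_span:
  assumes "\<And>s. s \<in> S \<Longrightarrow> restrict_vars F s = 0" "f \<in> ideal_span S"
  shows "restrict_vars F f = 0"
  using assms(2)
  by (induction f rule: ring_mod.span_induct_alt)
     (simp_all add: restrict_vars.hom_zero restrict_vars.hom_add restrict_vars.hom_mult assms(1))

lemma restrict_vars_disjoint:
  assumes "vars p \<inter> F = {}"
  shows "restrict_vars F p = Const (lookup p 0)"
proof -
  have "restrict_vars F p = restrict_vars {} p"
    by (rule ring_hom_unique[OF restrict_vars.comm_ring_hom_axioms restrict_vars.comm_ring_hom_axioms])
       (use assms in \<open>auto simp: restrict_vars_Var\<close>)
  moreover have "restrict_vars {} p = Const (lookup (restrict_vars {} p) 0)"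
    using vars_restrict_vars[of "{}" p] by (intro no_vars_imp_Const) simp
  ultimately show ?thesis
    by (simp add: lookup_restrict_vars)
qed

lemma ideal_adjoin_span: "ideal_adjoin (ideal_span S) p = ideal_span (insert p S)"
  by (auto simp: ideal_span_insert ring_mod.span_span)

text \<open>Vanishing constant terms provide a common zero of the \<open>\<psi> j\<close> with \<open>j \<noteq> i\<close> at which the
  variables of \<open>\<psi> i\<close> remain free.\<close>

locale disjoint_primes =
  fixes N :: "'i set" and \<psi> :: "'i \<Rightarrow> ('e, 'k::field) mpoly"
  assumes finite: "finite N"
    and indecomposable: "i \<in> N \<Longrightarrow> indecomposable (\<psi> i)"
    and disjoint: "i \<in> N \<Longrightarrow> j \<in> N \<Longrightarrow> i \<noteq> j \<Longrightarrow> vars (\<psi> i) \<inter> vars (\<psi> j) = {}"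
    and no_constant_term: "i \<in> N \<Longrightarrow> lookup (\<psi> i) 0 = 0"
begin

definition others :: "'i \<Rightarrow> ('e, 'k) mpoly" where
  "others i = (\<Prod>j\<in>N - {i}. \<psi> j)"

lemma vars_nonempty: "i \<in> N \<Longrightarrow> vars (\<psi> i) \<noteq> {}"
  using indecomposable by (auto simp: indecomposable_def)

lemma nonzero: "i \<in> N \<Longrightarrow> \<psi> i \<noteq> 0"
  using vars_nonempty vars_simps(1) by metis

lemma restrict_other:
  "i \<in> N \<Longrightarrow> j \<in> N \<Longrightarrow> i \<noteq> j \<Longrightarrow> restrict_vars (vars (\<psi> i)) (\<psi> j) = 0"
  using disjoint no_constant_term by (simp add: restrict_vars_disjoint)

lemma prime_single:
  assumes "i \<in> N"
  shows "is_prime_ideal (ideal_span {\<psi> i})"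
proof -
  have "is_prime_ideal (ideal_adjoin {0} (\<psi> i))"
    using assms indecomposable
    by (intro indecomposable_prime[OF is_prime_ideal_zero free_of_zero, of "vars (\<psi> i)"])
       (auto simp: restrict_vars.hom_zero)
  also have "ideal_adjoin {0} (\<psi> i) = ideal_span {\<psi> i}"
    using ideal_adjoin_span[where S = "{}" and p = "\<psi> i"] by simp
  finally show ?thesis .
qed

lemma prime_pair:
  assumes ij: "i \<in> N" "j \<in> N" "i \<noteq> j"
  shows "is_prime_ideal (ideal_span {\<psi> i, \<psi> j})"
proof -
  have "is_prime_ideal (ideal_adjoin (ideal_span {\<psi> i}) (\<psi> j))"
  proof (rule indecomposable_prime[OF prime_single[OF ij(1)] _ _ indecomposable[OF ij(2)] order_refl])
    show "free_of e (ideal_span {\<psi> i})" if "e \<in> vars (\<psi> j)" for e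
      using that disjoint[OF ij] by (intro free_of_ideal_span) auto
    show "restrict_vars (vars (\<psi> j)) q = 0" if "q \<in> ideal_span {\<psi> i}" for q
      by (rule restrict_vars_ideal_span[OF _ that]) (use restrict_other ij in auto)
  qed
  then show ?thesis
    by (simp add: ideal_adjoin_span insert_commute)
qed

lemma not_in_span_others:
  assumes "k \<in> N" "M \<subseteq> N - {k}"
  shows "\<psi> k \<notin> ideal_span (\<psi> ` M)"
proof
  assume "\<psi> k \<in> ideal_span (\<psi> ` M)"
  then have "restrict_vars (vars (\<psi> k)) (\<psi> k) = 0"
    by (rule restrict_vars_ideal_span[rotated]) (use assms restrict_other in auto)
  then show False
    using nonzero[OF assms(1)] by (simp add: restrict_vars_id)
qed

lemma prod_dvd_iff:
  assumes "M \<subseteq> N"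
  shows "(\<Prod>i\<in>M. \<psi> i) dvd f \<longleftrightarrow> (\<forall>i\<in>M. \<psi> i dvd f)"
proof -
  have "finite M" using assms finite by (rule finite_subset)
  then show ?thesis using assms
  proof (induction M arbitrary: f rule: finite_induct)
    case (insert k M)
    have "(\<Prod>i\<in>insert k M. \<psi> i) dvd f" if dvd: "\<forall>i\<in>insert k M. \<psi> i dvd f"
    proof -
      obtain g where g: "f = \<psi> k * g" using dvd by (auto elim: dvdE)
      have "\<psi> i dvd g" if i: "i \<in> M" for i
      proof -
        have "i \<in> N" "k \<in> N" "i \<noteq> k" using i insert by auto
        then have "\<psi> k \<notin> ideal_span {\<psi> i}"
          using not_in_span_others[of k "{i}"] by auto
        moreover have "\<psi> k * g \<in> ideal_span {\<psi> i}"
          using dvd i g by (simp add: ideal_span_singleton)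
        ultimately show ?thesis
          using is_prime_idealD(3)[OF prime_single[OF \<open>i \<in> N\<close>], of "\<psi> k" g]
          by (simp add: ideal_span_singleton)
      qed
      then have "(\<Prod>i\<in>M. \<psi> i) dvd g"
        using insert by simp
      then show ?thesis
        using insert.hyps by (simp add: g mult_dvd_mono)
    qed
    moreover have "\<forall>i\<in>insert k M. \<psi> i dvd f" if "(\<Prod>i\<in>insert k M. \<psi> i) dvd f"
      using dvd_prodI[of "insert k M" _ \<psi>] insert.hyps(1) that dvd_trans by blast
    ultimately show ?case by blast
  qed simp
qed

text \<open>When \<open>k\<close> is added to \<open>M\<close>, all terms but the \<open>i\<close>-th of the given combination are divisible by
  \<open>\<psi> i\<close>. Hence membership in \<open>(\<psi> i, \<psi> k)\<close> forces the \<open>i\<close>-th coefficient into this prime ideal, since the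
  other \<open>\<psi> j\<close> are not in it. Substituting \<open>g i = a i * \<psi> i + b i * \<psi> k\<close> gives a combination for
  \<open>insert k M\<close>.\<close>

lemma in_pairs_imp_in_span:
  assumes "M \<subseteq> N" "M \<noteq> {}"
    and "\<And>i j. i \<in> M \<Longrightarrow> j \<in> M \<Longrightarrow> i \<noteq> j \<Longrightarrow> f \<in> ideal_span {\<psi> i, \<psi> j}"
  shows "\<exists>g. f = (\<Sum>i\<in>M. g i * (\<Prod>j\<in>M - {i}. \<psi> j))"
proof -
  have "finite M" using assms(1) finite by (rule finite_subset)
  then show ?thesis using assms(2,1,3)
  proof (induction M rule: finite_ne_induct)
    case (singleton k)
    show ?case by (intro exI[of _ "\<lambda>_. f"]) simp
  next
    case (insert k M)
    let ?P = "\<lambda>M i. \<Prod>j\<in>M - {i}. \<psi> j"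
    have fin: "finite M" and k: "k \<notin> M" "k \<in> N" and M: "M \<subseteq> N" using insert by auto
    obtain g where g: "f = (\<Sum>i\<in>M. g i * ?P M i)"
      using insert.IH insert.prems by (metis insert_iff insert_subset)
    have "\<exists>a b. g i = a * \<psi> i + b * \<psi> k" if i: "i \<in> M" for i
    proof -
      let ?J = "ideal_span {\<psi> i, \<psi> k}"
      have iN: "i \<in> N" "i \<noteq> k" using i k M by auto
      have J: "is_prime_ideal ?J" by (rule prime_pair[OF iN(1) k(2) iN(2)])
      note I = is_prime_idealD(1)[OF J]
      have rest: "(\<Sum>l\<in>M - {i}. g l * ?P M l) \<in> ?J"
      proof (rule ring_mod.subspace_sum[OF I])
        fix l assume l: "l \<in> M - {i}"
        have "\<psi> i dvd g l * ?P M l"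
          using l i fin by (intro dvd_mult dvd_prodI) auto
        then show "g l * ?P M l \<in> ?J"
          by (rule ideal_dvd[OF I, rotated]) (simp add: ring_mod.span_base)
      qed
      have split: "f = g i * ?P M i + (\<Sum>l\<in>M - {i}. g l * ?P M l)"
        unfolding g by (rule sum.remove[OF fin i])
      have "f \<in> ?J"
        using i iN by (intro insert.prems(2)) simp_all
      then have "g i * ?P M i \<in> ?J"
        unfolding split by (rule ideal_cancel_add[OF I _ rest])
      moreover have "?P M i \<notin> ?J"
      proof
        assume "?P M i \<in> ?J"
        then obtain l where "l \<in> M - {i}" "\<psi> l \<in> ?J"
          using prime_ideal_prod[OF J] fin by blast
        then show False
          using not_in_span_others[of l "{i, k}"] iN k M by auto
      qed
      ultimately have "g i \<in> ?J"
        using is_prime_idealD(3)[OF J] by blast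
      then obtain a b where "g i - a * \<psi> i = b * \<psi> k"
        by (auto simp: ideal_span_insert ring_mod.span_singleton)
      then show ?thesis by (metis diff_add_cancel add.commute)
    qed
    then obtain a b where ab: "\<And>i. i \<in> M \<Longrightarrow> g i = a i * \<psi> i + b i * \<psi> k"
      by metis
    define h where "h i = (if i = k then \<Sum>i\<in>M. a i else b i)" for i
    have "f = (\<Sum>i\<in>M. a i * ?P (insert k M) k + b i * ?P (insert k M) i)"
      unfolding g
    proof (rule sum.cong[OF refl])
      fix i assume i: "i \<in> M"
      have "?P (insert k M) k = \<psi> i * ?P M i"
        using k fin i by (simp add: prod.remove)
      moreover have "insert k M - {i} = insert k (M - {i})"
        using i k by auto
      then have "?P (insert k M) i = \<psi> k * ?P M i"
        using k fin by simp
      ultimately show "g i * ?P M i = a i * ?P (insert k M) k + b i * ?P (insert k M) i"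
        using ab[OF i] by (simp add: algebra_simps)
    qed
    also have "\<dots> = h k * ?P (insert k M) k + (\<Sum>i\<in>M. h i * ?P (insert k M) i)"
    proof -
      have "(\<Sum>i\<in>M. h i * ?P (insert k M) i) = (\<Sum>i\<in>M. b i * ?P (insert k M) i)"
        using k by (intro sum.cong) (auto simp: h_def)
      then show ?thesis
        by (simp add: h_def sum.distrib sum_distrib_right)
    qed
    also have "\<dots> = (\<Sum>i\<in>insert k M. h i * ?P (insert k M) i)"
      using k fin by simp
    finally show ?case by blast
  qed
qed

text \<open>Let \<open>f = \<Sum>\<^sub>i g\<^sub>i * others i\<close> lie in the ideal generated by \<open>S i\<close>. Modulo this ideal only the
  \<open>i\<close>-th term remains, and \<open>others i\<close> is a nonzerodivisor there because it involves other variables than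
  \<open>S i\<close>. So \<open>g\<^sub>i\<close> belongs to the ideal.\<close>

theorem intersection_eq_span_products:
  assumes ne: "N \<noteq> {}"
    and S: "\<And>i s. i \<in> N \<Longrightarrow> s \<in> S i \<Longrightarrow> vars s \<subseteq> vars (\<psi> i)"
    and \<psi>: "\<And>i. i \<in> N \<Longrightarrow> \<psi> i \<in> ideal_span (S i)"
  shows "ideal_span {s * others i | i s. i \<in> N \<and> s \<in> S i} =
    {f. (\<forall>i\<in>N. f \<in> ideal_span (S i)) \<and>
        (\<forall>i\<in>N. \<forall>j\<in>N. i \<noteq> j \<longrightarrow> f \<in> ideal_span {\<psi> i, \<psi> j})}" (is "?L = ?R")
proof (intro equalityI subsetI)
  fix f assume f: "f \<in> ?L"
  have other: "\<psi> k dvd others i" if "k \<in> N" "k \<noteq> i" for i k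
    unfolding others_def using that finite by (intro dvd_prodI) auto
  have "s * others i \<in> ideal_span (S k)" if "i \<in> N" "s \<in> S i" "k \<in> N" for i s k
  proof (cases "k = i")
    case True
    then show ?thesis
      using that ideal_absorb(2)[of "ideal_span (S i)" s] by (simp add: ring_mod.span_base)
  next
    case False
    then have "\<psi> k dvd s * others i"
      using other that(3) by simp
    then show ?thesis
      by (rule ideal_dvd[OF _ \<psi>[OF that(3)], rotated]) simp
  qed
  then have 1: "f \<in> ideal_span (S k)" if "k \<in> N" for k
    using that by (intro subsetD[OF ring_mod.span_minimal f]) auto
  have "s * others i \<in> ideal_span {\<psi> k, \<psi> l}" if "k \<in> N" "l \<in> N" "k \<noteq> l" "i \<in> N" for i s k l
  proof -
    obtain m where m: "m \<in> {k, l}" "m \<noteq> i"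
      using \<open>k \<noteq> l\<close> by auto
    then have "\<psi> m dvd s * others i"
      using other that(1,2) by auto
    moreover have "\<psi> m \<in> ideal_span {\<psi> k, \<psi> l}"
      using m(1) by (auto intro: ring_mod.span_base)
    ultimately show ?thesis
      by (intro ideal_dvd[OF _ _ \<open>\<psi> m dvd s * others i\<close>]) simp_all
  qed
  then have 2: "f \<in> ideal_span {\<psi> k, \<psi> l}" if "k \<in> N" "l \<in> N" "k \<noteq> l" for k l
    using that by (intro subsetD[OF ring_mod.span_minimal f]) auto
  from 1 2 show "f \<in> ?R" by simp
next
  fix f assume f: "f \<in> ?R"
  obtain g where g: "f = (\<Sum>i\<in>N. g i * others i)"
    using in_pairs_imp_in_span[OF order_refl ne, of f] f by (auto simp: others_def)
  have L: "is_ideal ?L" by simp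
  have "g i * others i \<in> ?L" if i: "i \<in> N" for i
  proof -
    let ?J = "ideal_span (S i)"
    have J: "is_ideal ?J" by simp
    have rest: "(\<Sum>l\<in>N - {i}. g l * others l) \<in> ?J"
    proof (rule ring_mod.subspace_sum[OF J])
      fix l assume l: "l \<in> N - {i}"
      have "\<psi> i dvd others l"
        unfolding others_def using l i finite by (intro dvd_prodI) auto
      then show "g l * others l \<in> ?J"
        using ideal_dvd[OF J \<psi>[OF i]] by (simp add: dvd_mult)
    qed
    have split: "f = g i * others i + (\<Sum>l\<in>N - {i}. g l * others l)"
      unfolding g by (rule sum.remove[OF finite i])
    have "f \<in> ?J" using f i by simp
    then have "g i * others i \<in> ?J"
      unfolding split by (rule ideal_cancel_add[OF J _ rest])
    then have "others i * g i \<in> ?J"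
      by (simp only: mult.commute)
    moreover have "others i \<noteq> 0"
      unfolding others_def using finite nonzero by (simp add: mpoly_prod_eq_0_iff)
    moreover have "free_of e ?J" if "e \<in> vars (others i)" for e
    proof (rule free_of_ideal_span)
      have "vars (others i) \<subseteq> - vars (\<psi> i)"
        unfolding others_def using disjoint[OF i] by (intro vars_prod_subset) auto
      then show "e \<notin> vars s" if "s \<in> S i" for s
        using S[OF i that] \<open>e \<in> vars (others i)\<close> by blast
    qed
    ultimately have "g i \<in> ?J"
      using nonzero_divisor_mod_free_ideal[OF J] by blast
    then show "g i * others i \<in> ?L"
    proof (induction rule: ring_mod.span_induct_alt)
      case base
      then show ?case using ring_mod.span_zero by simp
    next
      case (step c x y)
      have "x * others i \<in> ?L"
        using step(1) i by (intro ring_mod.span_base) blast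
      from ring_mod.span_add[OF ring_mod.span_scale[OF this, of c] step(2)] show ?case
        by (simp add: algebra_simps)
    qed
  qed
  then show "f \<in> ?L"
    unfolding g by (rule ring_mod.subspace_sum[OF L])
qed

end

section \<open>Ideals of the rings \<open>\<bbbK>[x\<^sub>e | e \<in> F]\<close>\<close>

definition poly_sub :: "'e set \<Rightarrow> ('e, 'k::comm_ring_1) mpoly set" where
  "poly_sub F = {p. vars p \<subseteq> F}"

lemma in_poly_sub [simp]: "p \<in> poly_sub F \<longleftrightarrow> vars p \<subseteq> F"
  by (simp add: poly_sub_def)

lemma poly_ring_simps [simp]:
  "carrier (poly_ring F) = poly_sub F" "mult (poly_ring F) = (*)" "one (poly_ring F) = 1"
  "zero (poly_ring F) = 0" "add (poly_ring F) = (+)"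
  by (simp_all add: poly_ring_def poly_sub_def)

lemma ring_poly_ring: "ring (poly_ring F)"
  using cring_poly_ring by (rule cring.axioms)

lemma ideal_poly_ring:
  fixes J :: "('e, 'k::comm_ring_1) mpoly set"
  assumes "is_ideal J"
  shows "ideal (J \<inter> poly_sub F) (poly_ring F)"
proof (rule idealI[OF ring_poly_ring])
  let ?R = "poly_ring F :: ('e, 'k) mpoly ring"
  interpret R: ring ?R by (rule ring_poly_ring)
  show "subgroup (J \<inter> poly_sub F) (add_monoid ?R)"
  proof (rule R.add.subgroupI)
    fix a assume a: "a \<in> J \<inter> poly_sub F"
    have "\<ominus>\<^bsub>?R\<^esub> a = - a"
      using a by (intro R.minus_equality) (simp_all add: vars_simps)
    then show "\<ominus>\<^bsub>?R\<^esub> a \<in> J \<inter> poly_sub F"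
      using a ring_mod.subspace_neg[OF assms] by (simp add: vars_simps)
  next
    show "J \<inter> poly_sub F \<noteq> {}"
      using ring_mod.subspace_0[OF assms] by (force simp: vars_simps)
  next
    fix a b assume "a \<in> J \<inter> poly_sub F" "b \<in> J \<inter> poly_sub F"
    then show "a \<oplus>\<^bsub>?R\<^esub> b \<in> J \<inter> poly_sub F"
      by (simp add: ring_mod.subspace_add[OF assms] vars_add_subset)
  qed simp
qed (simp_all add: ideal_absorb[OF assms] vars_mult_subset)

text \<open>Applying the retraction to a combination of elements of \<open>S\<close> moves its coefficients into
  \<open>\<bbbK>[x\<^sub>e | e \<in> F]\<close>. Thus generated ideals may be computed in the ring of all polynomials.\<close>

lemma genideal_poly_ring:
  fixes S :: "('e, 'k::comm_ring_1) mpoly set"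
  assumes S: "S \<subseteq> poly_sub F"
  shows "Idl\<^bsub>poly_ring F\<^esub> S = ideal_span S \<inter> poly_sub F"
proof
  let ?R = "poly_ring F :: ('e, 'k) mpoly ring"
  interpret R: ring ?R by (rule ring_poly_ring)
  show "Idl\<^bsub>?R\<^esub> S \<subseteq> ideal_span S \<inter> poly_sub F"
    using S by (intro R.genideal_minimal ideal_poly_ring) (auto intro: ring_mod.span_base)
  interpret I: ideal "Idl\<^bsub>?R\<^esub> S" ?R
    using S by (intro R.genideal_ideal) simp
  have "restrict_vars F f \<in> Idl\<^bsub>?R\<^esub> S" if "f \<in> ideal_span S" for f
    using that
  proof (induction f rule: ring_mod.span_induct_alt)
    case base
    then show ?case using I.zero_closed by (simp add: restrict_vars.hom_zero)
  next
    case (step c x y)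
    have "x \<in> Idl\<^bsub>?R\<^esub> S" "restrict_vars F x = x"
      using R.genideal_self[of S] S step(1) restrict_vars_id[of x F] by auto
    then have "restrict_vars F (c * x) \<in> Idl\<^bsub>?R\<^esub> S"
      using I.I_l_closed[of x "restrict_vars F c"] vars_restrict_vars[of F c]
      by (simp add: restrict_vars.hom_mult)
    then show ?case
      using I.a_closed step(2) by (simp add: restrict_vars.hom_add)
  qed
  then show "ideal_span S \<inter> poly_sub F \<subseteq> Idl\<^bsub>?R\<^esub> S"
    using restrict_vars_id by (metis IntE in_poly_sub subsetI)
qed

lemma ideal_span_absorb:
  assumes "S \<subseteq> T" "T \<subseteq> ideal_span S"
  shows "ideal_span T = ideal_span S"
  using assms ring_mod.span_mono[OF assms(1)] ring_mod.span_minimal[OF assms(2)] by auto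

lemma ideal_span_insert_0: "ideal_span (insert 0 S) = ideal_span S"
  using ring_mod.span_superset[of S] ring_mod.span_zero by (intro ideal_span_absorb) auto

lemma times_rest_eq:
  assumes "F \<subseteq> E" "S \<subseteq> poly_sub F"
  shows "times_rest E F (ideal_span S \<inter> poly_sub F) = ideal_span S \<inter> poly_sub E"
proof -
  let ?T = "ideal_span S \<inter> poly_sub F \<union> {0}"
  have "F \<union> (E - F) = E" using assms(1) by blast
  moreover have "?T \<subseteq> poly_sub E"
    using assms(1) by (auto simp: vars_simps)
  moreover have "ideal_span ?T = ideal_span S"
    using assms(2) ring_mod.span_superset[of S] ring_mod.span_zero
    by (intro ideal_span_absorb) auto
  ultimately show ?thesis
    by (simp only: times_rest_def scheme_prod_def genideal_poly_ring)
qed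

lemma scheme_prod_eq:
  assumes "S \<subseteq> poly_sub F" "T \<subseteq> poly_sub G"
  shows "scheme_prod F (ideal_span S \<inter> poly_sub F) G (ideal_span T \<inter> poly_sub G) =
    ideal_span (S \<union> T) \<inter> poly_sub (F \<union> G)"
proof -
  let ?U = "ideal_span S \<inter> poly_sub F \<union> ideal_span T \<inter> poly_sub G"
  have "?U \<subseteq> poly_sub (F \<union> G)" by auto
  moreover have "ideal_span ?U = ideal_span (S \<union> T)"
    using assms ring_mod.span_superset[of S] ring_mod.span_superset[of T]
      ring_mod.span_mono[of S "S \<union> T"] ring_mod.span_mono[of T "S \<union> T"]
    by (intro ideal_span_absorb) auto
  ultimately show ?thesis
    by (simp only: scheme_prod_def genideal_poly_ring)
qed

lemma primeideal_poly_ring: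
  fixes J :: "('e, 'k::comm_ring_1) mpoly set"
  assumes "is_prime_ideal J"
  shows "primeideal (J \<inter> poly_sub F) (poly_ring F)"
proof (rule primeidealI[OF ideal_poly_ring cring_poly_ring])
  show "is_ideal J" by (rule is_prime_idealD(1)[OF assms])
  have "(1 :: ('e, 'k) mpoly) \<in> poly_sub F" by (simp add: vars_simps)
  then show "carrier (poly_ring F) \<noteq> J \<inter> poly_sub F"
    using is_prime_idealD(2)[OF assms] by (metis IntD1 poly_ring_simps(1))
qed (use is_prime_idealD(3)[OF assms] in auto)

lemma integral_scheme_prime:
  "is_prime_ideal J \<Longrightarrow> integral_scheme F (J \<inter> poly_sub F)"
  unfolding integral_scheme_def by (intro primeideal.quotient_is_domain primeideal_poly_ring)

lemma reduced_schemeI: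
  fixes J :: "('e, 'k::field) mpoly set"
  assumes J: "is_ideal J" and radical: "\<And>x k. x ^ k \<in> J \<Longrightarrow> x \<in> J"
  shows "reduced_scheme F (J \<inter> poly_sub F)"
proof -
  let ?R = "poly_ring F :: ('e, 'k) mpoly ring" and ?I = "J \<inter> poly_sub F"
  let ?h = "(+>\<^bsub>?R\<^esub>) ?I"
  interpret I: ideal ?I ?R by (rule ideal_poly_ring[OF J])
  have hom: "?h \<in> ring_hom ?R (?R Quot ?I)" by (rule I.rcos_ring_hom)
  have pow_closed: "x ^ k \<in> poly_sub F" if "x \<in> poly_sub F" for x :: "('e, 'k) mpoly" and k
    using that by (simp add: vars_power_subset)
  have pow: "?h x [^]\<^bsub>?R Quot ?I\<^esub> k = ?h (x ^ k)" if x: "x \<in> poly_sub F" for x and k :: nat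
  proof (induction k)
    case 0
    then show ?case using ring_hom_one[OF hom] by (simp add: nat_pow_def)
  next
    case (Suc k)
    then show ?case
      using ring_hom_mult[OF hom, of "x ^ k" x] x pow_closed[OF x, of k]
      by (simp add: nat_pow_def mult.commute)
  qed
  have "a = ?I" if a: "a \<in> carrier (?R Quot ?I)" "a [^]\<^bsub>?R Quot ?I\<^esub> k = ?I" for a and k :: nat
  proof -
    obtain x where x: "x \<in> poly_sub F" "a = ?h x"
      using a(1) by (auto simp: FactRing_def A_RCOSETS_def')
    then have "?h (x ^ k) = ?I"
      using a(2) pow by simp
    then have "x ^ k \<in> ?I"
      using I.rcos_const_imp_mem[of "x ^ k"] pow_closed[OF x(1)] by simp
    then have "x \<in> ?I"
      using radical x(1) by auto
    then show ?thesis
      using x(2) I.a_rcos_const by simp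
  qed
  then show ?thesis
    unfolding reduced_scheme_def Let_def by (simp add: FactRing_def)
qed

section \<open>Configurations over a direct sum of connected matroids\<close>

text \<open>The generators of the ideal \<open>J\<^sub>W\<close>.\<close>

definition jacobian_gens :: "'e set \<Rightarrow> ('e \<Rightarrow> 'k::field) list \<Rightarrow> ('e, 'k) mpoly set" where
  "jacobian_gens F ws = insert (config_poly F ws) {partial e (config_poly F ws) | e. e \<in> F}"

lemma jacobian_change_basis:
  fixes ws bs :: "('e \<Rightarrow> 'k::field) list"
  assumes "length ws = length bs" "set ws \<subseteq> fun_vs.span (set bs)"
  shows "ideal_span (jacobian_gens E ws) \<subseteq> ideal_span (jacobian_gens E bs)"
proof -
  obtain c where c: "config_poly E ws = Const c * config_poly E bs"
    using config_poly_change_basis[OF assms] by blast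
  have "s \<in> ideal_span (jacobian_gens E bs)" if s: "s \<in> jacobian_gens E ws" for s
  proof -
    obtain t where "t \<in> jacobian_gens E bs" "s = Const c * t"
      using s by (auto simp: jacobian_gens_def c partial_Const_mult)
    then show ?thesis
      by (simp add: ring_mod.span_scale ring_mod.span_base)
  qed
  then show ?thesis
    by (intro ring_mod.span_minimal) auto
qed

locale decomposed_configuration =
  fixes E :: "'e set" and Ind :: "'e set set"
    and n :: nat and Es :: "nat \<Rightarrow> 'e set" and Inds :: "nat \<Rightarrow> 'e set set"
    and W :: "('e \<Rightarrow> 'k::field) set" and Ws :: "nat \<Rightarrow> ('e \<Rightarrow> 'k) set"
    and ws :: "('e \<Rightarrow> 'k) list" and wss :: "nat \<Rightarrow> ('e \<Rightarrow> 'k) list"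
  assumes finite_E: "finite E"
    and loopless: "loopless E Ind"
    and realization: "realization E Ind W"
    and connected: "\<forall>i\<in>{1..n}. connected_matroid (Es i) (Inds i)"
    and direct_sum: "matroid_direct_sum {1..n} Es Inds E Ind"
    and Ws: "\<forall>i\<in>{1..n}. Ws i = W \<inter> coord_space (Es i)"
    and basis: "is_basis W ws"
    and bases: "\<forall>i\<in>{1..n}. is_basis (Ws i) (wss i)"
begin

abbreviation "N \<equiv> {1..n}"

lemma W: "fun_vs.subspace W" "W \<subseteq> coord_space E"
  using realization by (simp_all add: realization_def)

lemma Ind_iff: "S \<in> Ind \<longleftrightarrow> S \<subseteq> E \<and> coords_independent W S"
  using realization by (auto simp: realization_def)

lemma E_eq: "E = (\<Union>i\<in>N. Es i)" and disjoint: "disjoint_family_on Es N"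
  using direct_sum by (simp_all add: matroid_direct_sum_def)

lemma Es_subset: "i \<in> N \<Longrightarrow> Es i \<subseteq> E"
  using E_eq by blast

lemma finite_Es: "i \<in> N \<Longrightarrow> finite (Es i)"
  using Es_subset finite_E finite_subset by blast

lemma Es_disjoint: "i \<in> N \<Longrightarrow> j \<in> N \<Longrightarrow> i \<noteq> j \<Longrightarrow> Es i \<inter> Es j = {}"
  using disjoint by (auto simp: disjoint_family_on_def)

lemma Inds_matroid: "i \<in> N \<Longrightarrow> matroid (Es i) (Inds i)"
  using connected by (simp add: connected_matroid_def)

lemma Ind_glue: "(\<And>i. i \<in> N \<Longrightarrow> S i \<in> Inds i) \<Longrightarrow> (\<Union>i\<in>N. S i) \<in> Ind"
  using direct_sum unfolding matroid_direct_sum_def by blast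

lemma Ind_split:
  assumes "S \<in> Ind" "i \<in> N"
  shows "S \<inter> Es i \<in> Inds i"
proof -
  obtain T where T: "S = (\<Union>j\<in>N. T j)" "\<forall>j\<in>N. T j \<in> Inds j"
    using assms(1) direct_sum unfolding matroid_direct_sum_def by blast
  then have sub: "T j \<subseteq> Es j" if "j \<in> N" for j
    using Inds_matroid[OF that] T(2) that unfolding matroid_def by blast
  have "S \<inter> Es i = T i"
  proof (intro equalityI subsetI)
    fix e assume "e \<in> S \<inter> Es i"
    then obtain j where j: "j \<in> N" "e \<in> T j" "e \<in> Es i" using T(1) by blast
    then have "j = i" using sub[OF j(1)] Es_disjoint[OF j(1) assms(2)] by blast
    then show "e \<in> T i" using j by simp
  qed (use T(1) sub assms(2) in blast)
  then show ?thesis using T(2) assms(2) by simp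
qed

lemma Inds_iff:
  assumes "i \<in> N"
  shows "S \<in> Inds i \<longleftrightarrow> S \<subseteq> Es i \<and> coords_independent W S"
proof
  assume S: "S \<in> Inds i"
  have "(\<Union>j\<in>N. if j = i then S else {}) \<in> Ind"
    using S Inds_matroid by (intro Ind_glue) (auto simp: matroid_def)
  moreover have "(\<Union>j\<in>N. if j = i then S else {}) = S"
    using assms by (auto split: if_splits)
  ultimately show "S \<subseteq> Es i \<and> coords_independent W S"
    using S Inds_matroid[OF assms] Ind_iff by (auto simp: matroid_def)
next
  assume S: "S \<subseteq> Es i \<and> coords_independent W S"
  then have "S \<in> Ind" using Ind_iff Es_subset[OF assms] by auto
  then show "S \<in> Inds i"
    using Ind_split[OF _ assms, of S] S by (simp add: Int_absorb2)
qed

text \<open>A circuit of a direct sum lies in a single component: if \<open>e\<close> were independent of \<open>B \<inter> Es i\<close>,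
  gluing with the other parts of \<open>B\<close> would make \<open>insert e B\<close> independent.\<close>

lemma circuit_in_component:
  assumes B: "coord_basis W E B" and e: "i \<in> N" "e \<in> Es i" "e \<notin> B"
  shows "\<not> coords_independent W (insert e (B \<inter> Es i))"
proof
  assume "coords_independent W (insert e (B \<inter> Es i))"
  then have ei: "insert e (B \<inter> Es i) \<in> Inds i"
    using e Inds_iff by auto
  have "B \<in> Ind" using B Ind_iff by (simp add: coord_basis_def)
  then have "(\<Union>j\<in>N. if j = i then insert e (B \<inter> Es i) else B \<inter> Es j) \<in> Ind"
    using ei Ind_split by (intro Ind_glue) auto
  moreover have "(\<Union>j\<in>N. if j = i then insert e (B \<inter> Es i) else B \<inter> Es j) = insert e B"
    using e B E_eq by (auto simp: coord_basis_def split: if_splits)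
  ultimately have "coords_independent W (insert e B)"
    using Ind_iff by simp
  then show False
    using B e Es_subset by (auto simp: coord_basis_def)
qed

text \<open>A vector of the basis dual to \<open>B\<close> is supported on a single component, because every coordinate
  outside \<open>B\<close> depends only on those coordinates from \<open>B\<close> that belong to its own component. This is
  the reason why \<open>W\<close> is the sum of the \<open>Ws i\<close>.\<close>

lemma local_dual_basis:
  obtains B u where "coord_basis W E B"
    "\<And>i b. i \<in> N \<Longrightarrow> b \<in> B \<inter> Es i \<Longrightarrow> u b \<in> Ws i"
    "\<And>w. w \<in> W \<Longrightarrow> w = (\<Sum>b\<in>B. (\<lambda>x. w b * u b x))"
proof -
  have "coords_independent W {}" by (simp add: coords_independent_def)
  then obtain B where B: "coord_basis W E B"
    using coord_basis_extends[OF finite_E, of "{}"] by auto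
  obtain u where u: "\<And>b. b \<in> B \<Longrightarrow> u b \<in> W"
    "\<And>b c. b \<in> B \<Longrightarrow> c \<in> B \<Longrightarrow> u b c = (if b = c then 1 else 0)"
    "\<And>w. w \<in> W \<Longrightarrow> w = (\<Sum>b\<in>B. (\<lambda>x. w b * u b x))"
    using coord_basis_dual[OF W finite_E B] by blast
  have BE: "B \<subseteq> E" and indB: "coords_independent W B"
    using B by (simp_all add: coord_basis_def)
  have finB: "finite B" using BE finite_E by (rule finite_subset)
  have "u b \<in> Ws i" if i: "i \<in> N" and b: "b \<in> B \<inter> Es i" for i b
  proof -
    have "u b e = 0" if "e \<notin> Es i" for e
    proof (cases "e \<in> E")
      case False
      then show ?thesis using W(2) u(1) b by (auto simp: coord_space_def)
    next
      case True
      then obtain j where j: "j \<in> N" "e \<in> Es j" using E_eq by blast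
      with that have "j \<noteq> i" by auto
      then have b': "b \<notin> Es j" using Es_disjoint[OF i j(1)] b by blast
      show ?thesis
      proof (cases "e \<in> B")
        case True
        then show ?thesis using u(2)[of b e] b j(2) b' by auto
      next
        case False
        have "finite (B \<inter> Es j)" "coords_independent W (B \<inter> Es j)"
          using finB coords_independent_subset[OF indB _ finB] by auto
        then obtain c where c: "\<And>w. w \<in> W \<Longrightarrow> w e = (\<Sum>b\<in>B \<inter> Es j. c b * w b)"
          using circuit_relation[of "B \<inter> Es j" W e] circuit_in_component[OF B j False] False by blast
        have "u b e = (\<Sum>d\<in>B \<inter> Es j. c d * u b d)"
          using c u(1) b by blast
        also have "\<dots> = 0"
          using u(2)[of b] b b' by (intro sum.neutral) auto
        finally show ?thesis .
      qed
    qed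
    then show ?thesis
      using Ws i u(1) b by (auto simp: coord_space_def)
  qed
  with B u(3) show ?thesis using that by blast
qed

lemma Ws_facts:
  assumes "i \<in> N"
  shows "fun_vs.subspace (Ws i)" "Ws i \<subseteq> coord_space (Es i)" "Ws i \<subseteq> W"
proof -
  have "fun_vs.subspace (coord_space (Es i) :: ('e \<Rightarrow> 'k) set)"
    by (auto simp: fun_vs.subspace_def coord_space_def)
  then show "fun_vs.subspace (Ws i)"
    using Ws assms W(1) by (simp add: fun_vs.subspace_inter)
  show "Ws i \<subseteq> coord_space (Es i)" "Ws i \<subseteq> W"
    using Ws assms by auto
qed

lemma W_subset_span: "W \<subseteq> fun_vs.span (\<Union>i\<in>N. Ws i)"
proof
  fix w assume w: "w \<in> W"
  obtain B u where B: "coord_basis W E B" "\<And>i b. i \<in> N \<Longrightarrow> b \<in> B \<inter> Es i \<Longrightarrow> u b \<in> Ws i"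
    "\<And>w. w \<in> W \<Longrightarrow> w = (\<Sum>b\<in>B. (\<lambda>x. w b * u b x))"
    using local_dual_basis by blast
  have "u b \<in> fun_vs.span (\<Union>i\<in>N. Ws i)" if b: "b \<in> B" for b
  proof -
    have "b \<in> E" using B(1) b by (auto simp: coord_basis_def)
    then obtain i where "i \<in> N" "b \<in> Es i" using E_eq by blast
    with b B(2) show ?thesis by (intro fun_vs.span_base) blast
  qed
  then show "w \<in> fun_vs.span (\<Union>i\<in>N. Ws i)"
    by (subst B(3)[OF w]) (intro fun_vs.span_sum fun_vs.span_scale)
qed

lemma independent_in_component:
  assumes i: "i \<in> N" and S: "S \<subseteq> Es i"
  shows "coords_independent (Ws i) S \<longleftrightarrow> coords_independent W S"
proof -
  have "(\<forall>w\<in>W. (\<Sum>e\<in>S. c e * w e) = 0) \<longleftrightarrow> (\<forall>w\<in>Ws i. (\<Sum>e\<in>S. c e * w e) = 0)" for c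
  proof
    assume vanish: "\<forall>w\<in>Ws i. (\<Sum>e\<in>S. c e * w e) = 0"
    have "(\<Sum>e\<in>S. c e * w e) = 0" if w: "w \<in> Ws j" "j \<in> N" for w j
    proof (cases "j = i")
      case False
      have "w e = 0" if "e \<in> S" for e
        using that w(1) Ws_facts(2)[OF w(2)] Es_disjoint[OF i w(2)] False S
        by (auto simp: coord_space_def)
      then show ?thesis by simp
    qed (use vanish w in simp)
    then have "\<forall>w\<in>(\<Union>i\<in>N. Ws i). (\<Sum>e\<in>S. c e * w e) = 0"
      by blast
    from coords_vanish_on_span[OF this] show "\<forall>w\<in>W. (\<Sum>e\<in>S. c e * w e) = 0"
      using W_subset_span by (meson subsetD)
  qed (use Ws_facts(3)[OF i] in \<open>meson subsetD\<close>)
  then show ?thesis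
    by (simp add: coords_independent_def)
qed

text \<open>A basis of the matroid meets each component in a basis of the component.\<close>

lemma length_ws: "length ws = (\<Sum>i\<in>N. length (wss i))"
proof -
  obtain B where B: "coord_basis W E B"
    using coord_basis_extends[OF finite_E, of "{}" W] by (auto simp: coords_independent_def)
  have BE: "B \<subseteq> E" and indB: "coords_independent W B"
    using B by (simp_all add: coord_basis_def)
  have finB: "finite B" using BE finite_E by (rule finite_subset)
  have "card (B \<inter> Es i) = length (wss i)" if i: "i \<in> N" for i
  proof (rule card_coord_basis[OF Ws_facts(1,2)[OF i] finite_Es[OF i]])
    have "\<not> coords_independent (Ws i) (insert e (B \<inter> Es i))" if "e \<in> Es i - B \<inter> Es i" for e
      using circuit_in_component[OF B(1) i, of e] that independent_in_component[OF i, of "insert e (B \<inter> Es i)"]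
      by auto
    moreover have "coords_independent (Ws i) (B \<inter> Es i)"
      using independent_in_component[OF i, of "B \<inter> Es i"] coords_independent_subset[OF indB _ finB]
      by auto
    ultimately show "coord_basis (Ws i) (Es i) (B \<inter> Es i)"
      unfolding coord_basis_def by blast
  qed (use bases i in blast)
  moreover have "card B = (\<Sum>i\<in>N. card (B \<inter> Es i))"
  proof -
    have "B = (\<Union>i\<in>N. B \<inter> Es i)" using BE E_eq by blast
    then have "card B = card (\<Union>i\<in>N. B \<inter> Es i)" by simp
    also have "\<dots> = (\<Sum>i\<in>N. card (B \<inter> Es i))"
      using finB Es_disjoint by (intro card_UN_disjoint) blast+
    finally show ?thesis .
  qed
  ultimately show ?thesis
    using card_coord_basis[OF W finite_E B(1) basis] by simp
qed

definition \<psi> :: "nat \<Rightarrow> ('e, 'k) mpoly" where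
  "\<psi> i = config_poly (Es i) (wss i)"

lemma component:
  assumes i: "i \<in> N"
  shows "indecomposable (\<psi> i)" "vars (\<psi> i) = Es i" "lookup (\<psi> i) 0 = 0"
    "length (wss i) \<ge> 1"
proof -
  have "{S. S \<subseteq> Es i \<and> coords_independent (Ws i) S} = Inds i"
    using Inds_iff[OF i] independent_in_component[OF i] by auto
  then have conn: "connected_matroid (Es i) {S. S \<subseteq> Es i \<and> coords_independent (Ws i) S}"
    using connected i by simp
  have "coords_independent (Ws i) {e}" if e: "e \<in> Es i" for e
  proof -
    have "coords_independent W {e}"
      using loopless e Es_subset[OF i] Ind_iff by (auto simp: loopless_def)
    then show ?thesis
      using independent_in_component[OF i, of "{e}"] e by simp
  qed
  note * = connected_imp_indecomposable[OF Ws_facts(1,2)[OF i] finite_Es[OF i] _ conn this]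
  show "indecomposable (\<psi> i)" "vars (\<psi> i) = Es i" "lookup (\<psi> i) 0 = 0"
    "length (wss i) \<ge> 1"
    unfolding \<psi>_def using * bases i by blast+
qed

sublocale disjoint_primes N \<psi>
  using component Es_disjoint by unfold_locales auto

subsection \<open>The block-diagonal configuration matrix\<close>

definition partial_union :: "nat \<Rightarrow> 'e set" where
  "partial_union m = (\<Union>i\<in>{1..m}. Es i)"

text \<open>Bases of the \<open>Ws i\<close> are concatenated one at a time, so that two-block matrices suffice.\<close>

definition joint_basis :: "nat \<Rightarrow> ('e \<Rightarrow> 'k) list" where
  "joint_basis m = concat (map wss [1..<Suc m])"

lemma partial_union_Suc: "partial_union (Suc m) = partial_union m \<union> Es (Suc m)"
  by (simp add: partial_union_def atLeastAtMostSuc_conv Un_commute)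

lemma joint_basis_Suc: "joint_basis (Suc m) = joint_basis m @ wss (Suc m)"
  by (simp add: joint_basis_def)

lemma set_joint_basis: "set (joint_basis m) = (\<Union>i\<in>{1..m}. set (wss i))"
  by (simp add: joint_basis_def atLeastLessThanSuc_atLeastAtMost del: upt_Suc)

lemma set_wss: "i \<in> N \<Longrightarrow> set (wss i) \<subseteq> Ws i"
  using bases fun_vs.span_superset by (force simp: is_basis_def)

lemma config_matrix_joint_basis:
  assumes "Suc m \<le> n"
  shows "config_matrix (partial_union (Suc m)) (joint_basis (Suc m)) =
    block_diag (config_matrix (partial_union m) (joint_basis m))
      (config_matrix (Es (Suc m)) (wss (Suc m)))"
  unfolding partial_union_Suc joint_basis_Suc
proof (rule config_matrix_append)
  show "finite (partial_union m)" "finite (Es (Suc m))"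
    unfolding partial_union_def using finite_Es assms by auto
  show "partial_union m \<inter> Es (Suc m) = {}"
    unfolding partial_union_def using Es_disjoint[of _ "Suc m"] assms by fastforce
  show "set (wss (Suc m)) \<subseteq> coord_space (Es (Suc m))"
    using set_wss[of "Suc m"] Ws_facts(2)[of "Suc m"] assms by auto
  show "set (joint_basis m) \<subseteq> coord_space (partial_union m)"
  proof
    fix w assume "w \<in> set (joint_basis m)"
    then obtain i where "i \<in> {1..m}" "w \<in> set (wss i)"
      by (auto simp: set_joint_basis)
    then have "w \<in> coord_space (Es i)" "Es i \<subseteq> partial_union m"
      using set_wss[of i] Ws_facts(2)[of i] assms by (auto simp: partial_union_def)
    then show "w \<in> coord_space (partial_union m)"
      by (auto simp: coord_space_def)
  qed
qed

lemma config_poly_partial_union: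
  assumes "m \<le> n"
  shows "config_poly (partial_union m) (joint_basis m) = (\<Prod>i\<in>{1..m}. \<psi> i)"
  using assms
proof (induction m)
  case 0
  then show ?case
    by (simp add: config_poly_def config_matrix_def joint_basis_def)
next
  case (Suc m)
  have "config_poly (partial_union (Suc m)) (joint_basis (Suc m)) =
      config_poly (partial_union m) (joint_basis m) * config_poly (Es (Suc m)) (wss (Suc m))"
    unfolding config_poly_def config_matrix_joint_basis[OF Suc.prems]
    by (rule det_block_diag[OF config_matrix_carrier config_matrix_carrier])
  then show ?case
    using Suc by (simp add: \<psi>_def atLeastAtMostSuc_conv mult.commute)
qed

definition component_entries :: "nat \<Rightarrow> ('e, 'k) mpoly set" where
  "component_entries i = entries (adj_mat (config_matrix (Es i) (wss i)))"

lemma adj_entries_partial_union: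
  assumes "m \<le> n"
  shows "insert 0 (entries (adj_mat (config_matrix (partial_union m) (joint_basis m)))) =
    insert 0 {s * (\<Prod>j\<in>{1..m} - {i}. \<psi> j) | i s. i \<in> {1..m} \<and> s \<in> component_entries i}"
  using assms
proof (induction m)
  case 0
  then show ?case
    by (simp add: config_matrix_def joint_basis_def entries_def adj_mat_def)
next
  case (Suc m)
  let ?A = "config_matrix (partial_union m) (joint_basis m)"
  let ?B = "config_matrix (Es (Suc m)) (wss (Suc m))"
  let ?P = "\<lambda>m i. \<Prod>j\<in>{1..m} - {i}. \<psi> j"
  have detA: "det ?A = (\<Prod>i\<in>{1..m}. \<psi> i)"
    using config_poly_partial_union[of m] Suc.prems by (simp add: config_poly_def)
  have detB: "det ?B = \<psi> (Suc m)"
    by (simp add: \<psi>_def config_poly_def)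
  have nz: "det ?A \<noteq> 0" "det ?B \<noteq> 0"
    using Suc.prems nonzero by (auto simp: detA detB mpoly_prod_eq_0_iff)
  have "insert 0 (entries (adj_mat (config_matrix (partial_union (Suc m)) (joint_basis (Suc m))))) =
      insert 0 ((*) (det ?B) ` entries (adj_mat ?A) \<union> (*) (det ?A) ` entries (adj_mat ?B))"
    unfolding config_matrix_joint_basis[OF Suc.prems]
      adj_mat_block_diag[OF config_matrix_carrier config_matrix_carrier nz]
    using adj_mat(1)[OF config_matrix_carrier, of "partial_union m" "joint_basis m"]
      adj_mat(1)[OF config_matrix_carrier, of "Es (Suc m)" "wss (Suc m)"]
    by (subst entries_block_diag[of _ "length (joint_basis m)" _ "length (wss (Suc m))"]) (auto simp only: entries_smult smult_carrier_mat)
  also have "\<dots> = insert 0 ((*) (det ?B) ` insert 0 (entries (adj_mat ?A)) \<union> (*) (det ?A) ` entries (adj_mat ?B))"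
    by auto
  also have "\<dots> = insert 0 ((*) (det ?B) ` {s * ?P m i | i s. i \<in> {1..m} \<and> s \<in> component_entries i} \<union>
      (*) (det ?A) ` component_entries (Suc m))"
    using Suc by (simp add: component_entries_def)
  also have "(*) (det ?B) ` {s * ?P m i | i s. i \<in> {1..m} \<and> s \<in> component_entries i} =
      {s * ?P (Suc m) i | i s. i \<in> {1..m} \<and> s \<in> component_entries i}"
  proof -
    have "?P (Suc m) i = ?P m i * \<psi> (Suc m)" if "i \<in> {1..m}" for i
    proof -
      have "{1..Suc m} - {i} = insert (Suc m) ({1..m} - {i})" using that by auto
      then show ?thesis by (simp add: mult.commute)
    qed
    then have "\<psi> (Suc m) * (s * ?P m i) = s * ?P (Suc m) i" if "i \<in> {1..m}" for s i
      using that by (simp add: mult_ac)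
    then have step: "det ?B * (s * ?P m i) = s * ?P (Suc m) i" if "i \<in> {1..m}" for s i
      using that unfolding detB by blast
    show ?thesis
    proof (intro equalityI subsetI)
      fix x assume "x \<in> (*) (det ?B) ` {s * ?P m i | i s. i \<in> {1..m} \<and> s \<in> component_entries i}"
      then obtain i s where "i \<in> {1..m}" "s \<in> component_entries i" "x = det ?B * (s * ?P m i)"
        by blast
      with step[of i s] show "x \<in> {s * ?P (Suc m) i | i s. i \<in> {1..m} \<and> s \<in> component_entries i}"
        by blast
    next
      fix x assume "x \<in> {s * ?P (Suc m) i | i s. i \<in> {1..m} \<and> s \<in> component_entries i}"
      then obtain i s where "i \<in> {1..m}" "s \<in> component_entries i" "x = s * ?P (Suc m) i"
        by blast
      with step[of i s] show "x \<in> (*) (det ?B) ` {s * ?P m i | i s. i \<in> {1..m} \<and> s \<in> component_entries i}"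
        by (intro image_eqI[of _ _ "s * ?P m i"]) auto
    qed
  qed
  also have "(*) (det ?A) ` component_entries (Suc m) =
      {s * ?P (Suc m) i | i s. i = Suc m \<and> s \<in> component_entries i}"
  proof -
    have "{1..Suc m} - {Suc m} = {1..m}" by auto
    then show ?thesis
      unfolding detA by (auto simp: image_iff mult.commute)
  qed
  finally show ?case
    by (auto simp: le_Suc_eq)
qed

lemma partial_union_n: "partial_union n = E"
  by (simp add: partial_union_def E_eq)

lemma length_joint_basis: "length (joint_basis n) = length ws"
proof -
  have "length (joint_basis m) = (\<Sum>i\<in>{1..m}. length (wss i))" for m
    by (induction m) (simp_all add: joint_basis_Suc, simp add: joint_basis_def)
  then show ?thesis by (simp add: length_ws)
qed

lemma span_joint_basis: "fun_vs.span (set (joint_basis n)) = W"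
proof
  have "set (joint_basis n) \<subseteq> W"
    using set_wss Ws_facts(3) by (force simp: set_joint_basis)
  then show "fun_vs.span (set (joint_basis n)) \<subseteq> W"
    using W(1) by (rule fun_vs.span_minimal)
  have "Ws i \<subseteq> fun_vs.span (set (joint_basis n))" if "i \<in> N" for i
  proof -
    have "Ws i = fun_vs.span (set (wss i))" using bases that by (simp add: is_basis_def)
    also have "\<dots> \<subseteq> fun_vs.span (set (joint_basis n))"
      using that by (intro fun_vs.span_mono) (auto simp: set_joint_basis)
    finally show ?thesis .
  qed
  then have "fun_vs.span (\<Union>i\<in>N. Ws i) \<subseteq> fun_vs.span (set (joint_basis n))"
    by (intro fun_vs.span_minimal UN_least fun_vs.subspace_span)
  then show "W \<subseteq> fun_vs.span (set (joint_basis n))"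
    using W_subset_span by blast
qed

lemma same_span:
  "set ws \<subseteq> fun_vs.span (set (joint_basis n))" "set (joint_basis n) \<subseteq> fun_vs.span (set ws)"
  using basis span_joint_basis fun_vs.span_superset unfolding is_basis_def by blast+

definition \<Psi> :: "('e, 'k) mpoly" where
  "\<Psi> = (\<Prod>i\<in>N. \<psi> i)"

lemma config_poly_joint_basis: "config_poly E (joint_basis n) = \<Psi>"
  using config_poly_partial_union[of n] by (simp add: partial_union_n \<Psi>_def)

lemma \<Psi>_nonzero: "\<Psi> \<noteq> 0"
  using nonzero by (simp add: \<Psi>_def mpoly_prod_eq_0_iff)

lemma \<Psi>_eq: "i \<in> N \<Longrightarrow> \<Psi> = \<psi> i * others i"
  unfolding \<Psi>_def others_def by (rule prod.remove) simp_all

lemma config_poly_nonzero: "config_poly E ws \<noteq> 0"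
proof
  assume "config_poly E ws = 0"
  moreover obtain c where "config_poly E (joint_basis n) = Const c * config_poly E ws"
    using config_poly_change_basis[OF length_joint_basis same_span(2)] by blast
  ultimately show False
    using \<Psi>_nonzero config_poly_joint_basis by simp
qed

lemma ideal_span_config_poly: "ideal_span {config_poly E ws} = ideal_span {\<Psi>}"
proof -
  obtain c where c: "config_poly E ws = Const c * \<Psi>"
    using config_poly_change_basis[OF length_joint_basis[symmetric] same_span(1)]
      config_poly_joint_basis by metis
  obtain d where d: "\<Psi> = Const d * config_poly E ws"
    using config_poly_change_basis[OF length_joint_basis same_span(2)]
      config_poly_joint_basis by metis
  have "\<Psi> dvd config_poly E ws" "config_poly E ws dvd \<Psi>"
    by (subst c, simp) (subst d, simp)
  then show ?thesis
    by (auto simp: ideal_span_singleton intro: dvd_trans)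
qed

text \<open>On \<open>Es i\<close>, the product rule differentiates only the factor \<open>\<psi> i\<close> of \<open>\<Psi>\<close>. For \<open>n = 0\<close> the
  left-hand side is the unit ideal and the right-hand side is \<open>{0}\<close>.\<close>

lemma jacobian_ideal:
  assumes "n \<ge> 1"
  shows "ideal_span (jacobian_gens E ws) =
    ideal_span {s * others i | i s. i \<in> N \<and> s \<in> jacobian_gens (Es i) (wss i)}"
proof -
  have "ideal_span (jacobian_gens E ws) = ideal_span (jacobian_gens E (joint_basis n))"
    using jacobian_change_basis[OF length_joint_basis same_span(2)]
      jacobian_change_basis[OF length_joint_basis[symmetric] same_span(1)] by blast
  moreover have "jacobian_gens E (joint_basis n) =
      {s * others i | i s. i \<in> N \<and> s \<in> jacobian_gens (Es i) (wss i)}"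
  proof -
    have deriv: "partial e \<Psi> = partial e (\<psi> i) * others i" if i: "i \<in> N" "e \<in> Es i" for i e
    proof -
      have "vars (others i) \<subseteq> - Es i"
        unfolding others_def using component(2) Es_disjoint[OF i(1)]
        by (intro vars_prod_subset) auto
      then have "partial e (others i) = 0"
        using i(2) by (intro partial_no_var) auto
      then show ?thesis
        by (simp add: \<Psi>_eq[OF i(1)] partial_mult)
    qed
    have "jacobian_gens E (joint_basis n) = insert \<Psi> {partial e \<Psi> | e. e \<in> E}"
      by (simp add: jacobian_gens_def config_poly_joint_basis)
    also have "\<dots> = (\<Union>i\<in>N. insert \<Psi> {partial e \<Psi> | e. e \<in> Es i})"
      using assms E_eq by auto
    also have "\<dots> = (\<Union>i\<in>N. (\<lambda>s. s * others i) ` insert (\<psi> i) {partial e (\<psi> i) | e. e \<in> Es i})"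
    proof (rule SUP_cong[OF refl])
      fix i assume i: "i \<in> N"
      show "insert \<Psi> {partial e \<Psi> | e. e \<in> Es i} =
          (\<lambda>s. s * others i) ` insert (\<psi> i) {partial e (\<psi> i) | e. e \<in> Es i}"
        using \<Psi>_eq[OF i] deriv[OF i] by (auto simp: image_iff) metis+
    qed
    also have "\<dots> = {s * others i | i s. i \<in> N \<and> s \<in> jacobian_gens (Es i) (wss i)}"
      unfolding jacobian_gens_def \<psi>_def by blast
    finally show ?thesis .
  qed
  ultimately show ?thesis by simp
qed

lemma minor_ideal_joint:
  "minor_ideal E ws = ideal_span {s * others i | i s. i \<in> N \<and> s \<in> component_entries i}"
proof -
  have "minor_ideal E ws = minor_ideal E (joint_basis n)"
    using minor_ideal_change_basis[OF length_joint_basis same_span(2)]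
      minor_ideal_change_basis[OF length_joint_basis[symmetric] same_span(1)]
      config_poly_nonzero \<Psi>_nonzero config_poly_joint_basis by (metis subset_antisym)
  also have "\<dots> = ideal_span (insert 0 (entries (adj_mat (config_matrix E (joint_basis n)))))"
    by (simp add: minor_ideal_def ideal_span_insert_0)
  also have "\<dots> = ideal_span {s * others i | i s. i \<in> N \<and> s \<in> component_entries i}"
    using adj_entries_partial_union[OF order_refl, unfolded partial_union_n, folded others_def]
    by (simp only: ideal_span_insert_0)
  finally show ?thesis .
qed

section \<open>The schemes of a configuration\<close>

lemma X_scheme_eq: "X_scheme E ws = ideal_span {\<Psi>} \<inter> poly_sub E"
  unfolding X_scheme_def ideal_span_config_poly[symmetric]
  using vars_config_poly[OF finite_E] by (intro genideal_poly_ring) simp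

lemma vars_\<psi>: "i \<in> N \<Longrightarrow> vars (\<psi> i) \<subseteq> Es i"
  by (simp add: component(2))

lemma X_component:
  assumes "i \<in> N"
  shows "X_scheme (Es i) (wss i) = ideal_span {\<psi> i} \<inter> poly_sub (Es i)"
  unfolding X_scheme_def \<psi>_def[symmetric]
  using vars_\<psi>[OF assms] by (intro genideal_poly_ring) simp

lemma X_component_cylinder:
  assumes "i \<in> N"
  shows "times_rest E (Es i) (X_scheme (Es i) (wss i)) = ideal_span {\<psi> i} \<inter> poly_sub E"
  unfolding X_component[OF assms]
  using vars_\<psi>[OF assms] Es_subset[OF assms] by (intro times_rest_eq) auto

lemma X_pair_cylinder:
  assumes "i \<in> N" "j \<in> N"
  shows "times_rest E (Es i \<union> Es j)
      (scheme_prod (Es i) (X_scheme (Es i) (wss i)) (Es j) (X_scheme (Es j) (wss j))) =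
    ideal_span {\<psi> i, \<psi> j} \<inter> poly_sub E"
proof -
  have "scheme_prod (Es i) (X_scheme (Es i) (wss i)) (Es j) (X_scheme (Es j) (wss j)) =
      ideal_span ({\<psi> i} \<union> {\<psi> j}) \<inter> poly_sub (Es i \<union> Es j)"
    unfolding X_component[OF assms(1)] X_component[OF assms(2)]
    using assms vars_\<psi> by (intro scheme_prod_eq) auto
  then show ?thesis
    using vars_\<psi>[OF assms(1)] vars_\<psi>[OF assms(2)] Es_subset[OF assms(1)] Es_subset[OF assms(2)]
    by (simp only: Un_insert_left Un_empty_left) (intro times_rest_eq, auto)
qed

lemma jacobian_gens_subset: "finite F \<Longrightarrow> jacobian_gens F vs \<subseteq> poly_sub F"
  unfolding jacobian_gens_def using vars_config_poly[of F vs] vars_partial by fastforce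

lemma Sigma_scheme_eq:
  assumes "finite F"
  shows "Sigma_scheme F vs = ideal_span (jacobian_gens F vs) \<inter> poly_sub F"
  unfolding Sigma_scheme_def jacobian_gens_def[symmetric]
  using jacobian_gens_subset[OF assms] by (rule genideal_poly_ring)

end

text \<open>The retraction commutes with determinants and fixes the entries.\<close>

lemma vars_det:
  fixes M :: "('e, 'k::comm_ring_1) mpoly mat"
  assumes "\<And>i j. i < dim_row M \<Longrightarrow> j < dim_col M \<Longrightarrow> vars (M $$ (i, j)) \<subseteq> F"
  shows "vars (det M) \<subseteq> F"
proof -
  have "map_mat (restrict_vars F) M = M"
    using assms by (intro eq_matI) (simp_all add: restrict_vars_id)
  then have "det M = restrict_vars F (det M)"
    by (metis restrict_vars.hom_det)
  then show ?thesis
    by (metis vars_restrict_vars)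
qed

lemma vars_minor:
  assumes "i < length vs" "j < length vs"
  shows "vars (det (mat_delete (config_matrix F vs) i j)) \<subseteq> F"
proof (rule vars_det)
  fix a b
  assume "a < dim_row (mat_delete (config_matrix F vs) i j)"
    and "b < dim_col (mat_delete (config_matrix F vs) i j)"
  then have "\<exists>c d. c < length vs \<and> d < length vs \<and>
      mat_delete (config_matrix F vs) i j $$ (a, b) = config_matrix F vs $$ (c, d)"
    by (intro exI[of _ "if a < i then a else Suc a"] exI[of _ "if b < j then b else Suc b"])
       (auto simp: mat_delete_def config_matrix_def)
  moreover have "vars (config_matrix F vs $$ (c, d)) \<subseteq> F" if "c < length vs" "d < length vs" for c d
    using that unfolding config_matrix_def by (simp, intro vars_sum_subset vars_mult_subset) auto
  ultimately show "vars (mat_delete (config_matrix F vs) i j $$ (a, b)) \<subseteq> F"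
    by metis
qed

lemma vars_adj_entries:
  fixes vs :: "('e \<Rightarrow> 'k::field) list"
  assumes "s \<in> entries (adj_mat (config_matrix F vs))"
  shows "vars s \<subseteq> F"
proof -
  obtain i j where "i < length vs" "j < length vs"
    "s = (- 1) ^ (j + i) * det (mat_delete (config_matrix F vs) j i)"
    using assms by (auto simp: entries_def adj_mat_def cofactor_def config_matrix_def)
  moreover have "vars ((- 1) ^ (j + i) :: ('e, 'k) mpoly) \<subseteq> F"
    by (intro vars_power_subset) (simp add: vars_simps)
  ultimately show ?thesis
    using vars_minor[of j vs i F] by (simp add: vars_mult_subset)
qed

text \<open>Laplace expansion along the first row.\<close>

lemma config_poly_in_minor_ideal:
  assumes "length vs \<ge> 1"
  shows "config_poly F vs \<in> minor_ideal F vs"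
proof -
  let ?C = "config_matrix F vs"
  have "cofactor ?C 0 j \<in> minor_ideal F vs" if "j < length vs" for j
  proof -
    have "0 < length vs" using assms by linarith
    moreover have "dim_row ?C = length vs" "dim_col ?C = length vs"
      by (simp_all add: config_matrix_def)
    ultimately have "adj_mat ?C $$ (j, 0) \<in> entries (adj_mat ?C)" "adj_mat ?C $$ (j, 0) = cofactor ?C 0 j"
      using that entriesI[of j "adj_mat ?C" 0] by (simp_all add: adj_mat_def)
    then show ?thesis
      unfolding minor_ideal_def by (metis ring_mod.span_base)
  qed
  then have "(\<Sum>j<length vs. ?C $$ (0, j) * cofactor ?C 0 j) \<in> minor_ideal F vs"
    unfolding minor_ideal_def by (intro ring_mod.span_sum ring_mod.span_scale) auto
  moreover have "0 < length vs" using assms by linarith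
  ultimately show ?thesis
    unfolding config_poly_def by (subst laplace_expansion_row[OF config_matrix_carrier])
qed

lemma ideal_span_UNIV: "1 \<in> ideal_span S \<Longrightarrow> ideal_span S = UNIV"
  using ring_mod.span_scale[of 1 S] by auto

lemma Delta_scheme_eq:
  assumes "length vs \<ge> 1"
  shows "Delta_scheme F vs = minor_ideal F vs \<inter> poly_sub F"
proof -
  let ?C = "config_matrix F vs"
  let ?M = "{det (mat_delete ?C i j) | i j. i < length vs \<and> j < length vs}"
  have minors: "minor_ideal F vs = ideal_span ?M"
    unfolding minor_ideal_def by (rule ideal_span_minors[symmetric]) simp
  show ?thesis
  proof (cases "length vs = 1")
    case True
    have "mat_delete ?C 0 0 \<in> carrier_mat 0 0"
      using mat_delete_carrier[OF config_matrix_carrier, of F vs 0 0] True by simp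
    then have "det (mat_delete ?C 0 0) = 1"
      by (rule det_dim_zero)
    then have "1 \<in> ?M" using assms by force
    then have "minor_ideal F vs = UNIV"
      unfolding minors by (intro ideal_span_UNIV ring_mod.span_base)
    then show ?thesis using True by (simp add: Delta_scheme_def)
  next
    case False
    then have "\<not> length vs \<le> 1" using assms by simp
    moreover have "?M \<subseteq> poly_sub F"
    proof
      fix s assume "s \<in> ?M"
      then obtain i j where "i < length vs" "j < length vs" "s = det (mat_delete ?C i j)"
        by blast
      then show "s \<in> poly_sub F" by (simp add: vars_minor)
    qed
    ultimately show ?thesis
      unfolding Delta_scheme_def minors by (simp only: if_False genideal_poly_ring)
  qed
qed

context decomposed_configuration
begin

lemma component_integral:
  "i \<in> N \<Longrightarrow> integral_scheme E (times_rest E (Es i) (X_scheme (Es i) (wss i)))"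
  by (simp only: X_component_cylinder integral_scheme_prime prime_single)

lemma pair_integral:
  "i \<in> N \<Longrightarrow> j \<in> N \<Longrightarrow> i \<noteq> j \<Longrightarrow> integral_scheme E (times_rest E (Es i \<union> Es j)
     (scheme_prod (Es i) (X_scheme (Es i) (wss i)) (Es j) (X_scheme (Es j) (wss j))))"
  by (metis X_pair_cylinder integral_scheme_prime prime_pair)

lemma in_span_\<Psi>_iff: "f \<in> ideal_span {\<Psi>} \<longleftrightarrow> (\<forall>i\<in>N. f \<in> ideal_span {\<psi> i})"
  unfolding ideal_span_singleton \<Psi>_def by (rule prod_dvd_iff) simp

lemma vars_\<psi>_E: "i \<in> N \<Longrightarrow> vars (\<psi> i) \<subseteq> E"
  using vars_\<psi> Es_subset by blast

lemma X_reduced: "reduced_scheme E (X_scheme E ws)"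
  unfolding X_scheme_eq
proof (rule reduced_schemeI)
  fix x k assume "x ^ k \<in> ideal_span {\<Psi>}"
  then show "x \<in> ideal_span {\<Psi>}"
    unfolding in_span_\<Psi>_iff using prime_ideal_power[OF prime_single] by blast
qed simp

lemma X_union:
  "X_scheme E ws = scheme_union E {times_rest E (Es i) (X_scheme (Es i) (wss i)) | i. i \<in> N}"
proof -
  have eq: "{times_rest E (Es i) (X_scheme (Es i) (wss i)) | i. i \<in> N} =
      (\<lambda>i. ideal_span {\<psi> i} \<inter> poly_sub E) ` N"
    unfolding Setcompr_eq_image Collect_mem_eq by (rule image_cong[OF refl X_component_cylinder])
  show ?thesis
    unfolding eq
  proof (rule Set.set_eqI)
    fix f
    show "f \<in> X_scheme E ws \<longleftrightarrow> f \<in> scheme_union E ((\<lambda>i. ideal_span {\<psi> i} \<inter> poly_sub E) ` N)"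
      unfolding X_scheme_eq scheme_union_def by (auto simp: in_span_\<Psi>_iff)
  qed
qed

text \<open>For \<open>J i\<close> the ideal of a scheme in the \<open>i\<close>-th component of the hypersurface, this is the ideal of
  the union of these schemes and of the pairwise intersections of the components.\<close>

definition local_ideal :: "(nat \<Rightarrow> ('e, 'k) mpoly set) \<Rightarrow> ('e, 'k) mpoly set" where
  "local_ideal J = {f. (\<forall>i\<in>N. f \<in> J i) \<and> (\<forall>i\<in>N. \<forall>j\<in>N. i \<noteq> j \<longrightarrow> f \<in> ideal_span {\<psi> i, \<psi> j})}"

abbreviation pair_cylinders :: "('e, 'k) mpoly set set" where
  "pair_cylinders \<equiv> {times_rest E (Es i \<union> Es j)
       (scheme_prod (Es i) (X_scheme (Es i) (wss i)) (Es j) (X_scheme (Es j) (wss j)))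
     | i j. i \<in> N \<and> j \<in> N \<and> i \<noteq> j}"

lemma local_ideal_union:
  assumes J: "\<And>i. i \<in> N \<Longrightarrow> times_rest E (Es i) (Y i) = J i \<inter> poly_sub E"
  shows "local_ideal J \<inter> poly_sub E =
    scheme_union E
      ({times_rest E (Es i) (Y i) | i. i \<in> N} \<union> pair_cylinders)"
    (is "_ = scheme_union E (?A \<union> ?B)")
proof -
  have A: "(\<forall>I\<in>?A. f \<in> I) \<longleftrightarrow> (\<forall>i\<in>N. f \<in> J i \<inter> poly_sub E)" for f
  proof -
    have "(\<forall>I\<in>?A. f \<in> I) \<longleftrightarrow> (\<forall>i\<in>N. f \<in> times_rest E (Es i) (Y i))" by blast
    also have "\<dots> \<longleftrightarrow> (\<forall>i\<in>N. f \<in> J i \<inter> poly_sub E)"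
      by (rule ball_cong[OF refl]) (simp only: J)
    finally show ?thesis .
  qed
  have B: "(\<forall>I\<in>?B. f \<in> I) \<longleftrightarrow>
      (\<forall>i\<in>N. \<forall>j\<in>N. i \<noteq> j \<longrightarrow> f \<in> ideal_span {\<psi> i, \<psi> j} \<inter> poly_sub E)" for f
  proof -
    have "(\<forall>I\<in>?B. f \<in> I) \<longleftrightarrow> (\<forall>i\<in>N. \<forall>j\<in>N. i \<noteq> j \<longrightarrow> f \<in> times_rest E (Es i \<union> Es j)
        (scheme_prod (Es i) (X_scheme (Es i) (wss i)) (Es j) (X_scheme (Es j) (wss j))))" by blast
    also have "\<dots> \<longleftrightarrow> (\<forall>i\<in>N. \<forall>j\<in>N. i \<noteq> j \<longrightarrow> f \<in> ideal_span {\<psi> i, \<psi> j} \<inter> poly_sub E)"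
      by (intro ball_cong refl imp_cong) (simp only: X_pair_cylinder)
    finally show ?thesis .
  qed
  have "f \<in> local_ideal J \<inter> poly_sub E \<longleftrightarrow> f \<in> scheme_union E (?A \<union> ?B)" for f
  proof -
    have "f \<in> scheme_union E (?A \<union> ?B) \<longleftrightarrow> f \<in> poly_sub E \<and> (\<forall>I\<in>?A. f \<in> I) \<and> (\<forall>I\<in>?B. f \<in> I)"
      unfolding scheme_union_def poly_ring_simps by blast
    also have "\<dots> \<longleftrightarrow> f \<in> local_ideal J \<inter> poly_sub E"
      unfolding A B local_ideal_def by blast
    finally show ?thesis by blast
  qed
  then show ?thesis by blast
qed

lemma N_empty:
  assumes "n = 0"
  shows "E = {}" "local_ideal J = UNIV" "length ws = 0" "\<Psi> = 1"
proof -
  have N: "N = {}" using assms by simp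
  show "E = {}" "local_ideal J = UNIV" "length ws = 0" "\<Psi> = 1"
    unfolding E_eq local_ideal_def length_ws \<Psi>_def N by simp_all
qed

lemma jacobian_local:
  "ideal_span (jacobian_gens E ws) = local_ideal (\<lambda>i. ideal_span (jacobian_gens (Es i) (wss i)))"
proof (cases "n = 0")
  case True
  have "ideal_span {config_poly E ws} \<subseteq> ideal_span (jacobian_gens E ws)"
    by (intro ring_mod.span_mono) (simp add: jacobian_gens_def)
  then have "1 \<in> ideal_span (jacobian_gens E ws)"
    unfolding ideal_span_config_poly N_empty(4)[OF True] using ring_mod.span_base by blast
  then show ?thesis
    using N_empty(2)[OF True] by (simp add: ideal_span_UNIV)
next
  case False
  have "vars s \<subseteq> vars (\<psi> i)" if "i \<in> N" "s \<in> jacobian_gens (Es i) (wss i)" for i s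
    using that jacobian_gens_subset[OF finite_Es] component(2) by (metis in_poly_sub subsetD)
  moreover have "\<psi> i \<in> ideal_span (jacobian_gens (Es i) (wss i))" for i
    by (intro ring_mod.span_base) (simp add: jacobian_gens_def \<psi>_def)
  ultimately show ?thesis
    using False unfolding local_ideal_def
    by (subst jacobian_ideal, simp) (rule intersection_eq_span_products; simp)
qed

lemma minor_local:
  assumes "n \<noteq> 0"
  shows "minor_ideal E ws = local_ideal (\<lambda>i. minor_ideal (Es i) (wss i))"
proof -
  have sub: "vars s \<subseteq> vars (\<psi> i)" if "i \<in> N" "s \<in> component_entries i" for i s
    using that vars_adj_entries component(2) unfolding component_entries_def by metis
  have mem: "\<psi> i \<in> ideal_span (component_entries i)" if "i \<in> N" for i
    using config_poly_in_minor_ideal[OF component(4)[OF that], of "Es i"]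
    by (simp add: \<psi>_def minor_ideal_def component_entries_def)
  have "N \<noteq> {}" using assms by simp
  from intersection_eq_span_products[OF this sub mem] show ?thesis
    unfolding minor_ideal_joint local_ideal_def
    unfolding minor_ideal_def component_entries_def[symmetric] .
qed

lemma Sigma_union:
  "Sigma_scheme E ws =
     scheme_union E
       ({times_rest E (Es i) (Sigma_scheme (Es i) (wss i)) | i. i \<in> N} \<union> pair_cylinders)"
proof -
  have "times_rest E (Es i) (Sigma_scheme (Es i) (wss i)) =
      ideal_span (jacobian_gens (Es i) (wss i)) \<inter> poly_sub E" if "i \<in> N" for i
    unfolding Sigma_scheme_eq[OF finite_Es[OF that]]
    by (rule times_rest_eq[OF Es_subset[OF that] jacobian_gens_subset[OF finite_Es[OF that]]])
  from local_ideal_union[OF this] show ?thesis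
    unfolding Sigma_scheme_eq[OF finite_E] jacobian_local .
qed

lemma Delta_union:
  "Delta_scheme E ws =
     scheme_union E
       ({times_rest E (Es i) (Delta_scheme (Es i) (wss i)) | i. i \<in> N} \<union> pair_cylinders)"
proof -
  have rest: "times_rest E (Es i) (Delta_scheme (Es i) (wss i)) =
      minor_ideal (Es i) (wss i) \<inter> poly_sub E" if "i \<in> N" for i
  proof -
    have "entries (adj_mat (config_matrix (Es i) (wss i))) \<subseteq> poly_sub (Es i)"
      using vars_adj_entries by (metis in_poly_sub subsetI)
    then show ?thesis
      unfolding Delta_scheme_eq[OF component(4)[OF that]] minor_ideal_def
      by (rule times_rest_eq[OF Es_subset[OF that]])
  qed
  have "Delta_scheme E ws = local_ideal (\<lambda>i. minor_ideal (Es i) (wss i)) \<inter> poly_sub E"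
  proof (cases "n = 0")
    case True
    then show ?thesis
      using N_empty by (simp add: Delta_scheme_def)
  next
    case False
    then have "1 \<in> N" by simp
    then have "length (wss 1) \<le> length ws"
      unfolding length_ws by (intro member_le_sum) auto
    then have "length ws \<ge> 1"
      using component(4)[OF \<open>1 \<in> N\<close>] by linarith
    then show ?thesis
      by (simp only: Delta_scheme_eq minor_local[OF False])
  qed
  also note local_ideal_union[OF rest]
  finally show ?thesis .
qed

text \<open>The smooth locus contains the points at which some partial derivative of the configuration
  polynomial does not vanish. It is dense because it contains the generic point \<open>(\<psi> i)\<close> of every component:
  for \<open>e\<close> in \<open>Es i\<close>, the derivative \<open>partial e (\<psi> i) * others i\<close> of \<open>\<Psi>\<close> has no factor divisible by \<open>\<psi> i\<close>,
  and the Jacobian ideal contains it.\<close>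

lemma X_generically_smooth: "generically_smooth E (X_scheme E ws)"
proof -
  let ?R = "poly_ring E :: ('e, 'k) mpoly ring" and ?p = "config_poly E ws"
  let ?D = "{partial e ?p | e. e \<in> E}"
  let ?U = "{P \<in> scheme_points E (X_scheme E ws). \<not> ?D \<subseteq> P}"
  interpret R: cring ?R by (rule cring_poly_ring)
  have gens: "insert ?p ?D \<subseteq> poly_sub E"
    using jacobian_gens_subset[OF finite_E, of ws] by (simp add: jacobian_gens_def)
  have X: "X_scheme E ws = Idl\<^bsub>?R\<^esub> {?p}"
    by (simp add: X_scheme_def)
  have p_X: "?p \<in> X_scheme E ws"
    unfolding X using gens by (intro R.genideal_self') simp
  have U_open: "scheme_open E (X_scheme E ws) ?U"
    unfolding scheme_open_def using gens by (intro exI[of _ ?D]) auto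
  have smooth: "smooth_at E (X_scheme E ws) P" if "P \<in> ?U" for P
  proof -
    from that obtain e where P: "primeideal P ?R" and e: "e \<in> E" "partial e ?p \<notin> P"
      by (auto simp: scheme_points_def)
    interpret P: primeideal P ?R by (rule P)
    have one: "1 \<in> poly_sub E - P"
      using P.one_imp_carrier P.I_notcarr by (auto simp: vars_simps)
    have "a \<in> P" if "a \<in> poly_sub E" "a * partial e ?p \<in> P" for a
      using P.I_prime[of a "partial e ?p"] that gens e by auto
    then show ?thesis
      unfolding smooth_at_def X using e p_X[unfolded X] one
      by (intro exI[of _ "[?p]"]) (auto intro!: bexI[of _ 1])
  qed
  \<comment> \<open>An open set meeting the component of \<open>\<psi> i\<close> contains its generic point.\<close>
  have dense: "?U \<inter> V \<noteq> {}" if V: "scheme_open E (X_scheme E ws) V" "V \<noteq> {}" for V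
  proof -
    obtain S where S: "V = {P \<in> scheme_points E (X_scheme E ws). \<not> S \<subseteq> P}"
      using V(1) by (auto simp: scheme_open_def)
    with V(2) obtain P where P: "primeideal P ?R" "X_scheme E ws \<subseteq> P" "\<not> S \<subseteq> P"
      by (auto simp: scheme_points_def)
    interpret P: primeideal P ?R by (rule P(1))
    have prod_P: "\<exists>i\<in>M. \<psi> i \<in> P" if "M \<subseteq> N" "(\<Prod>i\<in>M. \<psi> i) \<in> P" for M
    proof -
      have "finite M" using that(1) finite by (rule finite_subset)
      then show ?thesis using that
      proof (induction M rule: finite_induct)
        case empty
        then show ?case using P.one_imp_carrier P.I_notcarr by simp
      next
        case (insert i M)
        have "vars (\<psi> i) \<subseteq> E" "vars (\<Prod>i\<in>M. \<psi> i) \<subseteq> E"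
          using insert.prems(1) by (auto intro!: vars_prod_subset vars_\<psi>_E)
        then show ?case
          using P.I_prime[of "\<psi> i" "\<Prod>i\<in>M. \<psi> i"] insert by auto
      qed
    qed
    have "vars \<Psi> \<subseteq> E"
      unfolding \<Psi>_def by (intro vars_prod_subset vars_\<psi>_E)
    then have "\<Psi> \<in> P"
      using P(2) ring_mod.span_base[of \<Psi> "{\<Psi>}"] by (auto simp: X_scheme_eq)
    then obtain i where i: "i \<in> N" "\<psi> i \<in> P"
      using prod_P[of N] by (auto simp: \<Psi>_def)
    note \<psi>E = vars_\<psi>_E[OF i(1)]
    let ?P = "ideal_span {\<psi> i} \<inter> poly_sub E"
    have "?P = Idl\<^bsub>?R\<^esub> {\<psi> i}"
      using \<psi>E by (intro genideal_poly_ring[symmetric]) simp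
    also have "\<dots> \<subseteq> P"
      using i(2) P.is_ideal by (intro R.genideal_minimal) auto
    finally have "\<not> S \<subseteq> ?P" using P(3) by blast
    moreover have "?P \<in> scheme_points E (X_scheme E ws)"
      unfolding scheme_points_def X_scheme_eq
      using primeideal_poly_ring[OF prime_single[OF i(1)]] in_span_\<Psi>_iff i(1) by blast
    moreover have "\<not> ?D \<subseteq> ?P"
    proof
      assume "?D \<subseteq> ?P"
      moreover have "?p \<in> ideal_span {\<psi> i}"
        using ring_mod.span_base[of ?p "{?p}"] i(1)
        unfolding ideal_span_config_poly in_span_\<Psi>_iff by simp
      ultimately have "ideal_span (jacobian_gens E ws) \<subseteq> ideal_span {\<psi> i}"
        by (intro ring_mod.span_minimal) (auto simp: jacobian_gens_def)
      moreover obtain e where e: "e \<in> Es i"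
        using vars_nonempty[OF i(1)] component(2)[OF i(1)] by blast
      moreover have "partial e (\<psi> i) * others i \<in> ideal_span (jacobian_gens E ws)"
      proof -
        have "partial e (\<psi> i) \<in> jacobian_gens (Es i) (wss i)"
          using e by (auto simp: jacobian_gens_def \<psi>_def)
        then show ?thesis
          using i(1) by (subst jacobian_ideal) (auto intro!: ring_mod.span_base)
      qed
      ultimately have "partial e (\<psi> i) * others i \<in> ideal_span {\<psi> i}" by blast
      then consider "\<psi> i dvd partial e (\<psi> i)" | "others i \<in> ideal_span {\<psi> i}"
        using is_prime_idealD(3)[OF prime_single[OF i(1)]] ideal_span_singleton by blast
      then show False
      proof cases
        case 1
        then show False
          using multiaffine_not_dvd_partial[of "\<psi> i" e] component(1,2)[OF i(1)] e
          by (auto simp: indecomposable_def)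
      next
        case 2
        then obtain j where "j \<in> N - {i}" "\<psi> j \<in> ideal_span {\<psi> i}"
          unfolding others_def using prime_ideal_prod[OF prime_single[OF i(1)], of "N - {i}" \<psi>] by blast
        then show False
          using not_in_span_others[of j "{i}"] i(1) by auto
      qed
    qed
    ultimately have "?P \<in> ?U \<inter> V"
      unfolding S by blast
    then show ?thesis by blast
  qed
  show ?thesis
    unfolding generically_smooth_def using U_open dense smooth by blast
qed

end

theorem theorem4p16:
  fixes E :: "'e set" and Ind :: "'e set set"
    and n :: nat and Es :: "nat \<Rightarrow> 'e set" and Inds :: "nat \<Rightarrow> 'e set set"
    and W :: "('e \<Rightarrow> 'k::field) set" and Ws :: "nat \<Rightarrow> ('e \<Rightarrow> 'k) set"
    and ws :: "('e \<Rightarrow> 'k) list" and wss :: "nat \<Rightarrow> ('e \<Rightarrow> 'k) list"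
  assumes "finite E"
    and "matroid E Ind"
    and "loopless E Ind"
    and "realization E Ind W"
    and "\<forall>i\<in>{1..n}. connected_matroid (Es i) (Inds i)"
    and "matroid_direct_sum {1..n} Es Inds E Ind"
    and "\<forall>i\<in>{1..n}. Ws i = W \<inter> coord_space (Es i)"
    and "is_basis W ws"
    and "\<forall>i\<in>{1..n}. is_basis (Ws i) (wss i)"
  shows
    "(\<forall>i\<in>{1..n}. integral_scheme E (times_rest E (Es i) (X_scheme (Es i) (wss i)))) \<and>
     reduced_scheme E (X_scheme E ws) \<and>
     X_scheme E ws =
       scheme_union E {times_rest E (Es i) (X_scheme (Es i) (wss i)) | i. i \<in> {1..n}} \<and>
     (\<forall>i\<in>{1..n}. \<forall>j\<in>{1..n}. i \<noteq> j \<longrightarrow>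
       integral_scheme E (times_rest E (Es i \<union> Es j)
         (scheme_prod (Es i) (X_scheme (Es i) (wss i)) (Es j) (X_scheme (Es j) (wss j))))) \<and>
     Sigma_scheme E ws =
       scheme_union E
         ({times_rest E (Es i) (Sigma_scheme (Es i) (wss i)) | i. i \<in> {1..n}} \<union>
          {times_rest E (Es i \<union> Es j)
             (scheme_prod (Es i) (X_scheme (Es i) (wss i)) (Es j) (X_scheme (Es j) (wss j)))
           | i j. i \<in> {1..n} \<and> j \<in> {1..n} \<and> i \<noteq> j}) \<and>
     Delta_scheme E ws =
       scheme_union E
         ({times_rest E (Es i) (Delta_scheme (Es i) (wss i)) | i. i \<in> {1..n}} \<union>
          {times_rest E (Es i \<union> Es j)
             (scheme_prod (Es i) (X_scheme (Es i) (wss i)) (Es j) (X_scheme (Es j) (wss j)))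
           | i j. i \<in> {1..n} \<and> j \<in> {1..n} \<and> i \<noteq> j}) \<and>
     generically_smooth E (X_scheme E ws)"
proof -
  interpret decomposed_configuration E Ind n Es Inds W Ws ws wss
    using assms by unfold_locales
  show ?thesis
    using component_integral X_reduced X_union pair_integral Sigma_union Delta_union
      X_generically_smooth by blast
qed

end
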